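(* Let $\mathbb{M}$ be a weight sequence satisfying (dc) (that is, $\widehat{\mathbb{M}}$ is a regular sequence) with $\gamma(\mathbb{M})>0$, and let $\gamma>0$ be given. Each of the following statements implies the next one: (i) $\gamma<\gamma(\mathbb{M})$. (ii) There exists an optimal $\{\mathbb{M}\}$-flat function in $\widetilde{\mathcal{A}}^u_{\{\mathbb{M}\}}(S_\gamma)$. (iii) There exists $c>0$ such that for every $A>0$ there exists a linear continuous map $T_{\mathbb{M},A}\colon\mathbb{C}[[z]]_{\mathbb{M},A}\to\widetilde{\mathcal{A}}^u_{\mathbb{M},cA}(S_\gamma)$ such that $\widetilde{\mathcal{B}}\circ T_{\mathbb{M},A}$ is the identity map in $\mathbb{C}[[z]]_{\mathbb{M},A}$. (iv) The Borel map $\widetilde{\mathcal{B}}\colon\widetilde{\mathcal{A}}^u_{\{\mathbb{M}\}}(S_\gamma)\to\mathbb{C}[[z]]_{\{\mathbb{M}\}}$ is surjective; in other words, $(0,\gamma]\subset\widetilde{S}^u_{\{\mathbb{M}\}}$. (v) $(0,\gamma)\subset S_{\{\widehat{\mathbb{M}}\}}$. (vi) $\gamma\le\gamma(\mathbb{M})$.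
   Context: A weight sequence is a sequence $\mathbb{M}=(M_p)_{p\in\mathbb{N}_0}$ of positive real numbers with $M_0=1$, logarithmically convex ($M_p^2\le M_{p-1}M_{p+1}$, $p\ge1$), and such that $m_p:=M_{p+1}/M_p\to\infty$. Condition (dc): there is $D>0$ with $M_{p+1}\le D^{p+1}M_p$ for all $p\in\mathbb{N}_0$. $\widehat{\mathbb{M}}:=(p!M_p)_{p\in\mathbb{N}_0}$; if $\mathbb{M}$ is a weight sequence satisfying (dc), $\widehat{\mathbb{M}}$ is called regular. Index: $(c_p)_p$ is almost increasing if there is $a>0$ with $c_p\le a\,c_q$ for all $q\ge p$. $\gamma(\mathbb{M}):=\sup\{\gamma>0:(m_p/(p+1)^\gamma)_{p}\text{ is almost increasing}\}\in[0,\infty]$ ($\sup\emptyset=0$). Sectors: $\mathcal{R}$ is the Riemann surface of the logarithm, $S_\gamma:=\{z\in\mathcal{R}:|\arg z|<\gamma\pi/2\}$. Classes (for $S$ an unbounded sector and $A>0$): $\widetilde{\mathcal{A}}^u_{\mathbb{M},A}(S)$ is the Banach space of holomorphic $f\colon S\to\mathbb{C}$ for which there is a formal series $\widehat f=\sum_{n\ge0}a_nz^n\in\mathbb{C}[[z]]$ (its uniform $\mathbb{M}$-asymptotic expansion) with finite norm $\sup_{z\in S,\,p\in\mathbb{N}_0}\frac{|f(z)-\sum_{k=0}^{p-1}a_kz^k|}{A^pM_p|z|^p}$; $\widetilde{\mathcal{A}}^u_{\{\mathbb{M}\}}(S):=\bigcup_{A>0}\widetilde{\mathcal{A}}^u_{\mathbb{M},A}(S)$.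 $\mathcal{A}_{\widehat{\mathbb{M}},A}(S)$ is the space of holomorphic $f$ on $S$ with $\sup_{z\in S,\,p\in\mathbb{N}_0}\frac{|f^{(p)}(z)|}{A^pp!M_p}<\infty$, and $\mathcal{A}_{\{\widehat{\mathbb{M}}\}}(S):=\bigcup_{A>0}\mathcal{A}_{\widehat{\mathbb{M}},A}(S)$; one has $\mathcal{A}_{\{\widehat{\mathbb{M}}\}}(S)\subseteq\widetilde{\mathcal{A}}^u_{\{\mathbb{M}\}}(S)$, with $a_p=\frac{1}{p!}\lim_{z\to0,z\in S}f^{(p)}(z)$. $\mathbb{C}[[z]]_{\mathbb{M},A}$ is the Banach space of formal series $\sum a_pz^p$ with finite norm $\sup_p\frac{|a_p|}{A^pM_p}$; $\mathbb{C}[[z]]_{\{\mathbb{M}\}}:=\bigcup_{A>0}\mathbb{C}[[z]]_{\mathbb{M},A}$. The asymptotic Borel map $\widetilde{\mathcal{B}}$ sends $f$ to its asymptotic expansion $\widehat f$. Surjectivity intervals: $S_{\{\widehat{\mathbb{M}}\}}:=\{\gamma>0:\widetilde{\mathcal{B}}\colon\mathcal{A}_{\{\widehat{\mathbb{M}}\}}(S_\gamma)\to\mathbb{C}[[z]]_{\{\mathbb{M}\}}\text{ is surjective}\}$ and $\widetilde{S}^u_{\{\mathbb{M}\}}:=\{\gamma>0:\widetilde{\mathcal{B}}\colon\widetilde{\mathcal{A}}^u_{\{\mathbb{M}\}}(S_\gamma)\to\mathbb{C}[[z]]_{\{\mathbb{M}\}}\text{ is surjective}\}$. Optimal flat function: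 with $h_{\mathbb{M}}(t):=\inf_{p\in\mathbb{N}_0}M_pt^p$, $t>0$, a holomorphic $G\colon S\to\mathbb{C}$ on an unbounded sector $S$ bisected by direction $0$ is an optimal $\{\mathbb{M}\}$-flat function in $S$ if there are $K_1,K_2,K_3,K_4>0$ with $K_1h_{\mathbb{M}}(K_2x)\le G(x)$ for all $x>0$ and $|G(z)|\le K_3h_{\mathbb{M}}(K_4|z|)$ for all $z\in S$ (such $G$ automatically belongs to $\widetilde{\mathcal{A}}^u_{\{\mathbb{M}\}}(S)$, with null expansion). *)

theory Defs
  imports "HOL-Complex_Analysis.Complex_Analysis"
begin

section \<open>Weight sequences\<close>

definition weight_sequence :: "(nat \<Rightarrow> real) \<Rightarrow> bool" where
  "weight_sequence M \<longleftrightarrow>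
     M 0 = 1 \<and> (\<forall>p. 0 < M p) \<and>
     (\<forall>p\<ge>1. (M p)\<^sup>2 \<le> M (p - 1) * M (p + 1)) \<and>
     filterlim (\<lambda>p. M (p + 1) / M p) at_top sequentially"

definition cond_dc :: "(nat \<Rightarrow> real) \<Rightarrow> bool" where
  "cond_dc M \<longleftrightarrow> (\<exists>D>0. \<forall>p. M (p + 1) \<le> D ^ (p + 1) * M p)"

definition hat_seq :: "(nat \<Rightarrow> real) \<Rightarrow> nat \<Rightarrow> real" where
  "hat_seq M p = fact p * M p"

definition almost_increasing :: "(nat \<Rightarrow> real) \<Rightarrow> bool" where
  "almost_increasing c \<longleftrightarrow> (\<exists>a>0. \<forall>p q. p \<le> q \<longrightarrow> c p \<le> a * c q)"

text \<open>In \<^typ>\<open>ennreal\<close> the supremum of the empty set is \<open>0\<close>.\<close>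

definition gamma_index :: "(nat \<Rightarrow> real) \<Rightarrow> ennreal" where
  "gamma_index M =
     (SUP \<gamma> \<in> {\<gamma>. 0 < \<gamma> \<and>
        almost_increasing (\<lambda>p. (M (p + 1) / M p) / real (p + 1) powr \<gamma>)}. ennreal \<gamma>)"

definition h_fun :: "(nat \<Rightarrow> real) \<Rightarrow> real \<Rightarrow> real" where
  "h_fun M t = (INF p. M p * t ^ p)"


section \<open>The Riemann surface of the logarithm\<close>

text \<open>
  A point \<open>z\<close> of the Riemann surface of the logarithm is represented by its logarithm
  \<open>ln |z| + i arg z\<close>, which is a global chart onto the complex plane. The covering map to the
  punctured plane is then the exponential function. Holomorphy and derivatives are taken with
  respect to \<open>z\<close>, i.e. with respect to the covering map; the lemmas below express them in the
  logarithmic chart.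
\<close>

type_synonym rlog = complex

definition rl_proj :: "rlog \<Rightarrow> complex" where
  "rl_proj z = exp z"

definition rl_abs :: "rlog \<Rightarrow> real" where
  "rl_abs z = cmod (rl_proj z)"

definition rl_arg :: "rlog \<Rightarrow> real" where
  "rl_arg z = Im z"

text \<open>The point of argument \<open>0\<close> over the positive real number \<open>x\<close>.\<close>

definition rl_of_pos :: "real \<Rightarrow> rlog" where
  "rl_of_pos x = complex_of_real (ln x)"

definition rl_has_deriv :: "(rlog \<Rightarrow> complex) \<Rightarrow> complex \<Rightarrow> rlog \<Rightarrow> bool" where
  "rl_has_deriv f D z \<longleftrightarrow>
     ((\<lambda>w. (f w - f z) / (rl_proj w - rl_proj z)) \<longlongrightarrow> D) (at z)"

definition rl_deriv :: "(rlog \<Rightarrow> complex) \<Rightarrow> rlog \<Rightarrow> complex" where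
  "rl_deriv f z = (THE D. rl_has_deriv f D z)"

definition rl_holomorphic_on :: "(rlog \<Rightarrow> complex) \<Rightarrow> rlog set \<Rightarrow> bool" where
  "rl_holomorphic_on f S \<longleftrightarrow> (\<forall>z\<in>S. \<exists>D. rl_has_deriv f D z)"

definition sector :: "real \<Rightarrow> rlog set" where
  "sector \<gamma> = {z. \<bar>rl_arg z\<bar> < \<gamma> * pi / 2}"

lemma rl_abs_pos: "0 < rl_abs z"
  by (simp add: rl_abs_def rl_proj_def)

lemma rl_proj_of_pos: "0 < x \<Longrightarrow> rl_proj (rl_of_pos x) = complex_of_real x"
  by (simp add: rl_proj_def rl_of_pos_def exp_of_real)

lemma rl_abs_of_pos: "0 < x \<Longrightarrow> rl_abs (rl_of_pos x) = x"
  by (simp add: rl_abs_def rl_proj_of_pos)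

lemma rl_of_pos_in_sector: "0 < \<gamma> \<Longrightarrow> rl_of_pos x \<in> sector \<gamma>"
  by (simp add: sector_def rl_arg_def rl_of_pos_def)

lemma open_sector: "open (sector \<gamma>)"
  unfolding sector_def rl_arg_def by (intro open_Collect_less continuous_intros)

lemma rl_has_deriv_unique: "rl_has_deriv f D z \<Longrightarrow> rl_has_deriv f E z \<Longrightarrow> D = E"
  unfolding rl_has_deriv_def by (rule tendsto_unique[OF trivial_limit_at])

lemma rl_has_deriv_iff:
  "rl_has_deriv f D z \<longleftrightarrow> (f has_field_derivative (D * exp z)) (at z)"
proof -
  have e: "((\<lambda>w. (exp w - exp z) / (w - z)) \<longlongrightarrow> exp z) (at z)"
    using DERIV_exp[of z] by (simp add: has_field_derivative_iff)
  have nz: "\<forall>\<^sub>F w in at z. exp w \<noteq> exp z"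
  proof -
    have "\<forall>\<^sub>F w in at z. (exp w - exp z) / (w - z) \<noteq> 0"
      by (rule tendsto_imp_eventually_ne[OF e]) simp
    then show ?thesis by eventually_elim auto
  qed
  have nz': "\<forall>\<^sub>F w in at z. w \<noteq> z"
    by (simp add: eventually_at_filter)
  show ?thesis
  proof
    assume "rl_has_deriv f D z"
    from tendsto_mult[OF this[unfolded rl_has_deriv_def rl_proj_def] e]
    have "((\<lambda>w. (f w - f z) / (w - z)) \<longlongrightarrow> D * exp z) (at z)"
      by (rule Lim_transform_eventually) (use nz in eventually_elim, simp)
    then show "(f has_field_derivative (D * exp z)) (at z)"
      by (simp add: has_field_derivative_iff)
  next
    assume "(f has_field_derivative (D * exp z)) (at z)"
    then have "((\<lambda>w. (f w - f z) / (w - z)) \<longlongrightarrow> D * exp z) (at z)"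
      by (simp add: has_field_derivative_iff)
    from tendsto_divide[OF this e exp_not_eq_zero]
    have "((\<lambda>w. (f w - f z) / (exp w - exp z)) \<longlongrightarrow> D * exp z / exp z) (at z)"
      by (rule Lim_transform_eventually) (use nz nz' in eventually_elim, simp)
    then show "rl_has_deriv f D z"
      by (simp add: rl_has_deriv_def rl_proj_def)
  qed
qed

lemma rl_deriv_eq:
  assumes "f field_differentiable (at z)"
  shows "rl_deriv f z = deriv f z / exp z"
proof -
  have "rl_has_deriv f (deriv f z / exp z) z"
    using assms by (simp add: rl_has_deriv_iff DERIV_deriv_iff_field_differentiable)
  then show ?thesis
    unfolding rl_deriv_def by (rule the_equality) (erule rl_has_deriv_unique, fact)
qed

lemma rl_holomorphic_on_iff:
  assumes "open S"
  shows "rl_holomorphic_on f S \<longleftrightarrow> f holomorphic_on S"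
proof -
  have "(\<exists>D. rl_has_deriv f D z) \<longleftrightarrow> f field_differentiable (at z within S)" if "z \<in> S" for z
  proof
    assume "\<exists>D. rl_has_deriv f D z"
    then show "f field_differentiable (at z within S)"
      unfolding rl_has_deriv_iff at_within_open[OF that assms] field_differentiable_def by blast
  next
    assume "f field_differentiable (at z within S)"
    then have "(f has_field_derivative (deriv f z / exp z * exp z)) (at z)"
      by (simp add: at_within_open[OF that assms] DERIV_deriv_iff_field_differentiable)
    then show "\<exists>D. rl_has_deriv f D z"
      unfolding rl_has_deriv_iff by (rule exI)
  qed
  then show ?thesis
    unfolding rl_holomorphic_on_def holomorphic_on_def by (rule ball_cong[OF refl])
qed


section \<open>Classes of functions and of formal power series\<close>

text \<open>
  Functions on \<open>S\<close> are total functions of which only the values on \<open>S\<close> are relevant. The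
  quotient below is the one whose supremum over \<open>z \<in> S\<close> and \<open>p\<close> is the norm of the class of
  functions with uniform asymptotic expansion \<open>F\<close>.
\<close>

definition asymp_quot ::
    "(nat \<Rightarrow> real) \<Rightarrow> real \<Rightarrow> (rlog \<Rightarrow> complex) \<Rightarrow> complex fps \<Rightarrow> rlog \<times> nat \<Rightarrow> real" where
  "asymp_quot M A f F = (\<lambda>(z, p).
     cmod (f z - (\<Sum>k<p. fps_nth F k * rl_proj z ^ k)) / (A ^ p * M p * rl_abs z ^ p))"

definition has_unif_expansion ::
    "(nat \<Rightarrow> real) \<Rightarrow> real \<Rightarrow> rlog set \<Rightarrow> (rlog \<Rightarrow> complex) \<Rightarrow> complex fps \<Rightarrow> bool" where
  "has_unif_expansion M A S f F \<longleftrightarrow> bdd_above (asymp_quot M A f F ` (S \<times> UNIV))"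

definition Au_class :: "(nat \<Rightarrow> real) \<Rightarrow> real \<Rightarrow> rlog set \<Rightarrow> (rlog \<Rightarrow> complex) set" where
  "Au_class M A S = {f. rl_holomorphic_on f S \<and> (\<exists>F. has_unif_expansion M A S f F)}"

definition Au_union :: "(nat \<Rightarrow> real) \<Rightarrow> rlog set \<Rightarrow> (rlog \<Rightarrow> complex) set" where
  "Au_union M S = (\<Union>A\<in>{0<..}. Au_class M A S)"

text \<open>Uniqueness of the expansion in sectors is shown in \<open>has_unif_expansion_unique\<close> below.\<close>

definition borel_map :: "(nat \<Rightarrow> real) \<Rightarrow> rlog set \<Rightarrow> (rlog \<Rightarrow> complex) \<Rightarrow> complex fps" where
  "borel_map M S f = (THE F. \<exists>A>0. has_unif_expansion M A S f F)"

definition Au_norm :: "(nat \<Rightarrow> real) \<Rightarrow> real \<Rightarrow> rlog set \<Rightarrow> (rlog \<Rightarrow> complex) \<Rightarrow> real" where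
  "Au_norm M A S f = (SUP zp \<in> S \<times> UNIV. asymp_quot M A f (borel_map M S f) zp)"

text \<open>In the next two definitions \<open>N\<close> is the full weight, to be taken as \<^term>\<open>hat_seq M\<close>.\<close>

definition A_class :: "(nat \<Rightarrow> real) \<Rightarrow> real \<Rightarrow> rlog set \<Rightarrow> (rlog \<Rightarrow> complex) set" where
  "A_class N A S = {f. rl_holomorphic_on f S \<and>
     bdd_above ((\<lambda>(z, p). cmod ((rl_deriv ^^ p) f z) / (A ^ p * N p)) ` (S \<times> UNIV))}"

definition A_union :: "(nat \<Rightarrow> real) \<Rightarrow> rlog set \<Rightarrow> (rlog \<Rightarrow> complex) set" where
  "A_union N S = (\<Union>A\<in>{0<..}. A_class N A S)"

definition series_class :: "(nat \<Rightarrow> real) \<Rightarrow> real \<Rightarrow> complex fps set" where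
  "series_class M A = {F. bdd_above (range (\<lambda>p. cmod (fps_nth F p) / (A ^ p * M p)))}"

definition series_norm :: "(nat \<Rightarrow> real) \<Rightarrow> real \<Rightarrow> complex fps \<Rightarrow> real" where
  "series_norm M A F = (SUP p. cmod (fps_nth F p) / (A ^ p * M p))"

definition series_union :: "(nat \<Rightarrow> real) \<Rightarrow> complex fps set" where
  "series_union M = (\<Union>A\<in>{0<..}. series_class M A)"

lemma has_unif_expansion_unique:
  assumes "0 < \<gamma>" and M: "\<And>p. 0 < M p" and "0 < A" "0 < B"
    and F: "has_unif_expansion M A (sector \<gamma>) f F"
    and G: "has_unif_expansion M B (sector \<gamma>) f G"
  shows "F = G"
proof (rule ccontr)
  assume "F \<noteq> G"
  define k where "k = (LEAST k. fps_nth F k \<noteq> fps_nth G k)"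
  from \<open>F \<noteq> G\<close> have "\<exists>k. fps_nth F k \<noteq> fps_nth G k"
    by (auto simp: fps_eq_iff)
  then have k: "fps_nth F k \<noteq> fps_nth G k"
    unfolding k_def by (rule LeastI_ex)
  have less: "fps_nth F j = fps_nth G j" if "j < k" for j
    using not_less_Least[of j "\<lambda>k. fps_nth F k \<noteq> fps_nth G k"] that by (simp add: k_def)
  define P where "P H x = (\<Sum>j<Suc k. fps_nth H j * complex_of_real x ^ j)" for H x
  have bound: "\<exists>C\<ge>0. \<forall>x>0. cmod (f (rl_of_pos x) - P H x) \<le> C * x ^ Suc k"
    if H: "has_unif_expansion M E (sector \<gamma>) f H" and "0 < E" for E H
  proof -
    from H obtain C where "\<forall>y\<in>asymp_quot M E f H ` (sector \<gamma> \<times> UNIV). y \<le> C"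
      unfolding has_unif_expansion_def bdd_above_def ..
    then have C: "asymp_quot M E f H (z, p) \<le> C" if "z \<in> sector \<gamma>" for z p
      using that by blast
    have "cmod (f (rl_of_pos x) - P H x) \<le> \<bar>C\<bar> * (E ^ Suc k * M (Suc k)) * x ^ Suc k"
      if "0 < x" for x
    proof -
      let ?d = "E ^ Suc k * M (Suc k) * x ^ Suc k"
      have d: "0 < ?d" using \<open>0 < E\<close> M that by simp
      have "cmod (f (rl_of_pos x) - P H x) / ?d \<le> \<bar>C\<bar>"
        using C[OF rl_of_pos_in_sector[OF \<open>0 < \<gamma>\<close>], of x "Suc k"] that
        unfolding asymp_quot_def P_def by (simp add: rl_proj_of_pos rl_abs_of_pos)
      then have "cmod (f (rl_of_pos x) - P H x) \<le> \<bar>C\<bar> * ?d"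
        using d by (simp only: pos_divide_le_eq)
      then show ?thesis by (simp only: mult.assoc)
    qed
    moreover have "0 \<le> \<bar>C\<bar> * (E ^ Suc k * M (Suc k))"
      using \<open>0 < E\<close> M[of "Suc k"] by simp
    ultimately show ?thesis by blast
  qed
  obtain C1 where C1: "C1 \<ge> 0" "\<And>x. 0 < x \<Longrightarrow> cmod (f (rl_of_pos x) - P F x) \<le> C1 * x ^ Suc k"
    using bound[OF F \<open>0 < A\<close>] by blast
  obtain C2 where C2: "C2 \<ge> 0" "\<And>x. 0 < x \<Longrightarrow> cmod (f (rl_of_pos x) - P G x) \<le> C2 * x ^ Suc k"
    using bound[OF G \<open>0 < B\<close>] by blast
  define d where "d = cmod (fps_nth F k - fps_nth G k)"
  have "0 < d" using k by (simp add: d_def)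
  have le: "d \<le> (C1 + C2) * x" if "0 < x" for x
  proof -
    have "P F x - P G x = (fps_nth F k - fps_nth G k) * complex_of_real x ^ k"
      using less by (simp add: P_def algebra_simps)
    then have "d * x ^ k = cmod (P F x - P G x)"
      using that by (simp add: d_def norm_mult norm_power)
    also have "\<dots> \<le> cmod (f (rl_of_pos x) - P G x) + cmod (f (rl_of_pos x) - P F x)"
      using norm_triangle_ineq4[of "f (rl_of_pos x) - P G x" "f (rl_of_pos x) - P F x"] by simp
    also have "\<dots> \<le> (C1 + C2) * x * x ^ k"
      using C1(2)[OF that] C2(2)[OF that] by (simp add: algebra_simps)
    finally show ?thesis using that by simp
  qed
  define x where "x = d / (2 * (C1 + C2 + 1))"
  have "0 < x" using \<open>0 < d\<close> C1(1) C2(1) by (simp add: x_def)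
  have "(C1 + C2) * x \<le> (C1 + C2 + 1) * x" using \<open>0 < x\<close> by (simp add: algebra_simps)
  also have "\<dots> = d / 2" using C1(1) C2(1) by (simp add: x_def field_simps)
  finally show False using le[OF \<open>0 < x\<close>] \<open>0 < d\<close> by simp
qed

lemma borel_map_eqI:
  assumes "0 < \<gamma>" "\<And>p. 0 < M p" "0 < A" "has_unif_expansion M A (sector \<gamma>) f F"
  shows "borel_map M (sector \<gamma>) f = F"
  unfolding borel_map_def
proof (rule the_equality)
  show "\<exists>A>0. has_unif_expansion M A (sector \<gamma>) f F"
    using assms(3,4) by blast
next
  fix G
  assume "\<exists>A>0. has_unif_expansion M A (sector \<gamma>) f G"
  then obtain B where "0 < B" "has_unif_expansion M B (sector \<gamma>) f G"
    by blast
  from has_unif_expansion_unique[OF assms(1,2) this(1) assms(3) this(2) assms(4)]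
  show "G = F" .
qed


section \<open>Flat functions, extension operators and surjectivity intervals\<close>

text \<open>The lower bound comprises the assertion that \<open>G\<close> is real on the direction \<open>0\<close>.\<close>

definition optimal_flat :: "(nat \<Rightarrow> real) \<Rightarrow> rlog set \<Rightarrow> (rlog \<Rightarrow> complex) \<Rightarrow> bool" where
  "optimal_flat M S G \<longleftrightarrow> rl_holomorphic_on G S \<and>
     (\<exists>K1>0. \<exists>K2>0. \<exists>K3>0. \<exists>K4>0.
        (\<forall>x>0. G (rl_of_pos x) \<in> \<real> \<and> K1 * h_fun M (K2 * x) \<le> Re (G (rl_of_pos x))) \<and>
        (\<forall>z\<in>S. cmod (G z) \<le> K3 * h_fun M (K4 * rl_abs z)))"

text \<open>Equality of elements of the target space means equality on \<open>S\<close>.\<close>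

definition linear_continuous_op ::
    "(nat \<Rightarrow> real) \<Rightarrow> real \<Rightarrow> real \<Rightarrow> rlog set \<Rightarrow> (complex fps \<Rightarrow> rlog \<Rightarrow> complex) \<Rightarrow> bool" where
  "linear_continuous_op M A B S T \<longleftrightarrow>
     (\<forall>F\<in>series_class M A. T F \<in> Au_class M B S) \<and>
     (\<forall>F\<in>series_class M A. \<forall>G\<in>series_class M A. \<forall>z\<in>S. T (F + G) z = T F z + T G z) \<and>
     (\<forall>c. \<forall>F\<in>series_class M A. \<forall>z\<in>S. T (fps_const c * F) z = c * T F z) \<and>
     (\<forall>F\<in>series_class M A. \<forall>\<epsilon>>0. \<exists>\<delta>>0. \<forall>G\<in>series_class M A.
        series_norm M A (G - F) < \<delta> \<longrightarrow> Au_norm M B S (\<lambda>z. T G z - T F z) < \<epsilon>)"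

definition has_extension_operators :: "(nat \<Rightarrow> real) \<Rightarrow> rlog set \<Rightarrow> bool" where
  "has_extension_operators M S \<longleftrightarrow>
     (\<exists>c>0. \<forall>A>0. \<exists>T. linear_continuous_op M A (c * A) S T \<and>
        (\<forall>F\<in>series_class M A. borel_map M S (T F) = F))"

definition borel_surjective_u :: "(nat \<Rightarrow> real) \<Rightarrow> rlog set \<Rightarrow> bool" where
  "borel_surjective_u M S \<longleftrightarrow> borel_map M S ` Au_union M S = series_union M"

definition borel_surjective_hat :: "(nat \<Rightarrow> real) \<Rightarrow> rlog set \<Rightarrow> bool" where
  "borel_surjective_hat M S \<longleftrightarrow> borel_map M S ` A_union (hat_seq M) S = series_union M"

definition surj_interval_u :: "(nat \<Rightarrow> real) \<Rightarrow> real set" where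
  "surj_interval_u M = {\<gamma>. 0 < \<gamma> \<and> borel_surjective_u M (sector \<gamma>)}"

definition surj_interval_hat :: "(nat \<Rightarrow> real) \<Rightarrow> real set" where
  "surj_interval_hat M = {\<gamma>. 0 < \<gamma> \<and> borel_surjective_hat M (sector \<gamma>)}"

end

theory Submission
  imports Defs
begin

text \<open>
  A flat function is the product of the functions \<open>(1 + (m\<^sub>j z)\<^sup>-\<^sup>1\<^sup>/\<^sup>\<gamma>)\<^sup>-\<^sup>\<gamma>\<close>, where \<open>m\<^sub>j = M\<^sub>j\<^sub>+\<^sub>1 / M\<^sub>j\<close>;
  it is optimal because \<open>\<gamma> < \<gamma>(M)\<close> bounds the tails of \<open>\<Sum> m\<^sub>j\<^sup>-\<^sup>1\<^sup>/\<^sup>\<gamma>\<close>. An optimal flat function \<open>G\<close>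
  serves as the kernel of a truncated Laplace transform: its moments \<open>\<mu>\<^sub>k\<close> are comparable to \<open>M\<^sub>k\<close> up to
  geometric factors, so that \<open>(1/z) \<integral>\<^sub>0\<^sup>R G(z/u) \<Sum> a\<^sub>k u\<^sup>k / \<mu>\<^sub>k du\<close> has the expansion \<open>\<Sum> a\<^sub>k z\<^sup>k\<close>.
  Cauchy's estimates on smaller sectors and Taylor's formula along rays relate the two function
  classes.

  For the bound on the index, let \<open>c\<^sub>p = m\<^sub>p / (p + 1)\<^sup>\<sigma>\<close> and suppose that it is not almost increasing.
  Then there are \<open>p\<^sub>i < N\<^sub>i < p\<^sub>i\<^sub>+\<^sub>1\<close> with \<open>c\<close> at \<open>p\<^sub>i\<close> larger than \<open>i\<close> times \<open>c\<close> at \<open>N\<^sub>i\<close>. A function whose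
  expansion is the lacunary series of the \<open>M\<^sub>q z\<^sup>q\<close> with \<open>q = 2 p\<^sub>i\<close> is of size at most
  \<open>C A\<^sup>N M\<^sub>N \<bar>z\<bar>\<^sup>N\<close>, \<open>N = N\<^sub>i\<close>, after subtraction of the terms up to the one of order \<open>q\<close>, while this last term
  dominates near \<open>\<bar>z\<bar> = 2 C A / m\<^sub>p\<close>, \<open>p = p\<^sub>i\<close>. By the Phragmen-Lindeloef principle both are compatible
  only if \<open>c\<^sub>p \<le> K c\<^sub>N\<close> with \<open>K\<close> independent of \<open>i\<close>.
\<close>

section \<open>Weight sequences and expansions\<close>

lemma rl_abs_eq: "rl_abs z = exp (Re z)"
  by (simp add: rl_abs_def rl_proj_def)

lemma sector_mono: "\<sigma> \<le> \<gamma> \<Longrightarrow> sector \<sigma> \<subseteq> sector \<gamma>"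
  by (auto simp: sector_def intro: less_le_trans mult_right_mono)

lemma sector_iff: "w \<in> sector \<gamma> \<longleftrightarrow> \<bar>Im w\<bar> < \<gamma> * pi / 2"
  by (simp add: sector_def rl_arg_def)

lemma of_real_in_sector: "0 < \<gamma> \<Longrightarrow> complex_of_real x \<in> sector \<gamma>"
  by (simp add: sector_iff)

lemma sector_minus_real: "w \<in> sector \<gamma> \<Longrightarrow> w - complex_of_real s \<in> sector \<gamma>"
  by (simp add: sector_iff)

lemma convex_sector: "convex (sector \<gamma>)"
proof -
  have "sector \<gamma> = {w. Im w < \<gamma> * pi / 2} \<inter> {w. Im w > - (\<gamma> * pi / 2)}"
    by (auto simp: sector_iff)
  then show ?thesis
    by (simp only: convex_Int convex_halfspace_Im_lt convex_halfspace_Im_gt)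
qed

section \<open>Growth of the quotients \<open>m\<close> and elementary bounds for
  \<open>M\<close>\<close>

locale weight_seq =
  fixes M :: "nat \<Rightarrow> real"
  assumes weight: "weight_sequence M"
begin

definition m :: "nat \<Rightarrow> real" where
  "m p = M (p + 1) / M p"

lemma M_pos [simp]: "0 < M p"
  and M_0 [simp]: "M 0 = 1"
  and M_nz [simp]: "M p \<noteq> 0"
proof -
  show "0 < M p" and "M 0 = 1"
    using weight by (auto simp: weight_sequence_def)
  then show "M p \<noteq> 0" by simp
qed

lemma M_nonneg [simp]: "0 \<le> M p"
  by (simp add: less_imp_le)

lemma m_pos [simp]: "0 < m p"
  by (simp add: m_def)

lemma m_nonneg [simp]: "0 \<le> m p"
  by (simp add: less_imp_le)

lemma m_nz [simp]: "m p \<noteq> 0"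
  by (simp add: m_def)

lemma M_Suc: "M (Suc p) = M p * m p"
  by (simp add: m_def)

lemma m_mono: "p \<le> q \<Longrightarrow> m p \<le> m q"
proof (rule lift_Suc_mono_le[of m], goal_cases)
  case (1 n)
  have "(M (Suc n))\<^sup>2 \<le> M n * M (n + 2)"
    using weight by (auto simp: weight_sequence_def dest: spec[of _ "Suc n"])
  then show ?case
    by (simp add: m_def divide_simps power2_eq_square mult.commute)
qed

lemma m_at_top: "filterlim m at_top sequentially"
proof -
  have "m = (\<lambda>p. M (p + 1) / M p)"
    by (auto simp: m_def)
  then show ?thesis
    using weight by (simp add: weight_sequence_def)
qed

lemma M_eq_prod: "M p = (\<Prod>j<p. m j)"
  by (induction p) (auto simp: M_Suc)

text \<open>\<open>M (p + n)\<close> is \<open>M p\<close> times the \<open>n\<close> quotients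
  \<open>m p, ..., m (p + n - 1)\<close>. Since \<open>m\<close> is nondecreasing, replacing them by
  \<open>m (p + n)\<close> or by \<open>m p\<close> gives this bound and the converse one in
  \<open>M_add_ge\<close>.\<close>

lemma M_add_le: "M (p + n) \<le> M p * m (p + n) ^ n"
proof (induction n)
  case (Suc n)
  have "M (p + Suc n) = M (p + n) * m (p + n)"
    by (simp add: M_Suc)
  also have "\<dots> \<le> (M p * m (p + n) ^ n) * m (p + Suc n)"
    using Suc by (intro mult_mono m_mono) auto
  also have "\<dots> \<le> (M p * m (p + Suc n) ^ n) * m (p + Suc n)"
    by (intro mult_mono power_mono m_mono) auto
  finally show ?case by (simp add: mult_ac)
qed simp

lemma M_add_ge: "M p * m p ^ n \<le> M (p + n)"
proof (induction n)
  case (Suc n)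
  have "M p * m p ^ Suc n \<le> M (p + n) * m (p + n)"
    using mult_mono[OF Suc m_mono[of p "p + n"]] by (simp add: mult_ac)
  then show ?case by (simp add: M_Suc)
qed simp

section \<open>The associated function \<open>h_fun\<close>\<close>

lemma h_le:
  assumes "0 \<le> t"
  shows "h_fun M t \<le> M p * t ^ p"
  unfolding h_fun_def
  by (rule cINF_lower) (use assms in \<open>auto intro!: bdd_belowI2[where m = 0]\<close>)

lemma h_ge: "(\<And>p. c \<le> M p * t ^ p) \<Longrightarrow> c \<le> h_fun M t"
  unfolding h_fun_def by (rule cINF_greatest) auto

lemma h_nonneg: "0 \<le> t \<Longrightarrow> 0 \<le> h_fun M t"
  by (rule h_ge) simp

text \<open>By logarithmic convexity the infimum at \<open>t = 1 / m k\<close> is attained at \<open>p = k\<close>.\<close>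

lemma h_ge_at:
  assumes "1 / m k \<le> t"
  shows "M k / m k ^ k \<le> h_fun M t"
proof (rule h_ge)
  fix p
  have "M k / m k ^ k \<le> M p * (1 / m k) ^ p"
  proof (cases "p \<le> k")
    case True
    then obtain n where k: "k = p + n" using le_Suc_ex by blast
    show ?thesis
      using M_add_le[of p n] by (simp add: k divide_simps power_add mult_ac)
  next
    case False
    then obtain n where p: "p = k + n" using le_Suc_ex[of k p] by auto
    show ?thesis
      using M_add_ge[of k n] by (simp add: p divide_simps power_add mult_ac)
  qed
  also have "\<dots> \<le> M p * t ^ p"
    using assms by (intro mult_left_mono power_mono) auto
  finally show "M k / m k ^ k \<le> M p * t ^ p" .
qed

section \<open>Uniform expansions, their coefficients and the Borel map\<close>

lemma asymp_quot_le_iff: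
  assumes "0 < A"
  shows "asymp_quot M A f F (z, p) \<le> C \<longleftrightarrow>
    cmod (f z - (\<Sum>k<p. fps_nth F k * exp z ^ k)) \<le> C * (A ^ p * M p * exp (Re z) ^ p)"
  using assms by (simp add: asymp_quot_def rl_abs_eq rl_proj_def pos_divide_le_eq)

lemma has_unif_expansionI:
  assumes "0 < A"
    and "\<And>z p. z \<in> S \<Longrightarrow>
      cmod (f z - (\<Sum>k<p. fps_nth F k * exp z ^ k)) \<le> C * (A ^ p * M p * exp (Re z) ^ p)"
  shows "has_unif_expansion M A S f F"
  unfolding has_unif_expansion_def
  by (rule bdd_aboveI2[where M = C]) (use assms in \<open>auto simp: asymp_quot_le_iff\<close>)

lemma has_unif_expansionD:
  assumes "has_unif_expansion M A S f F" "0 < A"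
  shows "\<exists>C\<ge>0. \<forall>z\<in>S. \<forall>p.
    cmod (f z - (\<Sum>k<p. fps_nth F k * exp z ^ k)) \<le> C * (A ^ p * M p * exp (Re z) ^ p)"
proof -
  obtain C where C: "asymp_quot M A f F x \<le> C" if "x \<in> S \<times> UNIV" for x
    using assms(1) unfolding has_unif_expansion_def bdd_above_def by blast
  have "asymp_quot M A f F (z, p) \<le> max 0 C" if "z \<in> S" for z p
    using C[of "(z, p)"] that by simp
  then show ?thesis
    unfolding asymp_quot_le_iff[OF assms(2)] by (intro exI[of _ "max 0 C"]) simp
qed

lemma has_unif_expansion_subset:
  "has_unif_expansion M A S f F \<Longrightarrow> S' \<subseteq> S \<Longrightarrow> has_unif_expansion M A S' f F"
  unfolding has_unif_expansion_def by (erule bdd_above_mono) auto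

lemma borel_map_eq:
  "0 < \<gamma> \<Longrightarrow> 0 < A \<Longrightarrow> has_unif_expansion M A (sector \<gamma>) f F \<Longrightarrow> borel_map M (sector \<gamma>) f = F"
  by (rule borel_map_eqI) auto

lemma series_classD:
  assumes "F \<in> series_class M A" "0 < A"
  shows "cmod (fps_nth F k) \<le> series_norm M A F * (A ^ k * M k)"
proof -
  have "cmod (fps_nth F k) / (A ^ k * M k) \<le> series_norm M A F"
    unfolding series_norm_def by (rule cSUP_upper) (use assms in \<open>auto simp: series_class_def\<close>)
  then show ?thesis using assms by (simp add: pos_divide_le_eq)
qed

lemma series_norm_nonneg:
  assumes "F \<in> series_class M A" "0 < A"
  shows "0 \<le> series_norm M A F"
  using series_classD[OF assms, of 0] by (simp add: order_trans[OF norm_ge_zero])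

lemma series_classI:
  assumes "0 < A" "\<And>k. cmod (fps_nth F k) \<le> C * (A ^ k * M k)"
  shows "F \<in> series_class M A"
  unfolding series_class_def
  by (auto intro!: bdd_aboveI2[where M = C] simp: pos_divide_le_eq assms)

text \<open>The remainders of orders \<open>k\<close> and \<open>k + 1\<close> differ by the term of
  order \<open>k\<close>. Divided by the power of order \<open>k\<close>, their bounds tend to the
  required one as \<open>x\<close> tends to 0 along the positive axis.\<close>

lemma expansion_coeffs:
  assumes "0 < \<gamma>" "0 < A" "has_unif_expansion M A (sector \<gamma>) f F"
  shows "F \<in> series_class M A"
proof -
  obtain C where C: "0 \<le> C" "\<And>z p. z \<in> sector \<gamma> \<Longrightarrow>
      cmod (f z - (\<Sum>k<p. fps_nth F k * exp z ^ k)) \<le> C * (A ^ p * M p * exp (Re z) ^ p)"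
    using has_unif_expansionD[OF assms(3,2)] by blast
  show ?thesis
  proof (rule series_classI[OF assms(2)])
    fix k
    \<comment> \<open>The value \<open>b 0\<close> is the bound sought; the linear term comes from
      the remainder of order \<open>k + 1\<close>.\<close>
    define b where "b x = C * (A ^ k * M k) + C * (A ^ Suc k * M (Suc k)) * x" for x :: real
    have "cmod (fps_nth F k) \<le> b x" if x: "0 < x" for x
    proof -
      define z where "z = complex_of_real (ln x)"
      have z: "z \<in> sector \<gamma>" "exp (Re z) = x" "exp z = of_real x"
        using assms(1) x by (simp_all add: z_def of_real_in_sector exp_of_real)
      have eq: "fps_nth F k * exp z ^ k = (f z - (\<Sum>j<k. fps_nth F j * exp z ^ j)) -
          (f z - (\<Sum>j<Suc k. fps_nth F j * exp z ^ j))"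
        by simp
      have "cmod (fps_nth F k * exp z ^ k) \<le>
          C * (A ^ k * M k * exp (Re z) ^ k) + C * (A ^ Suc k * M (Suc k) * exp (Re z) ^ Suc k)"
        by (subst eq, intro order_trans[OF norm_triangle_ineq4] add_mono C(2)[OF z(1)])
      then have "cmod (fps_nth F k) * x ^ k \<le> b x * x ^ k"
        using x by (simp add: z norm_mult norm_power b_def algebra_simps)
      then show ?thesis using x by simp
    qed
    moreover have "(b \<longlongrightarrow> b 0) (at_right 0)"
      unfolding b_def by (intro tendsto_intros)
    ultimately have "cmod (fps_nth F k) \<le> b 0"
      by (intro tendsto_lowerbound[of b "b 0" "at_right 0"] eventually_mono[OF eventually_at_right_less[of 0]])
        simp_all
    then show "cmod (fps_nth F k) \<le> C * (A ^ k * M k)"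
      by (simp add: b_def)
  qed
qed

lemma Au_unionE:
  assumes "0 < \<gamma>" "f \<in> Au_union M (sector \<gamma>)"
  obtains A F where "0 < A" "f holomorphic_on sector \<gamma>" "has_unif_expansion M A (sector \<gamma>) f F"
    "borel_map M (sector \<gamma>) f = F" "F \<in> series_class M A"
proof -
  obtain A F where "0 < A" "f holomorphic_on sector \<gamma>" "has_unif_expansion M A (sector \<gamma>) f F"
    using assms(2) unfolding Au_union_def Au_class_def rl_holomorphic_on_iff[OF open_sector] by blast
  then show ?thesis
    using borel_map_eq expansion_coeffs assms(1) that by blast
qed

text \<open>One inclusion in the equality defining surjectivity holds always, by
  \<open>expansion_coeffs\<close>; what remains is to find a preimage of each series.\<close>

lemma borel_surjective_uI:
  assumes "0 < \<gamma>" "\<And>F. F \<in> series_union M \<Longrightarrow>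
    \<exists>A>0. \<exists>f. f holomorphic_on sector \<gamma> \<and> has_unif_expansion M A (sector \<gamma>) f F"
  shows "borel_surjective_u M (sector \<gamma>)"
  unfolding borel_surjective_u_def
proof safe
  fix f assume "f \<in> Au_union M (sector \<gamma>)"
  with assms(1) obtain A F where "0 < A" "borel_map M (sector \<gamma>) f = F" "F \<in> series_class M A"
    by (rule Au_unionE)
  then show "borel_map M (sector \<gamma>) f \<in> series_union M"
    by (auto simp: series_union_def)
next
  fix F assume "F \<in> series_union M"
  from assms(2)[OF this] obtain A f where "0 < A" "f holomorphic_on sector \<gamma>"
    "has_unif_expansion M A (sector \<gamma>) f F" by blast
  then have "f \<in> Au_union M (sector \<gamma>)" "borel_map M (sector \<gamma>) f = F"
    using borel_map_eq[OF assms(1)]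
    unfolding Au_union_def Au_class_def rl_holomorphic_on_iff[OF open_sector] by blast+
  then show "F \<in> borel_map M (sector \<gamma>) ` Au_union M (sector \<gamma>)"
    by blast
qed

lemma borel_surjective_uE:
  assumes "0 < \<gamma>" "borel_surjective_u M (sector \<gamma>)" "F \<in> series_union M"
  obtains A f where "0 < A" "f holomorphic_on sector \<gamma>" "has_unif_expansion M A (sector \<gamma>) f F"
proof -
  obtain f where f: "f \<in> Au_union M (sector \<gamma>)" "borel_map M (sector \<gamma>) f = F"
    using assms(2,3) unfolding borel_surjective_u_def by (metis imageE)
  from assms(1) f(1) obtain A F' where "0 < A" "f holomorphic_on sector \<gamma>"
    "has_unif_expansion M A (sector \<gamma>) f F'" "borel_map M (sector \<gamma>) f = F'"
    by (rule Au_unionE)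
  then show ?thesis using f(2) that[of A f] by simp
qed

lemma borel_surjective_u_mono:
  assumes "borel_surjective_u M (sector \<gamma>)" "0 < \<sigma>" "\<sigma> \<le> \<gamma>"
  shows "borel_surjective_u M (sector \<sigma>)"
proof (rule borel_surjective_uI[OF assms(2)])
  fix F assume "F \<in> series_union M"
  then obtain A f where "0 < A" "f holomorphic_on sector \<gamma>" "has_unif_expansion M A (sector \<gamma>) f F"
    using borel_surjective_uE[of \<gamma> F] assms by (metis less_le_trans)
  then show "\<exists>A>0. \<exists>f. f holomorphic_on sector \<sigma> \<and> has_unif_expansion M A (sector \<sigma>) f F"
    using sector_mono[OF assms(3)] holomorphic_on_subset has_unif_expansion_subset by blast
qed

text \<open>Restriction to a smaller sector preserves the expansion, so the largest opening decides
  for the whole interval.\<close>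

lemma borel_surjective_u_iff:
  assumes "0 < \<gamma>"
  shows "borel_surjective_u M (sector \<gamma>) \<longleftrightarrow> {0<..\<gamma>} \<subseteq> surj_interval_u M"
  using assms borel_surjective_u_mono[of \<gamma>] by (auto simp: surj_interval_u_def)

lemma extension_operators_imp_surjective:
  assumes "0 < \<gamma>" "has_extension_operators M (sector \<gamma>)"
  shows "borel_surjective_u M (sector \<gamma>)"
proof (rule borel_surjective_uI[OF assms(1)])
  fix F assume "F \<in> series_union M"
  then obtain A where A: "0 < A" "F \<in> series_class M A"
    by (auto simp: series_union_def)
  from assms(2) obtain c T where c: "0 < c" and
    T: "linear_continuous_op M A (c * A) (sector \<gamma>) T" "borel_map M (sector \<gamma>) (T F) = F"
    unfolding has_extension_operators_def using A by meson
  have "T F \<in> Au_class M (c * A) (sector \<gamma>)"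
    using T(1) A(2) by (auto simp: linear_continuous_op_def)
  then obtain F' where "T F holomorphic_on sector \<gamma>"
    "has_unif_expansion M (c * A) (sector \<gamma>) (T F) F'"
    by (auto simp: Au_class_def rl_holomorphic_on_iff open_sector)
  moreover from this have "F' = F"
    using borel_map_eq[of \<gamma> "c * A" "T F" F'] assms(1) T(2) A(1) c by simp
  ultimately show "\<exists>A>0. \<exists>f. f holomorphic_on sector \<gamma> \<and> has_unif_expansion M A (sector \<gamma>) f F"
    using A(1) c by (intro exI[of _ "c * A"] conjI exI[of _ "T F"]) auto
qed

end

section \<open>Optimal flat functions\<close>

text \<open>The right-hand side is the integral of \<open>t powr (- \<delta>)\<close> over the
  interval from \<open>x\<close> to \<open>x + 1\<close>; the mean value theorem replaces the
  integral comparison.\<close>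

lemma powr_neg_le_diff:
  fixes x \<delta> :: real
  assumes "0 < x" "1 < \<delta>"
  shows "(x + 1) powr (- \<delta>) \<le> (x powr (1 - \<delta>) - (x + 1) powr (1 - \<delta>)) / (\<delta> - 1)"
proof -
  have "\<exists>\<xi>>x. \<xi> < x + 1 \<and>
      (x + 1) powr (1 - \<delta>) - x powr (1 - \<delta>) = (x + 1 - x) * ((1 - \<delta>) * \<xi> powr (1 - \<delta> - 1))"
    using assms by (intro MVT2 has_real_derivative_powr) auto
  then obtain \<xi> where \<xi>: "x < \<xi>" "\<xi> < x + 1"
    "x powr (1 - \<delta>) - (x + 1) powr (1 - \<delta>) = (\<delta> - 1) * \<xi> powr (- \<delta>)"
    by (auto simp: algebra_simps)
  have "(x + 1) powr (- \<delta>) \<le> \<xi> powr (- \<delta>)"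
    using \<xi> assms by (intro powr_mono2') auto
  then show ?thesis using \<xi>(3) assms by (simp add: pos_le_divide_eq mult.commute)
qed

lemma sum_powr_neg_le:
  fixes \<delta> :: real
  assumes "1 < \<delta>"
  shows "(\<Sum>q=p..<p + n. real (q + 1) powr (- \<delta>)) \<le> (1 + 1 / (\<delta> - 1)) * real (p + 1) powr (1 - \<delta>)"
proof -
  \<comment> \<open>The first summand is kept apart: its comparison integral would start at
    \<open>p\<close>, which may be 0. The others telescope.\<close>
  have "(\<Sum>q=p..<p + Suc n. real (q + 1) powr (- \<delta>)) \<le>
      real (p + 1) powr (- \<delta>) + (real (p + 1) powr (1 - \<delta>) - real (p + Suc n) powr (1 - \<delta>)) / (\<delta> - 1)" for n
  proof (induction n)
    case (Suc n)
    have "(\<Sum>q=p..<p + Suc (Suc n). real (q + 1) powr (- \<delta>)) =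
        (\<Sum>q=p..<p + Suc n. real (q + 1) powr (- \<delta>)) + (real (p + Suc n) + 1) powr (- \<delta>)"
      by (simp add: add_ac)
    also have "\<dots> \<le> (real (p + 1) powr (- \<delta>) + (real (p + 1) powr (1 - \<delta>) - real (p + Suc n) powr (1 - \<delta>)) / (\<delta> - 1))
        + (real (p + Suc n) powr (1 - \<delta>) - (real (p + Suc n) + 1) powr (1 - \<delta>)) / (\<delta> - 1)"
      using assms by (intro add_mono Suc powr_neg_le_diff) auto
    also have "\<dots> = real (p + 1) powr (- \<delta>) + (real (p + 1) powr (1 - \<delta>) - real (p + Suc (Suc n)) powr (1 - \<delta>)) / (\<delta> - 1)"
      by (simp add: diff_divide_distrib add_ac)
    finally show ?case .
  qed simp
  also have "real (p + 1) powr (- \<delta>) + (real (p + 1) powr (1 - \<delta>) - real (p + Suc n) powr (1 - \<delta>)) / (\<delta> - 1)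
      \<le> real (p + 1) powr (1 - \<delta>) + real (p + 1) powr (1 - \<delta>) / (\<delta> - 1)"
    using assms by (intro add_mono divide_right_mono powr_mono) auto
  finally have "(\<Sum>q=p..<p + Suc n. real (q + 1) powr (- \<delta>)) \<le> (1 + 1 / (\<delta> - 1)) * real (p + 1) powr (1 - \<delta>)"
    by (simp add: algebra_simps)
  moreover have "(\<Sum>q=p..<p + n. real (q + 1) powr (- \<delta>)) \<le> (\<Sum>q=p..<p + Suc n. real (q + 1) powr (- \<delta>))"
    by (intro sum_mono2) auto
  ultimately show ?thesis by linarith
qed

context weight_seq
begin

text \<open>Almost monotonicity gives a lower bound for \<open>m q / m p\<close> by a multiple of
  the power of order \<open>\<sigma>\<close> of \<open>(q + 1) / (p + 1)\<close>. Raised to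
  \<open>- 1 / \<gamma>\<close>, it has exponent \<open>- \<delta>\<close> with
  \<open>\<delta> = \<sigma> / \<gamma> > 1\<close>, which is summable.\<close>

lemma tail_sum_le:
  assumes "0 < \<gamma>" "\<gamma> < \<sigma>" "almost_increasing (\<lambda>p. m p / real (p + 1) powr \<sigma>)"
  shows "\<exists>C\<ge>0. \<forall>p n. (\<Sum>q=p..<p + n. m q powr (- (1 / \<gamma>))) \<le> C * real (p + 1) * m p powr (- (1 / \<gamma>))"
proof -
  obtain a where a: "0 < a" "\<And>p q. p \<le> q \<Longrightarrow> m p / real (p + 1) powr \<sigma> \<le> a * (m q / real (q + 1) powr \<sigma>)"
    using assms(3) unfolding almost_increasing_def by blast
  define \<delta> where "\<delta> = \<sigma> / \<gamma>"
  have "1 < \<delta>" using assms by (simp add: \<delta>_def)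
  define C where "C = a powr (1 / \<gamma>) * (1 + 1 / (\<delta> - 1))"
  have "(\<Sum>q=p..<p + n. m q powr (- (1 / \<gamma>))) \<le> C * real (p + 1) * m p powr (- (1 / \<gamma>))" for p n
  proof -
    define D where "D = a powr (1 / \<gamma>) * m p powr (- (1 / \<gamma>)) * real (p + 1) powr \<delta>"
    have "m q powr (- (1 / \<gamma>)) \<le> D * real (q + 1) powr (- \<delta>)" if "p \<le> q" for q
    proof -
      have "m p / a * (real (q + 1) / real (p + 1)) powr \<sigma> \<le> m q"
        using a(2)[OF that] a(1) by (subst powr_divide) (auto simp: field_simps)
      then have "m q powr (- (1 / \<gamma>)) \<le> (m p / a * (real (q + 1) / real (p + 1)) powr \<sigma>) powr (- (1 / \<gamma>))"
        using a(1) assms(1) by (intro powr_mono2') auto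
      also have "\<dots> = (m p / a) powr (- (1 / \<gamma>)) * (real (q + 1) / real (p + 1)) powr (- \<delta>)"
        using a(1) by (subst powr_mult) (auto simp: powr_powr \<delta>_def)
      also have "\<dots> = D * real (q + 1) powr (- \<delta>)"
        unfolding D_def using a(1) by (subst (1 2) powr_divide) (auto simp: powr_minus field_simps)
      finally show ?thesis .
    qed
    then have "(\<Sum>q=p..<p + n. m q powr (- (1 / \<gamma>))) \<le> (\<Sum>q=p..<p + n. D * real (q + 1) powr (- \<delta>))"
      by (intro sum_mono) auto
    also have "\<dots> \<le> D * ((1 + 1 / (\<delta> - 1)) * real (p + 1) powr (1 - \<delta>))"
      unfolding sum_distrib_left[symmetric]
      by (intro mult_left_mono sum_powr_neg_le \<open>1 < \<delta>\<close>) (simp add: D_def)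
    also have "\<dots> = C * (real (p + 1) powr \<delta> * real (p + 1) powr (1 - \<delta>)) * m p powr (- (1 / \<gamma>))"
      by (simp only: C_def D_def mult_ac)
    also have "real (p + 1) powr \<delta> * real (p + 1) powr (1 - \<delta>) = real (p + 1)"
      by (subst powr_add[symmetric]) simp
    finally show ?thesis .
  qed
  moreover have "0 \<le> C" using \<open>1 < \<delta>\<close> by (simp add: C_def)
  ultimately show ?thesis by blast
qed

text \<open>
  With \<open>v = (m\<^sub>j z)\<^sup>-\<^sup>1\<^sup>/\<^sup>\<gamma>\<close>, which lies in the right half-plane for \<open>z\<close> in the sector, one has
  \<open>\<bar>1 + v\<bar>\<^sup>-\<^sup>\<gamma> \<le> min 1 (m\<^sub>j \<bar>z\<bar>)\<close>; the flat function is the product of the \<open>(1 + v)\<^sup>-\<^sup>\<gamma>\<close>.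
\<close>

definition flat_factor :: "real \<Rightarrow> nat \<Rightarrow> complex \<Rightarrow> complex" where
  "flat_factor \<gamma> j w = exp (- ((w + of_real (ln (m j))) / of_real \<gamma>))"

text \<open>The power of exponent \<open>- \<gamma>\<close> is taken through principal logarithms:
  on the sector every \<open>1 + flat_factor \<gamma> j w\<close> has real part above 1.\<close>

definition flat :: "real \<Rightarrow> complex \<Rightarrow> complex" where
  "flat \<gamma> w = exp (- of_real \<gamma> * (\<Sum>j. Ln (1 + flat_factor \<gamma> j w)))"

lemma norm_flat_factor: "cmod (flat_factor \<gamma> j w) = exp (- (Re w / \<gamma>)) * m j powr (- (1 / \<gamma>))"
  by (simp add: flat_factor_def powr_def add_divide_distrib flip: exp_add)

lemma Re_flat_factor:
  assumes "0 < \<gamma>" "w \<in> sector \<gamma>"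
  shows "0 < Re (flat_factor \<gamma> j w)"
proof -
  have "\<bar>Im w / \<gamma>\<bar> < pi / 2"
    using assms by (simp add: sector_iff field_simps)
  then have "- (pi / 2) < Im w / \<gamma>" "Im w / \<gamma> < pi / 2" by linarith+
  then have "0 < cos (Im w / \<gamma>)" by (rule cos_gt_zero_pi)
  then show ?thesis by (simp add: flat_factor_def Re_exp)
qed

section \<open>Convergence of the product and its bounds on both sides\<close>

context
  fixes \<gamma> \<sigma> :: real
  assumes \<gamma>: "0 < \<gamma>" "\<gamma> < \<sigma>" and ai: "almost_increasing (\<lambda>p. m p / real (p + 1) powr \<sigma>)"
begin

lemma summable_m_powr: "summable (\<lambda>j. m j powr (- (1 / \<gamma>)))"
proof -
  obtain C where "\<And>p n. (\<Sum>q=p..<p + n. m q powr (- (1 / \<gamma>))) \<le> C * real (p + 1) * m p powr (- (1 / \<gamma>))"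
    using tail_sum_le[OF \<gamma> ai] by blast
  from this[of 0] show ?thesis
    by (intro summableI_nonneg_bounded) (auto simp: lessThan_atLeast0)
qed

text \<open>Majorants for the Weierstrass test, uniform on right half-planes of the chart. They hold
  only from some \<open>j\<close> on, when the factor has modulus below 1/2 and
  \<open>norm_Ln_le\<close> applies.\<close>

lemma flat_factor_bound:
  "\<forall>\<^sub>F j in sequentially. \<forall>w\<in>{w. c \<le> Re w}.
    cmod (Ln (1 + flat_factor \<gamma> j w)) \<le> 2 * exp (- (c / \<gamma>)) * m j powr (- (1 / \<gamma>))"
proof -
  have "(\<lambda>j. exp (- (c / \<gamma>)) * m j powr (- (1 / \<gamma>))) \<longlonglongrightarrow> 0"
    by (intro tendsto_mult_right_zero summable_LIMSEQ_zero summable_m_powr)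
  then have "\<forall>\<^sub>F j in sequentially. exp (- (c / \<gamma>)) * m j powr (- (1 / \<gamma>)) < 1 / 2"
    by (rule order_tendstoD) simp
  then show ?thesis
  proof eventually_elim
    case (elim j)
    show ?case
    proof
      fix w assume "w \<in> {w. c \<le> Re w}"
      then have "cmod (flat_factor \<gamma> j w) \<le> exp (- (c / \<gamma>)) * m j powr (- (1 / \<gamma>))"
        unfolding norm_flat_factor using \<gamma> by (intro mult_right_mono) (auto simp: divide_right_mono)
      then show "cmod (Ln (1 + flat_factor \<gamma> j w)) \<le> 2 * exp (- (c / \<gamma>)) * m j powr (- (1 / \<gamma>))"
        using norm_Ln_le[of "flat_factor \<gamma> j w"] elim by linarith
    qed
  qed
qed

lemma uniform_limit_flat:
  "uniform_limit {w. c \<le> Re w} (\<lambda>n w. \<Sum>j<n. Ln (1 + flat_factor \<gamma> j w))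
    (\<lambda>w. \<Sum>j. Ln (1 + flat_factor \<gamma> j w)) sequentially"
  by (rule Weierstrass_m_test_ev[OF flat_factor_bound summable_mult[OF summable_m_powr]])

lemma summable_flat: "summable (\<lambda>j. Ln (1 + flat_factor \<gamma> j w))"
proof (rule summable_comparison_test_ev)
  show "\<forall>\<^sub>F j in sequentially. norm (Ln (1 + flat_factor \<gamma> j w)) \<le>
      2 * exp (- (Re w / \<gamma>)) * m j powr (- (1 / \<gamma>))"
    using flat_factor_bound[of "Re w"] by eventually_elim simp
  show "summable (\<lambda>j. 2 * exp (- (Re w / \<gamma>)) * m j powr (- (1 / \<gamma>)))"
    by (intro summable_mult summable_m_powr)
qed

lemma flat_holomorphic: "flat \<gamma> holomorphic_on sector \<gamma>"
proof -
  have "(\<lambda>w. \<Sum>j. Ln (1 + flat_factor \<gamma> j w)) holomorphic_on sector \<gamma>"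
  proof (rule holomorphic_uniform_sequence[OF open_sector])
    fix n
    have "1 + flat_factor \<gamma> j w \<notin> \<real>\<^sub>\<le>\<^sub>0" if "w \<in> sector \<gamma>" for j w
      using Re_flat_factor[OF \<gamma>(1) that, of j] by (auto simp: complex_nonpos_Reals_iff)
    then show "(\<lambda>w. \<Sum>j<n. Ln (1 + flat_factor \<gamma> j w)) holomorphic_on sector \<gamma>"
      using \<gamma> unfolding flat_factor_def by (intro holomorphic_intros) auto
  next
    fix w assume "w \<in> sector \<gamma>"
    then obtain d where d: "0 < d" "cball w d \<subseteq> sector \<gamma>"
      using open_sector open_contains_cball by metis
    have "cball w d \<subseteq> {z. Re w - d \<le> Re z}"
    proof
      fix z assume "z \<in> cball w d"
      then show "z \<in> {z. Re w - d \<le> Re z}"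
        using abs_Re_le_cmod[of "w - z"] by (simp add: dist_norm)
    qed
    then show "\<exists>d>0. cball w d \<subseteq> sector \<gamma> \<and> uniform_limit (cball w d)
        (\<lambda>n w. \<Sum>j<n. Ln (1 + flat_factor \<gamma> j w)) (\<lambda>w. \<Sum>j. Ln (1 + flat_factor \<gamma> j w)) sequentially"
      using d uniform_limit_on_subset[OF uniform_limit_flat] by blast
  qed
  then show ?thesis
    unfolding flat_def[abs_def] by (intro holomorphic_intros)
qed

text \<open>The first \<open>p\<close> factors are bounded by \<open>m j\<close> times the modulus
  of the point, the others by 1. As \<open>p\<close> is arbitrary, this bounds \<open>flat\<close>
  by \<open>h_fun\<close>, and it is also the remainder estimate for the null expansion.\<close>

lemma norm_flat_le:
  assumes w: "w \<in> sector \<gamma>"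
  shows "cmod (flat \<gamma> w) \<le> M p * exp (Re w) ^ p"
proof -
  let ?v = "\<lambda>j. flat_factor \<gamma> j w"
  have v: "1 \<le> cmod (1 + ?v j)" "cmod (?v j) \<le> cmod (1 + ?v j)" for j
  proof -
    note Re = Re_flat_factor[OF \<gamma>(1) w, of j]
    show "1 \<le> cmod (1 + ?v j)"
      using Re complex_Re_le_cmod[of "1 + ?v j"] by simp
    show "cmod (?v j) \<le> cmod (1 + ?v j)"
      using Re by (simp add: cmod_def power2_eq_square algebra_simps)
  qed
  have nz: "1 + ?v j \<noteq> 0" for j using v(1)[of j] by auto
  have ln: "Re (Ln (1 + ?v j)) = ln (cmod (1 + ?v j))" for j
    using nz by (rule Re_Ln)
  have "- ((Re w + ln (m j)) / \<gamma>) \<le> Re (Ln (1 + ?v j))" for j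
  proof -
    have "- ((Re w + ln (m j)) / \<gamma>) = ln (cmod (?v j))"
      by (simp add: flat_factor_def)
    also have "\<dots> \<le> Re (Ln (1 + ?v j))"
      unfolding ln using v(2)[of j] by (intro ln_mono) (auto simp: flat_factor_def)
    finally show ?thesis .
  qed
  then have "(\<Sum>j<p. - ((Re w + ln (m j)) / \<gamma>)) \<le> (\<Sum>j<p. Re (Ln (1 + ?v j)))"
    by (rule sum_mono)
  also have "\<dots> \<le> (\<Sum>j. Re (Ln (1 + ?v j)))"
    using v(1) by (intro sum_le_suminf summable_Re summable_flat) (auto simp: ln)
  also have "\<dots> = Re (\<Sum>j. Ln (1 + ?v j))"
    by (rule Re_suminf[OF summable_flat, symmetric])
  finally have "- \<gamma> * Re (\<Sum>j. Ln (1 + ?v j)) \<le> - \<gamma> * (\<Sum>j<p. - ((Re w + ln (m j)) / \<gamma>))"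
    using \<gamma> by (intro mult_left_mono_neg) auto
  also have "\<dots> = (\<Sum>j<p. Re w + ln (m j))"
    unfolding sum_distrib_left using \<gamma> by (intro sum.cong) auto
  finally have "cmod (flat \<gamma> w) \<le> exp (\<Sum>j<p. Re w + ln (m j))"
    by (simp add: flat_def)
  also have "\<dots> = M p * exp (Re w) ^ p"
    by (simp add: exp_sum exp_add prod.distrib M_eq_prod)
  finally show ?thesis .
qed

lemma flat_of_real: "flat \<gamma> (of_real s) =
    of_real (exp (- \<gamma> * (\<Sum>j. ln (1 + exp (- ((s + ln (m j)) / \<gamma>))))))"
  and summable_ln_flat: "summable (\<lambda>j. ln (1 + exp (- ((s + ln (m j)) / \<gamma>))))"
proof -
  let ?l = "\<lambda>j. ln (1 + exp (- ((s + ln (m j)) / \<gamma>)))"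
  have Ln: "Ln (1 + flat_factor \<gamma> j (of_real s)) = of_real (?l j)" for j
  proof -
    have "1 + flat_factor \<gamma> j (of_real s) = of_real (1 + exp (- ((s + ln (m j)) / \<gamma>)))"
      by (simp add: flat_factor_def flip: exp_of_real)
    moreover have "0 < 1 + exp (- ((s + ln (m j)) / \<gamma>))" by (simp add: add_pos_pos)
    ultimately show ?thesis by (simp only: Ln_of_real)
  qed
  have "summable (\<lambda>j. complex_of_real (?l j))"
    using summable_flat[of "of_real s"] by (simp only: Ln)
  then show "summable ?l" by (simp only: summable_of_real_iff)
  then have "(\<Sum>j. complex_of_real (?l j)) = of_real (\<Sum>j. ?l j)"
    by (rule suminf_of_real[symmetric])
  then show "flat \<gamma> (of_real s) = of_real (exp (- \<gamma> * (\<Sum>j. ?l j)))"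
    unfolding flat_def Ln by (simp flip: exp_of_real)
qed

text \<open>The product is split at the first \<open>p\<close> with \<open>1 / x < m p\<close>.
  Before \<open>p\<close> one has \<open>1 + s j \<le> 2 * s j\<close>, which costs a factor
  \<open>2 powr \<gamma>\<close> for each \<open>j\<close>; from \<open>p\<close> on,
  \<open>ln (1 + s j) \<le> s j\<close> and \<open>tail_sum_le\<close> bound the loss by a multiple
  of \<open>p + 1\<close>. Losses geometric in \<open>p\<close> are absorbed by
  \<open>K2\<close>.\<close>

lemma flat_lower_bound:
  "\<exists>K1>0. \<exists>K2>0. \<forall>x>0. K1 * h_fun M (K2 * x) \<le> Re (flat \<gamma> (of_real (ln x)))"
proof -
  obtain C where C: "0 \<le> C"
    "\<And>p n. (\<Sum>q=p..<p + n. m q powr (- (1 / \<gamma>))) \<le> C * real (p + 1) * m p powr (- (1 / \<gamma>))"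
    using tail_sum_le[OF \<gamma> ai] by blast
  \<comment> \<open>The loss per index: \<open>\<gamma> * ln 2\<close> from the factors before
    \<open>p\<close> and \<open>\<gamma> * C\<close> from the tail. The remaining
    \<open>exp (- (\<gamma> * C))\<close> becomes \<open>K1\<close>.\<close>
  define \<kappa> where "\<kappa> = \<gamma> * (ln 2 + C)"
  have "exp (- (\<gamma> * C)) * h_fun M (exp (- \<kappa>) * x) \<le> Re (flat \<gamma> (of_real (ln x)))" if x: "0 < x" for x
  proof -
    define s where "s j = exp (- ((ln x + ln (m j)) / \<gamma>))" for j
    have s_pos: "0 < s j" for j by (simp add: s_def)
    have s_powr: "s j = x powr (- (1 / \<gamma>)) * m j powr (- (1 / \<gamma>))" for j
      using x by (simp add: s_def powr_def add_divide_distrib flip: exp_add)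
    have summable_l: "summable (\<lambda>j. ln (1 + s j))"
      unfolding s_def by (rule summable_ln_flat)
    have "\<forall>\<^sub>F p in sequentially. 1 / x < m p"
      using m_at_top by (simp add: filterlim_at_top_dense)
    then have ex: "\<exists>p. 1 / x < m p" by (auto simp: eventually_sequentially)
    define p where "p = (LEAST p. 1 / x < m p)"
    have p: "1 / x < m p" unfolding p_def using ex by (rule LeastI_ex)
    have less_p: "m j \<le> 1 / x" if "j < p" for j
      using not_less_Least[of j "\<lambda>p. 1 / x < m p"] that by (simp add: p_def)
    have "(\<Sum>j<p. ln (1 + s j)) \<le> (\<Sum>j<p. ln 2 - (ln x + ln (m j)) / \<gamma>)"
    proof (rule sum_mono)
      fix j assume "j \<in> {..<p}"
      then have "m j * x \<le> 1" using less_p[of j] x by (simp add: field_simps)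
      then have "ln (m j * x) \<le> 0" using x by simp
      then have "ln x + ln (m j) \<le> 0" using x by (simp add: ln_mult)
      then have "1 \<le> s j" using \<gamma> by (simp add: s_def divide_nonpos_pos)
      then have "ln (1 + s j) \<le> ln (2 * s j)" by (intro ln_mono) auto
      also have "\<dots> = ln 2 + ln (s j)"
        using s_pos[of j] by (simp add: ln_mult)
      finally show "ln (1 + s j) \<le> ln 2 - (ln x + ln (m j)) / \<gamma>" by (simp add: s_def)
    qed
    moreover have "(\<Sum>j. ln (1 + s (j + p))) \<le> C * real (p + 1)"
    proof (rule suminf_le_const)
      show "summable (\<lambda>j. ln (1 + s (j + p)))"
        using summable_l by (rule summable_ignore_initial_segment)
      fix n
      have "(\<Sum>j<n. ln (1 + s (j + p))) \<le> (\<Sum>j<n. s (j + p))"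
        using s_pos by (intro sum_mono ln_add_one_self_le_self) (auto intro: less_imp_le)
      also have "\<dots> = (\<Sum>q=p..<p + n. s q)"
        by (simp add: sum.shift_bounds_nat_ivl[of s 0 p n, simplified] lessThan_atLeast0 add.commute)
      also have "\<dots> = x powr (- (1 / \<gamma>)) * (\<Sum>q=p..<p + n. m q powr (- (1 / \<gamma>)))"
        by (simp add: s_powr sum_distrib_left)
      also have "\<dots> \<le> x powr (- (1 / \<gamma>)) * (C * real (p + 1) * m p powr (- (1 / \<gamma>)))"
        by (intro mult_left_mono C) auto
      also have "\<dots> = C * real (p + 1) * (x * m p) powr (- (1 / \<gamma>))"
        using x by (simp add: powr_mult)
      also have "\<dots> \<le> C * real (p + 1) * 1"
      \<comment> \<open>By the choice of \<open>p\<close>, \<open>x * m p\<close> is at least 1, so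
        its negative power is at most 1.\<close>
      proof -
        have "1 \<le> x * m p" using p x by (simp add: field_simps)
        then have "(x * m p) powr (- (1 / \<gamma>)) \<le> 1"
          using \<gamma> powr_mono2'[of "- (1 / \<gamma>)" 1 "x * m p"] by simp
        then show ?thesis using C(1) by (intro mult_left_mono) auto
      qed
      finally show "(\<Sum>j<n. ln (1 + s (j + p))) \<le> C * real (p + 1)" by simp
    qed
    ultimately have "(\<Sum>j. ln (1 + s j)) \<le> C * real (p + 1) + (\<Sum>j<p. ln 2 - (ln x + ln (m j)) / \<gamma>)"
      unfolding suminf_split_initial_segment[OF summable_l, of p] by linarith
    then have "- \<gamma> * (C * real (p + 1) + (\<Sum>j<p. ln 2 - (ln x + ln (m j)) / \<gamma>)) \<le> - \<gamma> * (\<Sum>j. ln (1 + s j))"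
      using \<gamma> by (intro mult_left_mono_neg) auto
    moreover have "- \<gamma> * (C * real (p + 1) + (\<Sum>j<p. ln 2 - (ln x + ln (m j)) / \<gamma>)) =
        - (\<gamma> * C) + (\<Sum>j<p. (- \<kappa> + ln x) + ln (m j))"
      using \<gamma> by (simp add: sum_subtractf sum.distrib sum_divide_distrib[symmetric] \<kappa>_def field_simps)
    ultimately have "exp (- (\<gamma> * C) + (\<Sum>j<p. (- \<kappa> + ln x) + ln (m j))) \<le> exp (- \<gamma> * (\<Sum>j. ln (1 + s j)))"
      by simp
    moreover have "exp (- (\<gamma> * C) + (\<Sum>j<p. (- \<kappa> + ln x) + ln (m j))) =
        exp (- (\<gamma> * C)) * (M p * (exp (- \<kappa>) * x) ^ p)"
    proof -
      have "exp (\<Sum>j<p. (- \<kappa> + ln x) + ln (m j)) = (\<Prod>j<p. (exp (- \<kappa>) * x) * m j)"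
        by (simp only: exp_sum[OF finite_lessThan] exp_add exp_ln[OF x] exp_ln[OF m_pos])
      also have "\<dots> = M p * (exp (- \<kappa>) * x) ^ p"
        by (simp add: prod.distrib M_eq_prod mult.commute)
      finally show ?thesis by (simp only: exp_add)
    qed
    moreover have "exp (- (\<gamma> * C)) * h_fun M (exp (- \<kappa>) * x) \<le> exp (- (\<gamma> * C)) * (M p * (exp (- \<kappa>) * x) ^ p)"
      using x by (intro mult_left_mono h_le) auto
    ultimately have "exp (- (\<gamma> * C)) * h_fun M (exp (- \<kappa>) * x) \<le> exp (- \<gamma> * (\<Sum>j. ln (1 + s j)))"
      by linarith
    then show ?thesis by (simp only: flat_of_real Re_complex_of_real s_def)
  qed
  then show ?thesis
    by (intro exI[of _ "exp (- (\<gamma> * C))"] exI[of _ "exp (- \<kappa>)"] conjI) auto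
qed

lemma optimal_flat_exists: "\<exists>G\<in>Au_union M (sector \<gamma>). optimal_flat M (sector \<gamma>) G"
proof
  have hol: "rl_holomorphic_on (flat \<gamma>) (sector \<gamma>)"
    by (simp add: rl_holomorphic_on_iff open_sector flat_holomorphic)
  have "has_unif_expansion M 1 (sector \<gamma>) (flat \<gamma>) 0"
    by (rule has_unif_expansionI[where C = 1]) (auto simp: norm_flat_le)
  with hol show "flat \<gamma> \<in> Au_union M (sector \<gamma>)"
    unfolding Au_union_def Au_class_def by (intro UN_I[of 1]) auto
  obtain K1 K2 where K: "0 < K1" "0 < K2"
    "\<And>x. 0 < x \<Longrightarrow> K1 * h_fun M (K2 * x) \<le> Re (flat \<gamma> (of_real (ln x)))"
    using flat_lower_bound by blast
  have "cmod (flat \<gamma> z) \<le> 1 * h_fun M (1 * rl_abs z)" if "z \<in> sector \<gamma>" for z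
    unfolding rl_abs_eq mult_1 by (rule h_ge) (rule norm_flat_le[OF that])
  moreover have "flat \<gamma> (rl_of_pos x) \<in> \<real> \<and> K1 * h_fun M (K2 * x) \<le> Re (flat \<gamma> (rl_of_pos x))" if "0 < x" for x
    using K(3)[OF that] by (simp add: rl_of_pos_def flat_of_real)
  ultimately show "optimal_flat M (sector \<gamma>) (flat \<gamma>)"
    unfolding optimal_flat_def using hol K(1,2) zero_less_one by blast
qed

end

end

section \<open>Extension operators\<close>

text \<open>Cauchy's inequality on discs of radius \<open>d / 4\<close> bounds the derivative on the
  half ball by \<open>4 * b / d\<close>; the mean value inequality does the rest. It serves to
  dominate difference quotients under the integral.\<close>

lemma bounded_holomorphic_lipschitz:
  assumes hol: "g holomorphic_on ball w d" and "0 < d"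
    and bound: "\<And>z. z \<in> ball w d \<Longrightarrow> cmod (g z) \<le> b" and x: "x \<in> ball w (d / 2)"
  shows "cmod (g x - g w) \<le> 4 * b / d * cmod (x - w)"
proof (rule field_differentiable_bound)
  fix z assume z: "z \<in> ball w (d / 2)"
  then have zd: "z \<in> ball w d" using \<open>0 < d\<close> by auto
  show "(g has_field_derivative deriv g z) (at z within ball w (d / 2))"
    by (rule has_field_derivative_at_within[OF holomorphic_derivI[OF hol open_ball zd]])
  have sub: "cball z (d / 4) \<subseteq> ball w d"
  proof
    fix y assume "y \<in> cball z (d / 4)"
    then show "y \<in> ball w d"
      using z \<open>0 < d\<close> dist_triangle[of w y z] by simp
  qed
  have "cmod ((deriv ^^ 1) g z) \<le> fact 1 * b / (d / 4) ^ 1"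
  proof (rule Cauchy_inequality)
    show "g holomorphic_on ball z (d / 4)"
      by (rule holomorphic_on_subset[OF hol order_trans[OF ball_subset_cball sub]])
    show "continuous_on (cball z (d / 4)) g"
      by (rule continuous_on_subset[OF holomorphic_on_imp_continuous_on[OF hol] sub])
    fix y assume "cmod (z - y) = d / 4"
    then have "y \<in> cball z (d / 4)" by (simp add: dist_norm)
    then show "cmod (g y) \<le> b" using sub bound by blast
  qed (use \<open>0 < d\<close> in simp)
  then show "cmod (deriv g z) \<le> 4 * b / d" by (simp add: field_simps)
qed (use \<open>0 < d\<close> x in auto)

text \<open>Dominated convergence of the difference quotients along an arbitrary sequence, with the
  majorant \<open>4 * B s / d\<close> from \<open>bounded_holomorphic_lipschitz\<close>.\<close>

lemma holomorphic_on_parametric_integral: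
  fixes f :: "complex \<Rightarrow> 'a \<Rightarrow> complex"
  assumes "open S" and hol: "\<And>s. (\<lambda>w. f w s) holomorphic_on S"
    and meas: "\<And>w. w \<in> S \<Longrightarrow> f w \<in> borel_measurable N"
    and dom: "\<And>w. w \<in> S \<Longrightarrow> \<exists>d>0. \<exists>B. ball w d \<subseteq> S \<and> integrable N B \<and> (\<forall>z\<in>ball w d. \<forall>s. cmod (f z s) \<le> B s)"
  shows "(\<lambda>w. \<integral>s. f w s \<partial>N) holomorphic_on S"
proof -
  have "(\<lambda>w. \<integral>s. f w s \<partial>N) field_differentiable (at w)" if "w \<in> S" for w
  proof -
    obtain d B where d: "0 < d" "ball w d \<subseteq> S" and B: "integrable N B"
      "\<And>z s. z \<in> ball w d \<Longrightarrow> cmod (f z s) \<le> B s"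
      using dom[OF \<open>w \<in> S\<close>] by blast
    have int: "integrable N (f z)" if "z \<in> ball w d" for z
    proof (rule Bochner_Integration.integrable_bound[OF B(1)])
      show "f z \<in> borel_measurable N" using d(2) that meas by blast
      show "AE s in N. cmod (f z s) \<le> norm (B s)"
        using B(2)[OF that] by (intro AE_I2) (simp add: abs_of_nonneg order_trans[OF _ abs_ge_self])
    qed
    define f' where "f' s = deriv (\<lambda>z. f z s) w" for s
    have "((\<lambda>z. \<integral>s. f z s \<partial>N) has_field_derivative (\<integral>s. f' s \<partial>N)) (at w)"
      unfolding has_field_derivative_iff tendsto_at_iff_sequentially o_def
    proof (intro allI impI)
      fix X assume X: "\<forall>i. X i \<in> UNIV - {w}" "X \<longlonglongrightarrow> w"
      \<comment> \<open>Dropping the first \<open>k\<close> members puts the whole sequence into the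
        half ball, where the Lipschitz bound holds.\<close>
      have "\<forall>\<^sub>F i in sequentially. X i \<in> ball w (d / 2)"
        using X(2) d(1) by (intro topological_tendstoD) auto
      then obtain k where "\<forall>i\<ge>k. X i \<in> ball w (d / 2)"
        unfolding eventually_sequentially by blast
      then have k: "X (i + k) \<in> ball w (d / 2)" for i
        by simp
      then have kd: "X (i + k) \<in> ball w d" for i
        using k[of i] d(1) unfolding mem_ball by linarith
      have w: "w \<in> ball w d" using d(1) by simp
      let ?q = "\<lambda>i s. (f (X (i + k)) s - f w s) / (X (i + k) - w)"
      have lim: "(\<lambda>i. ?q i s) \<longlonglongrightarrow> f' s" for s
      proof -
        have "((\<lambda>z. f z s) has_field_derivative f' s) (at w)"
          unfolding f'_def by (rule holomorphic_derivI[OF hol \<open>open S\<close> \<open>w \<in> S\<close>])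
        then have "(\<lambda>i. (f (X i) s - f w s) / (X i - w)) \<longlonglongrightarrow> f' s"
          using X unfolding has_field_derivative_iff tendsto_at_iff_sequentially o_def by blast
        then show ?thesis by (rule LIMSEQ_ignore_initial_segment)
      qed
      have meas_q: "?q i \<in> borel_measurable N" for i
        using int[OF kd] int[OF w] by (intro borel_measurable_divide borel_measurable_diff) auto
      have "(\<lambda>i. \<integral>s. ?q i s \<partial>N) \<longlonglongrightarrow> (\<integral>s. f' s \<partial>N)"
      proof (rule integral_dominated_convergence[where w = "\<lambda>s. 4 * B s / d"])
        show "f' \<in> borel_measurable N"
          by (rule borel_measurable_LIMSEQ_metric[OF meas_q lim])
        show "integrable N (\<lambda>s. 4 * B s / d)" using B(1) by simp
        fix i
        show "AE s in N. norm (?q i s) \<le> 4 * B s / d"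
        proof (rule AE_I2)
          fix s
          have "cmod (f (X (i + k)) s - f w s) \<le> 4 * B s / d * cmod (X (i + k) - w)"
            by (rule bounded_holomorphic_lipschitz[OF holomorphic_on_subset[OF hol d(2)] d(1) B(2) k])
          moreover have "0 < cmod (X (i + k) - w)" using X(1) by auto
          ultimately show "norm (?q i s) \<le> 4 * B s / d"
            by (simp add: norm_divide pos_divide_le_eq)
        qed
      qed (use lim meas_q in auto)
      moreover have "(\<integral>s. ?q i s \<partial>N) = ((\<integral>s. f (X (i + k)) s \<partial>N) - (\<integral>s. f w s \<partial>N)) / (X (i + k) - w)" for i
        using int[OF kd] int[OF w] by simp
      ultimately have "(\<lambda>i. ((\<integral>s. f (X (i + k)) s \<partial>N) - (\<integral>s. f w s \<partial>N)) / (X (i + k) - w)) \<longlonglongrightarrow> (\<integral>s. f' s \<partial>N)"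
        by (simp only:)
      then show "(\<lambda>i. ((\<integral>s. f (X i) s \<partial>N) - (\<integral>s. f w s \<partial>N)) / (X i - w)) \<longlonglongrightarrow> (\<integral>s. f' s \<partial>N)"
        by (rule LIMSEQ_offset)
    qed
    then show ?thesis by (auto simp: field_differentiable_def)
  qed
  then show ?thesis
    by (simp add: holomorphic_on_def field_differentiable_at_within)
qed

lemma integrable_exp_minus_abs: "integrable lborel (\<lambda>s::real. exp (- \<bar>s\<bar>))"
proof -
  have half: "integrable lborel (\<lambda>s::real. exp (- s) * indicator {0..} s)"
  proof (rule integrableI_nn_integral_finite)
    have "(\<integral>\<^sup>+s. ennreal (exp (- s)) * indicator {0::real..} s \<partial>lborel) = ennreal (0 - (- exp (- 0)))"
    proof (rule nn_integral_FTC_atLeast)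
      have "((\<lambda>x::real. exp (- x)) \<longlongrightarrow> 0) at_top"
        by (intro filterlim_compose[OF exp_at_bot] filterlim_uminus_at_bot_at_top)
      then show "((\<lambda>x::real. - exp (- x)) \<longlongrightarrow> 0) at_top"
        using tendsto_minus by fastforce
    qed (auto intro!: derivative_eq_intros)
    then show "(\<integral>\<^sup>+s. ennreal (exp (- s) * indicator {0::real..} s) \<partial>lborel) = ennreal (0 - (- exp (- 0)))"
      by (simp add: ennreal_mult' ennreal_indicator)
  qed auto
  have "integrable lborel (\<lambda>s::real. exp (- (0 + (- 1) * s)) * indicator {0..} (0 + (- 1) * s))"
    by (rule lborel_integrable_real_affine[OF half]) simp
  from Bochner_Integration.integrable_add[OF half this] show ?thesis
    by (rule Bochner_Integration.integrable_bound) (auto simp: indicator_def abs_if)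
qed

lemma integrable_exp_minus_abs_diff: "integrable lborel (\<lambda>s::real. exp (- \<bar>s - x\<bar>))"
  and integral_exp_minus_abs_diff:
    "(\<integral>s. exp (- \<bar>s - x\<bar>) \<partial>lborel) = (\<integral>s. exp (- \<bar>s::real\<bar>) \<partial>lborel)"
proof -
  show "integrable lborel (\<lambda>s::real. exp (- \<bar>s - x\<bar>))"
    using lborel_integrable_real_affine[OF integrable_exp_minus_abs, of 1 "- x"] by simp
  show "(\<integral>s. exp (- \<bar>s - x\<bar>) \<partial>lborel) = (\<integral>s. exp (- \<bar>s::real\<bar>) \<partial>lborel)"
    using lborel_integral_real_affine[of 1 "\<lambda>s. exp (- \<bar>s\<bar>)" "- x"] by simp
qed

lemma sums_half_powers: "(\<lambda>j. (1 / 2) ^ j :: real) sums 2"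
  using geometric_sums[of "1 / 2 :: real"] by simp

section \<open>Moments of an optimal flat kernel\<close>

text \<open>The data of an optimal flat function in the logarithmic chart. In \<open>upper\<close>
  the infimum \<open>h_fun\<close> is replaced by each of its terms, and the constant of (dc) is
  normalized to be at least 1.\<close>

locale flat_kernel = weight_seq +
  fixes \<gamma> K1 K2 K3 K4 D :: real and G :: "complex \<Rightarrow> complex"
  assumes \<gamma>: "0 < \<gamma>" and holG: "G holomorphic_on sector \<gamma>"
    and K: "0 < K1" "0 < K2" "0 < K3" "0 < K4"
    and lower: "\<And>x. 0 < x \<Longrightarrow> K1 * h_fun M (K2 * x) \<le> Re (G (of_real (ln x)))"
    and upper: "\<And>w p. w \<in> sector \<gamma> \<Longrightarrow> cmod (G w) \<le> K3 * (M p * (K4 * exp (Re w)) ^ p)"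
    and D: "1 \<le> D" "\<And>p. M (p + 1) \<le> D ^ (p + 1) * M p"
begin

text \<open>The exponent is \<open>k + 1\<close> because the substitution \<open>u = exp s\<close>
  contributes one factor \<open>exp s\<close> from \<open>du\<close>.\<close>

definition kern :: "nat \<Rightarrow> complex \<Rightarrow> real \<Rightarrow> complex" where
  "kern k w s = G (w - of_real s) * of_real (exp (real (k + 1) * s))"

text \<open>In the variable \<open>u = e\<^sup>s\<close> this is the integral of \<open>G (z / u) u\<^sup>k du\<close> over \<open>ln u \<in> B\<close>.\<close>

definition mom :: "nat \<Rightarrow> real set \<Rightarrow> complex \<Rightarrow> complex" where
  "mom k B w = (\<integral>s. indicator B s * kern k w s \<partial>lborel)"

text \<open>\<open>c1\<close> and \<open>Q\<close> serve the upper bound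
  \<open>c1 * Q ^ k * M k\<close> of the moments at \<open>w = 0\<close>, \<open>c2\<close> and
  \<open>\<kappa>\<close> the lower bound \<open>c2 * \<kappa> ^ k * M k\<close>.\<close>

definition "W = (\<integral>s. exp (- \<bar>s::real\<bar>) \<partial>lborel)"
definition "Q = K4 * D\<^sup>2"
definition "c1 = K3 * (1 + K4\<^sup>2 * D ^ 3) * W"
definition "c2 = K1 * m 0 * (K2 / exp 1)"
definition "\<kappa> = K2 / exp 1"

lemma W_nonneg: "0 \<le> W"
  unfolding W_def by (rule Bochner_Integration.integral_nonneg) simp

lemma constants: "0 < Q" "0 \<le> c1" "0 < c2" "0 < \<kappa>"
  using K D(1) W_nonneg by (auto simp: Q_def c1_def c2_def \<kappa>_def)

lemma M_add_2_le: "M (k + 2) \<le> D ^ 3 * (D\<^sup>2) ^ k * M k"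
proof -
  have "M (k + 2) \<le> D ^ (k + 2) * M (k + 1)"
    using D(2)[of "k + 1"] by simp
  also have "\<dots> \<le> D ^ (k + 2) * (D ^ (k + 1) * M k)"
    using D by (intro mult_left_mono) auto
  also have "\<dots> = D ^ ((k + 2) + (k + 1)) * M k"
    by (simp only: power_add mult.assoc)
  also have "(k + 2) + (k + 1) = 3 + 2 * k" by simp
  finally show ?thesis by (simp only: power_add power_mult)
qed

lemma continuous_kern:
  assumes "w \<in> sector \<gamma>"
  shows "continuous_on UNIV (kern k w)"
  unfolding kern_def
  by (intro continuous_intros continuous_on_compose2[OF holomorphic_on_imp_continuous_on[OF holG]])
    (use assms in \<open>auto simp: sector_minus_real\<close>)

lemma measurable_kern: "w \<in> sector \<gamma> \<Longrightarrow> kern k w \<in> borel_measurable borel"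
  by (intro borel_measurable_continuous_onI continuous_kern)

lemma norm_kern: "cmod (kern k w s) = cmod (G (w - of_real s)) * exp (real (k + 1) * s)"
  by (simp add: kern_def norm_mult)

text \<open>Flatness of order \<open>k\<close> for \<open>s \<le> Re w\<close> and of order
  \<open>k + 2\<close> for larger \<open>s\<close> each leave exactly the decay
  \<open>exp (- \<bar>s - Re w\<bar>)\<close>. The second case needs \<open>M (k + 2)\<close> in
  terms of \<open>M k\<close>, which is where (dc) enters.\<close>

lemma kern_le:
  assumes w: "w \<in> sector \<gamma>"
  shows "cmod (kern k w s) \<le>
    K3 * (1 + K4\<^sup>2 * D ^ 3) * (Q ^ k * M k) * exp (real (k + 1) * Re w) * exp (- \<bar>s - Re w\<bar>)"
proof -
  define x where "x = Re w"
  have Qk: "K4 ^ k * (D\<^sup>2) ^ k = Q ^ k" by (simp add: Q_def power_mult_distrib)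
  have up: "cmod (kern k w s) \<le> K3 * (M p * (K4 * exp (x - s)) ^ p) * exp (real (k + 1) * s)" for p
    unfolding norm_kern using upper[OF sector_minus_real[OF w], of s p]
    by (intro mult_right_mono) (auto simp: x_def)
  have D2: "1 \<le> (D\<^sup>2) ^ k" "0 \<le> D ^ 3" using D(1) by (auto intro!: one_le_power)
  show ?thesis
  proof (cases "s \<le> x")
    case True
    have "cmod (kern k w s) \<le> K3 * (M k * (K4 * exp (x - s)) ^ k) * exp (real (k + 1) * s)"
      by (rule up)
    also have "\<dots> = K3 * (K4 ^ k * M k) * (exp (x - s) ^ k * exp (real (k + 1) * s))"
      by (simp add: power_mult_distrib)
    also have "exp (x - s) ^ k * exp (real (k + 1) * s) = exp (real (k + 1) * x) * exp (- \<bar>s - x\<bar>)"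
      using True by (simp add: exp_of_nat_mult[symmetric] algebra_simps flip: exp_add)
    also have "K3 * (K4 ^ k * M k) * (exp (real (k + 1) * x) * exp (- \<bar>s - x\<bar>)) \<le>
        K3 * ((1 + K4\<^sup>2 * D ^ 3) * (K4 ^ k * (D\<^sup>2) ^ k) * M k) * (exp (real (k + 1) * x) * exp (- \<bar>s - x\<bar>))"
    proof -
      have "1 * (K4 ^ k * 1) \<le> (1 + K4\<^sup>2 * D ^ 3) * (K4 ^ k * (D\<^sup>2) ^ k)"
        using K D2 by (intro mult_mono) auto
      then show ?thesis using K by (intro mult_right_mono mult_left_mono) auto
    qed
    finally show ?thesis by (simp add: Qk x_def mult.assoc)
  next
    case False
    have "cmod (kern k w s) \<le> K3 * (M (k + 2) * (K4 * exp (x - s)) ^ (k + 2)) * exp (real (k + 1) * s)"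
      by (rule up)
    also have "\<dots> = K3 * (K4 ^ (k + 2) * M (k + 2)) * (exp (x - s) ^ (k + 2) * exp (real (k + 1) * s))"
      by (simp only: power_mult_distrib mult_ac)
    also have "exp (x - s) ^ (k + 2) * exp (real (k + 1) * s) = exp (real (k + 1) * x) * exp (- \<bar>s - x\<bar>)"
      using False by (simp add: exp_of_nat_mult[symmetric] algebra_simps flip: exp_add)
    also have "K3 * (K4 ^ (k + 2) * M (k + 2)) * (exp (real (k + 1) * x) * exp (- \<bar>s - x\<bar>)) \<le>
        K3 * ((1 + K4\<^sup>2 * D ^ 3) * (K4 ^ k * (D\<^sup>2) ^ k) * M k) * (exp (real (k + 1) * x) * exp (- \<bar>s - x\<bar>))"
    proof -
      have "K4 ^ (k + 2) * M (k + 2) \<le> K4 ^ (k + 2) * (D ^ 3 * (D\<^sup>2) ^ k * M k)"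
        using K by (intro mult_left_mono M_add_2_le) auto
      also have "\<dots> = (K4\<^sup>2 * D ^ 3) * (K4 ^ k * (D\<^sup>2) ^ k * M k)"
        by (simp only: power_add mult_ac)
      also have "\<dots> \<le> (1 + K4\<^sup>2 * D ^ 3) * (K4 ^ k * (D\<^sup>2) ^ k * M k)"
        using K D by (intro mult_right_mono) auto
      finally show ?thesis using K by (intro mult_right_mono mult_left_mono) (auto simp: mult.assoc)
    qed
    finally show ?thesis by (simp add: Qk x_def mult.assoc)
  qed
qed

lemma integrable_kern:
  assumes "w \<in> sector \<gamma>"
  shows "integrable lborel (kern k w)"
proof (rule Bochner_Integration.integrable_bound)
  let ?c = "K3 * (1 + K4\<^sup>2 * D ^ 3) * (Q ^ k * M k) * exp (real (k + 1) * Re w)"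
  show "integrable lborel (\<lambda>s. ?c * exp (- \<bar>s - Re w\<bar>))"
    by (intro integrable_mult_right integrable_exp_minus_abs_diff)
  show "kern k w \<in> borel_measurable lborel"
    using measurable_kern[OF assms] by simp
  show "AE s in lborel. norm (kern k w s) \<le> norm (?c * exp (- \<bar>s - Re w\<bar>))"
  proof (rule AE_I2)
    fix s
    show "norm (kern k w s) \<le> norm (?c * exp (- \<bar>s - Re w\<bar>))"
      unfolding real_norm_def by (rule order_trans[OF kern_le[OF assms] abs_ge_self])
  qed
qed

lemma integral_norm_kern_le:
  assumes "w \<in> sector \<gamma>"
  shows "(\<integral>s. cmod (kern k w s) \<partial>lborel) \<le> c1 * (Q ^ k * M k) * exp (Re w) ^ (k + 1)"
proof -
  have "(\<integral>s. cmod (kern k w s) \<partial>lborel) \<le>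
      (\<integral>s. K3 * (1 + K4\<^sup>2 * D ^ 3) * (Q ^ k * M k) * exp (real (k + 1) * Re w) * exp (- \<bar>s - Re w\<bar>) \<partial>lborel)"
    using integrable_kern[OF assms] integrable_exp_minus_abs_diff kern_le[OF assms]
    by (intro integral_mono integrable_mult_right integrable_norm) auto
  also have "\<dots> = K3 * (1 + K4\<^sup>2 * D ^ 3) * (Q ^ k * M k) * exp (real (k + 1) * Re w) * W"
    by (simp only: integral_mult_right_zero integral_exp_minus_abs_diff W_def)
  also have "exp (real (k + 1) * Re w) = exp (Re w) ^ (k + 1)"
    by (rule exp_of_nat_mult)
  finally show ?thesis by (simp only: c1_def mult_ac)
qed

lemma integrable_indicator_kern:
  assumes "w \<in> sector \<gamma>" "B \<in> sets borel"
  shows "integrable lborel (\<lambda>s. indicator B s * kern k w s)"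
  by (rule Bochner_Integration.integrable_bound[OF integrable_kern[OF assms(1), of k]])
    (use measurable_kern[OF assms(1)] assms(2) in \<open>auto simp: indicator_def\<close>)

lemma mom_Compl:
  assumes "w \<in> sector \<gamma>" "B \<in> sets borel"
  shows "mom k UNIV w = mom k B w + mom k (- B) w"
proof -
  have "mom k B w + mom k (- B) w = (\<integral>s. indicator B s * kern k w s + indicator (- B) s * kern k w s \<partial>lborel)"
    unfolding mom_def using assms
    by (intro Bochner_Integration.integral_add[symmetric] integrable_indicator_kern) auto
  also have "(\<lambda>s. indicator B s * kern k w s + indicator (- B) s * kern k w s) = (\<lambda>s. indicator UNIV s * kern k w s)"
    by (auto simp: indicator_def)
  finally show ?thesis by (simp add: mom_def)
qed

lemma mom_holomorphic:
  assumes "B \<in> sets borel"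
  shows "mom k B holomorphic_on sector \<gamma>"
  unfolding mom_def[abs_def]
proof (rule holomorphic_on_parametric_integral[OF open_sector])
  fix s
  have "(G \<circ> (\<lambda>w. w - of_real s)) holomorphic_on sector \<gamma>"
    by (rule holomorphic_on_compose_gen[OF _ holG]) (auto intro!: holomorphic_intros simp: sector_minus_real)
  then have "(\<lambda>w. G (w - of_real s)) holomorphic_on sector \<gamma>"
    by (simp add: o_def)
  then show "(\<lambda>w. indicator B s * kern k w s) holomorphic_on sector \<gamma>"
    unfolding kern_def by (intro holomorphic_intros)
next
  fix w assume w: "w \<in> sector \<gamma>"
  show "(\<lambda>s. indicator B s * kern k w s) \<in> borel_measurable lborel"
    using measurable_kern[OF w] assms by auto
  obtain d where d: "0 < d" "ball w d \<subseteq> sector \<gamma>"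
    using open_sector w open_contains_ball by metis
  define a where "a = K3 * (1 + K4\<^sup>2 * D ^ 3) * (Q ^ k * M k)"
  have "0 \<le> a" using K D constants by (auto simp: a_def)
  \<comment> \<open>Moving \<open>Re w\<close> by less than \<open>d\<close> costs at most the
    factors \<open>exp ((k + 1) * d)\<close> and \<open>exp d\<close> in the bound of
    \<open>kern_le\<close>.\<close>
  define b where "b s = a * exp (real (k + 1) * (Re w + d)) * exp d * exp (- \<bar>s - Re w\<bar>)" for s
  have "cmod (indicator B s * kern k z s) \<le> b s" if z: "z \<in> ball w d" for z s
  proof -
    have "\<bar>Re z - Re w\<bar> < d"
      using z abs_Re_le_cmod[of "z - w"] by (simp add: dist_norm norm_minus_commute)
    then have "exp (real (k + 1) * Re z) \<le> exp (real (k + 1) * (Re w + d))"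
      "exp (- \<bar>s - Re z\<bar>) \<le> exp (d + - \<bar>s - Re w\<bar>)"
      by (simp_all add: mult_left_mono)
    then have "a * exp (real (k + 1) * Re z) * exp (- \<bar>s - Re z\<bar>) \<le> a * exp (real (k + 1) * (Re w + d)) * exp (d + - \<bar>s - Re w\<bar>)"
      using \<open>0 \<le> a\<close> by (intro mult_mono) auto
    moreover have "cmod (kern k z s) \<le> a * exp (real (k + 1) * Re z) * exp (- \<bar>s - Re z\<bar>)"
      unfolding a_def using d(2) z by (intro kern_le) auto
    moreover have "cmod (indicator B s * kern k z s) \<le> cmod (kern k z s)"
      by (auto simp: indicator_def)
    moreover have "b s = a * exp (real (k + 1) * (Re w + d)) * exp (d + - \<bar>s - Re w\<bar>)"
      unfolding b_def exp_add by (simp only: mult.assoc)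
    ultimately show ?thesis by linarith
  qed
  moreover have "integrable lborel b"
    unfolding b_def by (intro integrable_mult_right integrable_exp_minus_abs_diff)
  ultimately show "\<exists>d>0. \<exists>b. ball w d \<subseteq> sector \<gamma> \<and> integrable lborel b \<and>
      (\<forall>z\<in>ball w d. \<forall>s. cmod (indicator B s * kern k z s) \<le> b s)"
    using d by blast
qed

text \<open>
  After division by \<open>z\<^sup>k\<^sup>+\<^sup>1\<close> the full integral is invariant under dilations by positive factors, hence
  constant by holomorphy. This replaces a rotation of the path of integration.
\<close>

lemma mom_UNIV:
  assumes w: "w \<in> sector \<gamma>"
  shows "mom k UNIV w = mom k UNIV 0 * exp w ^ (k + 1)"
proof -
  define H where "H w = exp (- (of_nat (k + 1) * w)) * mom k UNIV w" for w
  have hol: "H holomorphic_on sector \<gamma>"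
    unfolding H_def by (intro holomorphic_intros mom_holomorphic) auto
  have shift: "H (w + of_real r) = H w" for w r
  proof -
    have "mom k UNIV (w + of_real r) = (\<integral>s. kern k (w + of_real r) (r + 1 * s) \<partial>lborel)"
      unfolding mom_def using lborel_integral_real_affine[of 1 "kern k (w + of_real r)" r] by simp
    also have "(\<lambda>s. kern k (w + of_real r) (r + 1 * s)) = (\<lambda>s. of_real (exp (real (k + 1) * r)) * kern k w s)"
      by (auto simp: kern_def algebra_simps exp_add)
    also have "(\<integral>s. of_real (exp (real (k + 1) * r)) * kern k w s \<partial>lborel) = of_real (exp (real (k + 1) * r)) * mom k UNIV w"
      by (simp add: mom_def)
    finally show ?thesis
      by (simp add: H_def exp_of_real[symmetric] distrib_left mult.assoc[symmetric] flip: exp_add)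
  qed
  have "(H has_field_derivative 0) (at z)" if z: "z \<in> sector \<gamma>" for z
  proof -
    have H': "(H has_field_derivative deriv H z) (at z)"
      by (rule holomorphic_derivI[OF hol open_sector z])
    \<comment> \<open>The complex derivative exists, so real increments determine it; along them
      \<open>H\<close> is constant.\<close>
    have "(\<lambda>n. (H (z + of_real (1 / real (Suc n))) - H z) / (z + of_real (1 / real (Suc n)) - z)) \<longlonglongrightarrow> deriv H z"
    proof -
      have "(\<lambda>n. z + of_real (1 / real (Suc n))) \<longlonglongrightarrow> z + of_real 0"
        by (intro tendsto_intros LIMSEQ_Suc lim_1_over_n)
      then show ?thesis
        using H' unfolding has_field_derivative_iff tendsto_at_iff_sequentially o_def
        by (elim allE[of _ "\<lambda>n. z + of_real (1 / real (Suc n))"]) (auto simp del: of_nat_Suc)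
    qed
    then have "(\<lambda>n::nat. 0) \<longlonglongrightarrow> deriv H z" by (simp only: shift diff_self div_0)
    then have "deriv H z = 0" by (simp add: LIMSEQ_const_iff)
    then show ?thesis using H' by simp
  qed
  then have "H constant_on sector \<gamma>"
    by (rule has_field_derivative_0_imp_constant_on)
      (auto simp: open_sector convex_connected convex_sector)
  moreover have "0 \<in> sector \<gamma>" using of_real_in_sector[OF \<gamma>, of 0] by simp
  ultimately have "H w = H 0" using w by (auto simp: constant_on_def)
  then have "exp (of_nat (k + 1) * w) * (exp (- (of_nat (k + 1) * w)) * mom k UNIV w) = exp (of_nat (k + 1) * w) * mom k UNIV 0"
    by (simp add: H_def)
  then have "mom k UNIV w = exp (of_nat (k + 1) * w) * mom k UNIV 0"
    by (simp add: mult.assoc[symmetric] del: of_nat_add of_nat_Suc flip: exp_add)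
  then show ?thesis
    by (simp only: exp_of_nat_mult mult.commute[of "mom k UNIV 0"])
qed

lemma zero_in_sector: "0 \<in> sector \<gamma>"
  using of_real_in_sector[OF \<gamma>, of 0] by simp

text \<open>On the positive axis the real part of the kernel is nonnegative, so only
  \<open>s\<close> in \<open>{b - 1..b}\<close> with \<open>b = ln (K2 * m k)\<close> is kept. There
  \<open>h_ge_at\<close> gives \<open>M k / m k ^ k\<close> and the exponential is at least
  \<open>(K2 * m k / exp 1) ^ (k + 1)\<close>. The powers of \<open>m k\<close> cancel up to one
  factor, which is at least \<open>m 0\<close>.\<close>

lemma norm_mom_ge: "c2 * \<kappa> ^ k * M k \<le> cmod (mom k UNIV 0)"
proof -
  define b where "b = ln (K2 * m k)"
  define a where "a = K1 * (M k / m k ^ k) * (K2 * m k / exp 1) ^ (k + 1)"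
  have "0 \<le> a" using K by (simp add: a_def)
  have Re_kern: "Re (kern k 0 s) = Re (G (- of_real s)) * exp (real (k + 1) * s)" for s
    by (simp add: kern_def)
  have Re_G: "K1 * h_fun M (K2 * exp (- s)) \<le> Re (G (- of_real s))" for s
    using lower[of "exp (- s)"] by simp
  have Re_G_nonneg: "0 \<le> Re (G (- of_real s))" for s
    using K by (intro order_trans[OF _ Re_G] mult_nonneg_nonneg h_nonneg) auto
  have le: "indicator {b - 1..b} s * a \<le> Re (kern k 0 s)" for s
  proof (cases "s \<in> {b - 1..b}")
    case True
    have "1 / m k \<le> K2 * exp (- s)"
    proof -
      have "exp s \<le> exp b" using True by simp
      also have "exp b = K2 * m k" using K by (simp add: b_def)
      finally show ?thesis by (simp add: field_simps exp_minus)
    qed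
    then have "K1 * (M k / m k ^ k) \<le> Re (G (- of_real s))"
      using K by (intro order_trans[OF mult_left_mono Re_G] h_ge_at) auto
    moreover have "(K2 * m k / exp 1) ^ (k + 1) \<le> exp (real (k + 1) * s)"
    proof -
      have "(K2 * m k / exp 1) ^ (k + 1) = exp (real (k + 1) * (b - 1))"
        using K by (simp only: exp_of_nat_mult) (simp add: b_def exp_diff)
      also have "\<dots> \<le> exp (real (k + 1) * s)"
        unfolding exp_le_cancel_iff using True by (intro mult_left_mono) auto
      finally show ?thesis .
    qed
    ultimately have "a \<le> Re (kern k 0 s)"
      unfolding Re_kern a_def using K by (intro mult_mono Re_G_nonneg) auto
    then show ?thesis using True by simp
  next
    case False
    then show ?thesis using Re_G_nonneg by (simp add: Re_kern)
  qed
  have "a = (\<integral>s. indicator {b - 1..b} s * a \<partial>lborel)" by simp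
  also have "\<dots> \<le> (\<integral>s. Re (kern k 0 s) \<partial>lborel)"
    using le integrable_kern[OF zero_in_sector, of k]
    by (intro integral_mono integrable_Re) auto
  also have "\<dots> = Re (mom k UNIV 0)"
    using integrable_kern[OF zero_in_sector, of k] by (simp add: mom_def)
  also have "\<dots> \<le> cmod (mom k UNIV 0)" by (rule complex_Re_le_cmod)
  finally have "a \<le> cmod (mom k UNIV 0)" .
  moreover have "c2 * \<kappa> ^ k * M k \<le> a"
  proof -
    have "a = K1 * m k * \<kappa> * \<kappa> ^ k * M k"
    proof -
      have "K2 * m k / exp 1 = \<kappa> * m k" by (simp add: \<kappa>_def)
      then show ?thesis by (simp add: a_def power_mult_distrib)
    qed
    moreover have "K1 * m 0 * \<kappa> * \<kappa> ^ k * M k \<le> K1 * m k * \<kappa> * \<kappa> ^ k * M k"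
      using K constants m_mono[of 0 k] by (intro mult_right_mono mult_left_mono) auto
    ultimately show ?thesis by (simp add: c2_def \<kappa>_def)
  qed
  ultimately show ?thesis by linarith
qed

text \<open>A change of the order from \<open>k\<close> to \<open>N\<close> on a part
  \<open>B\<close> of the line. It is applied to the left of the cut with \<open>k \<ge> N\<close>
  and to the right of it with \<open>k \<le> N\<close>.\<close>

lemma norm_mom_le:
  assumes w: "w \<in> sector \<gamma>" and B: "B \<in> sets borel" and "0 \<le> c"
    and le: "\<And>s. s \<in> B \<Longrightarrow> exp (real (k + 1) * s) \<le> c * exp (real (N + 1) * s)"
  shows "cmod (mom k B w) \<le> c * (c1 * (Q ^ N * M N) * exp (Re w) ^ (N + 1))"
proof -
  have "cmod (mom k B w) \<le> (\<integral>s. c * cmod (kern N w s) \<partial>lborel)"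
    unfolding mom_def
  proof (rule Bochner_Integration.integral_norm_bound_integral)
    fix s
    show "norm (indicator B s * kern k w s) \<le> c * cmod (kern N w s)"
    proof (cases "s \<in> B")
      case True
      then have "cmod (G (w - of_real s)) * exp (real (k + 1) * s) \<le> cmod (G (w - of_real s)) * (c * exp (real (N + 1) * s))"
        by (intro mult_left_mono le) auto
      then show ?thesis using True unfolding norm_mult norm_kern by (simp add: mult_ac)
    qed (use \<open>0 \<le> c\<close> in simp)
  qed (use w B in \<open>auto intro!: integrable_indicator_kern integrable_mult_right integrable_norm integrable_kern\<close>)
  also have "\<dots> = c * (\<integral>s. cmod (kern N w s) \<partial>lborel)" by simp
  also have "\<dots> \<le> c * (c1 * (Q ^ N * M N) * exp (Re w) ^ (N + 1))"
    using \<open>0 \<le> c\<close> by (intro mult_left_mono integral_norm_kern_le w)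
  finally show ?thesis .
qed

section \<open>The truncated Laplace transform as an extension operator\<close>

text \<open>The coefficients of a Borel transform of \<open>F\<close> adapted to the kernel:
  integrated over the whole line, \<open>coef F k\<close> reproduces the term of order
  \<open>k\<close>.\<close>

definition coef :: "complex fps \<Rightarrow> nat \<Rightarrow> complex" where
  "coef F k = fps_nth F k / mom k UNIV 0"

lemma mom_nz: "mom k UNIV 0 \<noteq> 0"
proof -
  have "0 < c2 * \<kappa> ^ k * M k" using constants by simp
  then show ?thesis using norm_mom_ge[of k] by auto
qed

context
  fixes A :: real
  assumes A: "0 < A"
begin

text \<open>By \<open>norm_coef_le\<close> the Borel transform converges at least for moduli below
  \<open>\<kappa> / A\<close>; truncating at half of this radius makes the series in question
  geometric of ratio 1/2.\<close>

definition cut :: real where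
  "cut = ln (\<kappa> / (2 * A))"

text \<open>The truncated integral applied term by term; \<open>exp (- w)\<close> is the factor
  \<open>1 / z\<close> in front of it.\<close>

definition ext_op :: "complex fps \<Rightarrow> complex \<Rightarrow> complex" where
  "ext_op F w = exp (- w) * (\<Sum>k. coef F k * mom k {..cut} w)"

definition bnd :: "complex fps \<Rightarrow> real" where
  "bnd F = series_norm M A F * (c1 / c2)"

lemma exp_cut: "exp cut = \<kappa> / (2 * A)"
  using constants A by (simp add: cut_def)

lemma norm_coef_le:
  assumes "F \<in> series_class M A"
  shows "cmod (coef F k) \<le> series_norm M A F / c2 * (A / \<kappa>) ^ k"
proof -
  have "0 < c2 * \<kappa> ^ k * M k" using constants by simp
  then have "cmod (coef F k) \<le> series_norm M A F * (A ^ k * M k) / (c2 * \<kappa> ^ k * M k)"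
    unfolding coef_def norm_divide
    using series_classD[OF assms A, of k] norm_mom_ge[of k] series_norm_nonneg[OF assms A] A
    by (intro frac_le) auto
  also have "\<dots> = series_norm M A F / c2 * (A / \<kappa>) ^ k"
    by (simp add: power_divide)
  finally show ?thesis .
qed

lemma bnd_nonneg: "F \<in> series_class M A \<Longrightarrow> 0 \<le> bnd F"
  using series_norm_nonneg[OF _ A] constants by (simp add: bnd_def)

text \<open>To the left of the cut, \<open>u ^ (N + j)\<close> is at most
  \<open>exp cut ^ j * u ^ N\<close>, and \<open>(A / \<kappa>) ^ j * exp cut ^ j\<close> equals
  \<open>(1 / 2) ^ j\<close>.\<close>

lemma low_term_le:
  assumes F: "F \<in> series_class M A" and w: "w \<in> sector \<gamma>"
  shows "cmod (coef F (N + j) * mom (N + j) {..cut} w) \<le>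
    bnd F * ((A * Q / \<kappa>) ^ N * M N * exp (Re w) ^ (N + 1)) * (1 / 2) ^ j"
proof -
  have "cmod (mom (N + j) {..cut} w) \<le> exp cut ^ j * (c1 * (Q ^ N * M N) * exp (Re w) ^ (N + 1))"
  proof (rule norm_mom_le[OF w])
    fix s assume "s \<in> {..cut}"
    then have "exp s ^ j \<le> exp cut ^ j" by (intro power_mono) auto
    then have "exp s ^ j * exp s ^ (N + 1) \<le> exp cut ^ j * exp s ^ (N + 1)"
      by (intro mult_right_mono) auto
    then show "exp (real (N + j + 1) * s) \<le> exp cut ^ j * exp (real (N + 1) * s)"
      unfolding exp_of_nat_mult by (simp add: power_add mult_ac)
  qed auto
  then have "cmod (coef F (N + j) * mom (N + j) {..cut} w) \<le>
      (series_norm M A F / c2 * (A / \<kappa>) ^ (N + j)) * (exp cut ^ j * (c1 * (Q ^ N * M N) * exp (Re w) ^ (N + 1)))"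
    unfolding norm_mult using norm_coef_le[OF F, of "N + j"] series_norm_nonneg[OF F A] constants A
    by (intro mult_mono) auto
  also have "\<dots> = bnd F * ((A / \<kappa>) ^ N * Q ^ N * M N * exp (Re w) ^ (N + 1)) * ((A / \<kappa>) ^ j * exp cut ^ j)"
    by (simp add: bnd_def power_add mult_ac)
  also have "(A / \<kappa>) ^ j * exp cut ^ j = (1 / 2) ^ j"
    unfolding power_mult_distrib[symmetric] exp_cut using A constants by simp
  also have "(A / \<kappa>) ^ N * Q ^ N = (A * Q / \<kappa>) ^ N"
    by (simp flip: power_mult_distrib)
  finally show ?thesis .
qed

text \<open>To the right of the cut, \<open>u ^ k\<close> is at most
  \<open>exp (- cut) ^ (N - k) * u ^ N\<close>; with \<open>exp (- cut) = 2 * A / \<kappa>\<close>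
  the constants combine to \<open>(2 * A / \<kappa>) ^ N * (1 / 2) ^ k\<close>.\<close>

lemma high_term_le:
  assumes F: "F \<in> series_class M A" and w: "w \<in> sector \<gamma>" and "k \<le> N"
  shows "cmod (coef F k * mom k (- {..cut}) w) \<le>
    bnd F * ((2 * A * Q / \<kappa>) ^ N * M N * exp (Re w) ^ (N + 1)) * (1 / 2) ^ k"
proof -
  obtain j where N: "N = k + j" using \<open>k \<le> N\<close> le_Suc_ex by blast
  have "cmod (mom k (- {..cut}) w) \<le> exp (- cut) ^ j * (c1 * (Q ^ N * M N) * exp (Re w) ^ (N + 1))"
  proof (rule norm_mom_le[OF w])
    fix s assume "s \<in> - {..cut}"
    then have "1 \<le> exp (- cut + s) ^ j" by (intro one_le_power) simp
    then have "1 * exp s ^ (k + 1) \<le> (exp (- cut) * exp s) ^ j * exp s ^ (k + 1)"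
      unfolding exp_add by (intro mult_right_mono) auto
    then show "exp (real (k + 1) * s) \<le> exp (- cut) ^ j * exp (real (N + 1) * s)"
      unfolding exp_of_nat_mult N by (simp add: power_add power_mult_distrib mult_ac)
  qed auto
  then have "cmod (coef F k * mom k (- {..cut}) w) \<le>
      (series_norm M A F / c2 * (A / \<kappa>) ^ k) * (exp (- cut) ^ j * (c1 * (Q ^ N * M N) * exp (Re w) ^ (N + 1)))"
    unfolding norm_mult using norm_coef_le[OF F, of k] series_norm_nonneg[OF F A] constants A
    by (intro mult_mono) auto
  also have "\<dots> = bnd F * (((A / \<kappa>) ^ k * exp (- cut) ^ j) * Q ^ N * M N * exp (Re w) ^ (N + 1))"
    by (simp add: bnd_def mult_ac)
  also have "(A / \<kappa>) ^ k * exp (- cut) ^ j = (2 * A / \<kappa>) ^ N * (1 / 2) ^ k"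
  proof -
    have "exp (- cut) = 2 * A / \<kappa>" by (simp add: exp_minus exp_cut)
    moreover have "(A / \<kappa>) ^ k = (2 * A / \<kappa>) ^ k * (1 / 2) ^ k"
      unfolding power_mult_distrib[symmetric] by simp
    ultimately show ?thesis by (simp only: N power_add mult_ac)
  qed
  also have "bnd F * ((2 * A / \<kappa>) ^ N * (1 / 2) ^ k * Q ^ N * M N * exp (Re w) ^ (N + 1)) =
      bnd F * (((2 * A / \<kappa>) ^ N * Q ^ N) * M N * exp (Re w) ^ (N + 1)) * (1 / 2) ^ k"
    by (simp only: mult_ac)
  also have "(2 * A / \<kappa>) ^ N * Q ^ N = (2 * A * Q / \<kappa>) ^ N"
    by (simp flip: power_mult_distrib)
  finally show ?thesis .
qed

lemma summable_ext_op:
  assumes "F \<in> series_class M A" "w \<in> sector \<gamma>"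
  shows "summable (\<lambda>k. coef F k * mom k {..cut} w)"
proof (rule summable_comparison_test')
  show "summable (\<lambda>k. bnd F * exp (Re w) * (1 / 2) ^ k)"
    by (intro summable_mult sums_summable[OF sums_half_powers])
  show "norm (coef F k * mom k {..cut} w) \<le> bnd F * exp (Re w) * (1 / 2) ^ k" for k
    using low_term_le[OF assms, of 0 k] by simp
qed

lemma ext_op_holomorphic:
  assumes F: "F \<in> series_class M A"
  shows "ext_op F holomorphic_on sector \<gamma>"
proof -
  \<comment> \<open>With \<open>N = 0\<close> in \<open>low_term_le\<close> the factor
    \<open>exp (- w)\<close> cancels the growth in \<open>w\<close>, so the majorants are uniform on
    the whole sector.\<close>
  have unif: "uniform_limit (sector \<gamma>) (\<lambda>n w. \<Sum>k<n. exp (- w) * (coef F k * mom k {..cut} w))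
      (\<lambda>w. \<Sum>k. exp (- w) * (coef F k * mom k {..cut} w)) sequentially"
  proof (rule Weierstrass_m_test)
    show "summable (\<lambda>k. bnd F * (1 / 2) ^ k)"
      by (intro summable_mult sums_summable[OF sums_half_powers])
    fix k w assume "w \<in> sector \<gamma>"
    from low_term_le[OF F this, of 0 k]
    have "exp (- Re w) * cmod (coef F k * mom k {..cut} w) \<le> exp (- Re w) * (bnd F * exp (Re w) * (1 / 2) ^ k)"
      by (intro mult_left_mono) auto
    also have "\<dots> = bnd F * (1 / 2) ^ k * (exp (- Re w) * exp (Re w))"
      by (simp only: mult_ac)
    finally show "norm (exp (- w) * (coef F k * mom k {..cut} w)) \<le> bnd F * (1 / 2) ^ k"
      by (simp add: norm_mult flip: exp_add)
  qed
  have "(\<lambda>w. \<Sum>k. exp (- w) * (coef F k * mom k {..cut} w)) holomorphic_on sector \<gamma>"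
  proof (rule holomorphic_uniform_sequence[OF open_sector])
    show "(\<lambda>w. \<Sum>k<n. exp (- w) * (coef F k * mom k {..cut} w)) holomorphic_on sector \<gamma>" for n
      by (intro holomorphic_intros mom_holomorphic) auto
    fix w assume "w \<in> sector \<gamma>"
    then obtain d where d: "0 < d" "cball w d \<subseteq> sector \<gamma>"
      using open_sector open_contains_cball by metis
    then show "\<exists>d>0. cball w d \<subseteq> sector \<gamma> \<and> uniform_limit (cball w d)
        (\<lambda>n w. \<Sum>k<n. exp (- w) * (coef F k * mom k {..cut} w))
        (\<lambda>w. \<Sum>k. exp (- w) * (coef F k * mom k {..cut} w)) sequentially"
      using uniform_limit_on_subset[OF unif] by blast
  qed
  then show ?thesis
    by (rule holomorphic_transform) (simp add: ext_op_def suminf_mult summable_ext_op[OF F])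
qed

text \<open>Each term of the partial sum is a full moment, hence the sum of its parts on both sides
  of the cut. What remains are the left parts from \<open>N\<close> on and the right parts below
  \<open>N\<close>, each a geometric sum.\<close>

lemma ext_op_expansion:
  assumes F: "F \<in> series_class M A" and w: "w \<in> sector \<gamma>"
  shows "cmod (ext_op F w - (\<Sum>k<N. fps_nth F k * exp w ^ k)) \<le>
    4 * bnd F * ((2 * Q / \<kappa> * A) ^ N * M N * exp (Re w) ^ N)"
proof -
  let ?low = "\<lambda>k. coef F k * mom k {..cut} w"
  let ?high = "\<lambda>k. coef F k * mom k (- {..cut}) w"
  define E where "E = (2 * A * Q / \<kappa>) ^ N * M N * exp (Re w) ^ (N + 1)"
  define E' where "E' = (A * Q / \<kappa>) ^ N * M N * exp (Re w) ^ (N + 1)"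
  have "(A * Q / \<kappa>) ^ N \<le> (2 * A * Q / \<kappa>) ^ N"
    using A constants by (intro power_mono divide_right_mono mult_right_mono) auto
  then have E: "0 \<le> E'" "E' \<le> E"
    unfolding E_def E'_def using A constants by (auto intro!: mult_right_mono)
  have summand: "fps_nth F k * exp w ^ k = exp (- w) * (?low k + ?high k)" for k
  proof -
    have "?low k + ?high k = coef F k * mom k UNIV w"
      using mom_Compl[OF w, of "{..cut}" k] by (simp add: distrib_left)
    also have "\<dots> = fps_nth F k * exp w ^ (k + 1)"
      using mom_nz[of k] by (simp add: mom_UNIV[OF w] coef_def)
    finally show ?thesis by (simp add: exp_minus field_simps)
  qed
  have "(\<Sum>k. ?low k) = (\<Sum>j. ?low (j + N)) + (\<Sum>k<N. ?low k)"
    by (rule suminf_split_initial_segment[OF summable_ext_op[OF F w]])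
  then have "ext_op F w - (\<Sum>k<N. fps_nth F k * exp w ^ k) =
      exp (- w) * ((\<Sum>j. ?low (j + N)) - (\<Sum>k<N. ?high k))"
    unfolding ext_op_def summand sum_distrib_left[symmetric] sum.distrib by (simp add: algebra_simps)
  then have "cmod (ext_op F w - (\<Sum>k<N. fps_nth F k * exp w ^ k)) =
      exp (- Re w) * cmod ((\<Sum>j. ?low (j + N)) - (\<Sum>k<N. ?high k))"
    by (simp add: norm_mult)
  also have "\<dots> \<le> exp (- Re w) * (2 * (bnd F * E) + 2 * (bnd F * E))"
  proof (intro mult_left_mono order_trans[OF norm_triangle_ineq4] add_mono)
    have sums: "(\<lambda>j. bnd F * E' * (1 / 2) ^ j) sums (bnd F * E' * 2)"
      by (intro sums_mult sums_half_powers)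
    have le: "norm (?low (j + N)) \<le> bnd F * E' * (1 / 2) ^ j" for j
      using low_term_le[OF F w, of N j] by (simp only: E'_def add.commute)
    have "norm (\<Sum>j. ?low (j + N)) \<le> (\<Sum>j. bnd F * E' * (1 / 2) ^ j)"
      by (rule norm_suminf_le[OF le sums_summable[OF sums]])
    also have "\<dots> = bnd F * E' * 2" by (rule sums_unique[OF sums, symmetric])
    also have "\<dots> \<le> 2 * (bnd F * E)"
      using E bnd_nonneg[OF F] by (simp add: mult_right_mono)
    finally show "cmod (\<Sum>j. ?low (j + N)) \<le> 2 * (bnd F * E)" .
    have "cmod (\<Sum>k<N. ?high k) \<le> (\<Sum>k<N. bnd F * E * (1 / 2) ^ k)"
      unfolding E_def by (intro sum_norm_le high_term_le F w) auto
    also have "\<dots> = bnd F * E * (\<Sum>k<N. (1 / 2) ^ k)" by (simp add: sum_distrib_left)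
    also have "\<dots> \<le> bnd F * E * 2"
      using E bnd_nonneg[OF F] sums_unique[OF sums_half_powers]
        sum_le_suminf[OF sums_summable[OF sums_half_powers], of "{..<N}"]
      by (intro mult_left_mono) auto
    finally show "cmod (\<Sum>k<N. ?high k) \<le> 2 * (bnd F * E)" by simp
  qed auto
  also have "\<dots> = 4 * bnd F * ((2 * Q / \<kappa> * A) ^ N * M N * (exp (- Re w) * exp (Re w) ^ (N + 1)))"
    unfolding E_def by (simp add: mult_ac)
  also have "exp (- Re w) * exp (Re w) ^ (N + 1) = exp (Re w) ^ N"
    by (simp add: exp_minus)
  finally show ?thesis .
qed

lemma has_unif_expansion_ext_op:
  "F \<in> series_class M A \<Longrightarrow> has_unif_expansion M (2 * Q / \<kappa> * A) (sector \<gamma>) (ext_op F) F"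
  by (rule has_unif_expansionI[OF _ ext_op_expansion]) (use A constants in auto)

lemma coef_simps:
  "coef (F - H) k = coef F k - coef H k" "coef (F + H) k = coef F k + coef H k"
  "coef (fps_const a * F) k = a * coef F k"
  by (simp_all add: coef_def diff_divide_distrib add_divide_distrib)

lemma ext_op_diff:
  assumes "F \<in> series_class M A" "H \<in> series_class M A" "w \<in> sector \<gamma>"
  shows "ext_op (F - H) w = ext_op F w - ext_op H w"
  by (simp only: ext_op_def coef_simps left_diff_distrib right_diff_distrib
      suminf_diff[OF summable_ext_op[OF assms(1,3)] summable_ext_op[OF assms(2,3)], symmetric])

lemma ext_op_add:
  assumes "F \<in> series_class M A" "H \<in> series_class M A" "w \<in> sector \<gamma>"
  shows "ext_op (F + H) w = ext_op F w + ext_op H w"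
  by (simp only: ext_op_def coef_simps distrib_left distrib_right
      suminf_add[OF summable_ext_op[OF assms(1,3)] summable_ext_op[OF assms(2,3)], symmetric])

lemma ext_op_scale:
  assumes "F \<in> series_class M A" "w \<in> sector \<gamma>"
  shows "ext_op (fps_const a * F) w = a * ext_op F w"
proof -
  have "(\<Sum>k. coef (fps_const a * F) k * mom k {..cut} w) = a * (\<Sum>k. coef F k * mom k {..cut} w)"
    unfolding suminf_mult[OF summable_ext_op[OF assms], symmetric] by (simp only: coef_simps mult.assoc)
  then show ?thesis by (simp add: ext_op_def)
qed

lemma linear_continuous_ext_op: "linear_continuous_op M A (2 * Q / \<kappa> * A) (sector \<gamma>) ext_op"
  unfolding linear_continuous_op_def
proof (intro conjI ballI allI impI)
  have c: "0 < 2 * Q / \<kappa> * A" using A constants by simp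
  fix F assume F: "F \<in> series_class M A"
  show "ext_op F \<in> Au_class M (2 * Q / \<kappa> * A) (sector \<gamma>)"
    using has_unif_expansion_ext_op[OF F] ext_op_holomorphic[OF F]
    by (auto simp: Au_class_def rl_holomorphic_on_iff open_sector)
  fix w assume w: "w \<in> sector \<gamma>"
  show "ext_op (fps_const a * F) w = a * ext_op F w" for a
    by (rule ext_op_scale[OF F w])
  show "ext_op (F + H) w = ext_op F w + ext_op H w" if "H \<in> series_class M A" for H
    by (rule ext_op_add[OF F that w])
next
  have c: "0 < 2 * Q / \<kappa> * A" using A constants by simp
  fix F and \<epsilon> :: real assume F: "F \<in> series_class M A" and "0 < \<epsilon>"
  \<comment> \<open>The estimate of \<open>ext_op_expansion\<close> makes the operator bounded with
    constant \<open>4 * (c1 / c2)\<close>. As \<open>c1\<close> is only known to be nonnegative, 1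
    is added to allow division by \<open>C\<close>.\<close>
  define C where "C = 4 * (c1 / c2) + 1"
  have C: "0 < C" "4 * (c1 / c2) \<le> C" using constants by (auto simp: C_def add_nonneg_pos)
  have "Au_norm M (2 * Q / \<kappa> * A) (sector \<gamma>) (\<lambda>z. ext_op H z - ext_op F z) < \<epsilon>"
    if H: "H \<in> series_class M A" and less: "series_norm M A (H - F) < \<epsilon> / C" for H
  proof -
    have HF: "H - F \<in> series_class M A"
    proof (rule series_classI[OF A])
      fix k
      have "cmod (fps_nth H k - fps_nth F k) \<le> series_norm M A H * (A ^ k * M k) + series_norm M A F * (A ^ k * M k)"
        by (intro order_trans[OF norm_triangle_ineq4] add_mono series_classD H F A)
      then show "cmod (fps_nth (H - F) k) \<le> (series_norm M A H + series_norm M A F) * (A ^ k * M k)"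
        by (simp add: distrib_right)
    qed
    let ?f = "\<lambda>z. ext_op H z - ext_op F z"
    have bound: "cmod (?f z - (\<Sum>k<p. fps_nth (H - F) k * exp z ^ k)) \<le>
        4 * bnd (H - F) * ((2 * Q / \<kappa> * A) ^ p * M p * exp (Re z) ^ p)" if "z \<in> sector \<gamma>" for z p
      using ext_op_expansion[OF HF that, of p] by (simp only: ext_op_diff[OF H F that])
    \<comment> \<open>The norm refers to the expansion through \<open>borel_map\<close>, so the
      expansion of the difference is identified first.\<close>
    then have borel: "borel_map M (sector \<gamma>) ?f = H - F"
      by (intro borel_map_eq[OF \<gamma> c] has_unif_expansionI[OF c])
    have "Au_norm M (2 * Q / \<kappa> * A) (sector \<gamma>) ?f \<le> 4 * bnd (H - F)"
      unfolding Au_norm_def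
    proof (intro cSUP_least)
      show "sector \<gamma> \<times> (UNIV :: nat set) \<noteq> {}" using zero_in_sector by blast
      fix x assume "x \<in> sector \<gamma> \<times> (UNIV :: nat set)"
      then obtain z p where x: "x = (z, p)" "z \<in> sector \<gamma>" by blast
      show "asymp_quot M (2 * Q / \<kappa> * A) ?f (borel_map M (sector \<gamma>) ?f) x \<le> 4 * bnd (H - F)"
        unfolding x(1) asymp_quot_le_iff[OF c] borel by (rule bound[OF x(2)])
    qed
    also have "\<dots> = series_norm M A (H - F) * (4 * (c1 / c2))" by (simp add: bnd_def)
    also have "\<dots> \<le> series_norm M A (H - F) * C"
      by (intro mult_left_mono C series_norm_nonneg[OF HF A])
    also have "\<dots> < \<epsilon>" using less C by (simp add: pos_less_divide_eq)
    finally show ?thesis .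
  qed
  then show "\<exists>\<delta>>0. \<forall>H\<in>series_class M A. series_norm M A (H - F) < \<delta> \<longrightarrow>
      Au_norm M (2 * Q / \<kappa> * A) (sector \<gamma>) (\<lambda>z. ext_op H z - ext_op F z) < \<epsilon>"
    using \<open>0 < \<epsilon>\<close> C(1) by (intro exI[of _ "\<epsilon> / C"]) auto
qed

lemma borel_map_ext_op: "F \<in> series_class M A \<Longrightarrow> borel_map M (sector \<gamma>) (ext_op F) = F"
  by (rule borel_map_eq[OF \<gamma> _ has_unif_expansion_ext_op]) (use A constants in auto)

end

lemma extension_operators: "has_extension_operators M (sector \<gamma>)"
  unfolding has_extension_operators_def
\<comment> \<open>The cut depends on \<open>A\<close>, but the factor by which the type grows does
  not.\<close>
proof (intro exI[of _ "2 * Q / \<kappa>"] conjI allI impI)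
  show "0 < 2 * Q / \<kappa>" using constants by simp
  fix A :: real assume A: "0 < A"
  show "\<exists>T. linear_continuous_op M A (2 * Q / \<kappa> * A) (sector \<gamma>) T \<and>
      (\<forall>F\<in>series_class M A. borel_map M (sector \<gamma>) (T F) = F)"
    using linear_continuous_ext_op[OF A] borel_map_ext_op[OF A] by blast
qed

end

context weight_seq
begin

lemma optimal_flat_imp_extension_operators:
  assumes "0 < \<gamma>" "cond_dc M" "optimal_flat M (sector \<gamma>) G"
  shows "has_extension_operators M (sector \<gamma>)"
proof -
  obtain D0 where D0: "0 < D0" "\<And>p. M (p + 1) \<le> D0 ^ (p + 1) * M p"
    using assms(2) unfolding cond_dc_def by blast
  define D where "D = max 1 D0"
  have D: "1 \<le> D" "M (p + 1) \<le> D ^ (p + 1) * M p" for p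
  proof -
    have "D0 ^ (p + 1) * M p \<le> D ^ (p + 1) * M p"
      using D0(1) by (intro mult_right_mono power_mono) (auto simp: D_def)
    then show "M (p + 1) \<le> D ^ (p + 1) * M p" using D0(2)[of p] by linarith
  qed (simp add: D_def)
  obtain K1 K2 K3 K4 where K: "0 < K1" "0 < K2" "0 < K3" "0 < K4"
    and low: "\<forall>x>0. G (rl_of_pos x) \<in> \<real> \<and> K1 * h_fun M (K2 * x) \<le> Re (G (rl_of_pos x))"
    and up: "\<forall>z\<in>sector \<gamma>. cmod (G z) \<le> K3 * h_fun M (K4 * rl_abs z)"
    using assms(3) unfolding optimal_flat_def by blast
  interpret flat_kernel M \<gamma> K1 K2 K3 K4 D G
  proof unfold_locales
    show "G holomorphic_on sector \<gamma>"
      using assms(3) by (simp add: optimal_flat_def rl_holomorphic_on_iff open_sector)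
    show "K1 * h_fun M (K2 * x) \<le> Re (G (of_real (ln x)))" if "0 < x" for x
      using low that by (simp add: rl_of_pos_def)
    show "cmod (G w) \<le> K3 * (M p * (K4 * exp (Re w)) ^ p)" if "w \<in> sector \<gamma>" for w p
    proof -
      have "K3 * h_fun M (K4 * rl_abs w) \<le> K3 * (M p * (K4 * exp (Re w)) ^ p)"
        unfolding rl_abs_eq using K by (intro mult_left_mono h_le) auto
      then show ?thesis using bspec[OF up that] by linarith
    qed
  qed (use assms(1) K D in auto)
  show ?thesis by (rule extension_operators)
qed

end

section \<open>Comparison of the function classes\<close>

context weight_seq
begin

text \<open>By the chain rule, differentiation on the surface is ordinary differentiation of a local
  branch \<open>g\<close> in the plane; thus Cauchy's inequality on plane discs becomes
  available.\<close>

lemma rl_deriv_funpow_eq: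
  assumes g: "g holomorphic_on U" "open U" and "open V" "exp ` V \<subseteq> U"
    and eq: "\<And>w. w \<in> V \<Longrightarrow> f w = g (exp w)"
  shows "w \<in> V \<Longrightarrow> (rl_deriv ^^ n) f w = (deriv ^^ n) g (exp w)"
proof (induction n arbitrary: w)
  case 0
  then show ?case by (simp add: eq)
next
  case (Suc n)
  have hol: "(deriv ^^ n) g holomorphic_on U"
    using g by (intro holomorphic_higher_deriv)
  have "exp w \<in> U" using Suc.prems assms(4) by auto
  then have "((deriv ^^ n) g has_field_derivative (deriv ^^ Suc n) g (exp w)) (at (exp w))"
    using holomorphic_derivI[OF hol g(2)] by simp
  then have "((\<lambda>w. (deriv ^^ n) g (exp w)) has_field_derivative (deriv ^^ Suc n) g (exp w) * exp w) (at w)"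
    by (rule DERIV_chain2) (auto intro!: derivative_eq_intros)
  then have "((rl_deriv ^^ n) f has_field_derivative (deriv ^^ Suc n) g (exp w) * exp w) (at w)"
    by (rule has_field_derivative_transform_within_open[OF _ \<open>open V\<close> Suc.prems]) (simp add: Suc.IH)
  then have "rl_has_deriv ((rl_deriv ^^ n) f) ((deriv ^^ Suc n) g (exp w)) w"
    by (simp add: rl_has_deriv_iff)
  then have "rl_deriv ((rl_deriv ^^ n) f) w = (deriv ^^ Suc n) g (exp w)"
    by (subst rl_deriv_def, intro the_equality) (auto dest: rl_has_deriv_unique)
  then show ?case by simp
qed

text \<open>Allows the partial sum of order \<open>n\<close> to be subtracted without changing the
  derivative of order \<open>n\<close>.\<close>

lemma higher_deriv_sum_powers:
  fixes z :: complex
  assumes "N \<le> n"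
  shows "(deriv ^^ n) (\<lambda>z. \<Sum>k<N. a k * z ^ k) z = 0"
  using assms
proof (induction N)
  case 0
  have "(deriv ^^ n) (\<lambda>z::complex. 0::complex) = (\<lambda>z. 0)"
    by (induction n) auto
  then show ?case by simp
next
  case (Suc N)
  have "(deriv ^^ n) (\<lambda>z. z ^ N) z = 0"
    using Suc.prems higher_deriv_power[of n 0 N z] by (simp add: pochhammer_0_left)
  moreover have "(deriv ^^ n) (\<lambda>z. (\<Sum>k<N. a k * z ^ k) + a N * z ^ N) z =
      (deriv ^^ n) (\<lambda>z. \<Sum>k<N. a k * z ^ k) z + (deriv ^^ n) (\<lambda>z. a N * z ^ N) z"
    by (rule higher_deriv_add[of _ UNIV]) (auto intro!: holomorphic_intros)
  moreover have "(deriv ^^ n) (\<lambda>z. a N * z ^ N) z = a N * (deriv ^^ n) (\<lambda>z. z ^ N) z"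
    by (rule higher_deriv_cmult[of _ UNIV]) (auto intro!: holomorphic_intros)
  ultimately show ?case using Suc by simp
qed

text \<open>Cauchy estimates on a circle of radius comparable to \<open>\<bar>z\<bar>\<close>.\<close>

lemma expansion_imp_A_class:
  assumes "0 < \<sigma>" "\<sigma> < \<gamma>" "0 < A" and holf: "f holomorphic_on sector \<gamma>"
    and exp: "has_unif_expansion M A (sector \<gamma>) f F"
  shows "f \<in> A_union (hat_seq M) (sector \<sigma>)"
proof -
  obtain C where C: "0 \<le> C" "\<And>z n. z \<in> sector \<gamma> \<Longrightarrow>
      cmod (f z - (\<Sum>k<n. fps_nth F k * exp z ^ k)) \<le> C * (A ^ n * M n * exp (Re z) ^ n)"
    using has_unif_expansionD[OF exp \<open>0 < A\<close>] by metis
  \<comment> \<open>On a disc of radius \<open>r * cmod z\<close> the argument varies by at most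
    \<open>2 * r\<close>, which is less than the difference of the half-openings. The bound 1/4
    makes the estimate for \<open>Ln\<close> near 1 applicable.\<close>
  define r where "r = min (1 / 4) ((\<gamma> - \<sigma>) * pi / 8)"
  have r: "0 < r" "r \<le> 1 / 4" "2 * r < \<gamma> * pi / 2 - \<sigma> * pi / 2"
    using assms(2) by (auto simp: r_def min_def field_simps)
  have main: "cmod ((rl_deriv ^^ n) f w) \<le> C * ((4 * A / r) ^ n * hat_seq M n)" if w: "w \<in> sector \<sigma>" for w n
  proof -
    define z where "z = exp w"
    define U where "U = ball z (r * cmod z)"
    \<comment> \<open>\<open>u\<close> is the branch of the logarithm on the disc \<open>U\<close>
      with \<open>u z = w\<close>, so \<open>g\<close> is \<open>f\<close> read in the plane near
      \<open>z\<close>.\<close>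
    define u where "u \<zeta> = w + Ln (\<zeta> / z)" for \<zeta>
    define g where "g \<zeta> = f (u \<zeta>)" for \<zeta>
    have "z \<noteq> 0" and nz: "cmod z = exp (Re w)" by (auto simp: z_def)
    have near: "cmod (\<zeta> / z - 1) < r" if "\<zeta> \<in> U" for \<zeta>
    proof -
      have "cmod (\<zeta> / z - 1) = dist z \<zeta> / cmod z"
        using \<open>z \<noteq> 0\<close> by (simp add: dist_norm norm_minus_commute diff_divide_distrib flip: norm_divide)
      then show ?thesis using that \<open>z \<noteq> 0\<close> by (simp add: U_def pos_divide_less_eq)
    qed
    have u_exp: "exp (u \<zeta>) = \<zeta>" if "\<zeta> \<in> U" for \<zeta>
    proof -
      have "\<zeta> \<noteq> 0" using near[OF that] r by auto
      then show ?thesis using \<open>z \<noteq> 0\<close> by (simp add: u_def exp_add z_def)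
    qed
    have nonpos: "\<zeta> / z \<notin> \<real>\<^sub>\<le>\<^sub>0" if "\<zeta> \<in> U" for \<zeta>
    proof -
      have "\<bar>Re (\<zeta> / z - 1)\<bar> < 1"
        using near[OF that] r abs_Re_le_cmod[of "\<zeta> / z - 1"] by linarith
      then have "0 < Re (\<zeta> / z)" unfolding minus_complex.simps one_complex.simps by linarith
      then show ?thesis by (auto simp: complex_nonpos_Reals_iff)
    qed
    have u_sector: "u \<zeta> \<in> sector \<gamma>" if "\<zeta> \<in> U" for \<zeta>
    proof -
      have "cmod (Ln (1 + (\<zeta> / z - 1))) \<le> 2 * cmod (\<zeta> / z - 1)"
        using near[OF that] r by (intro norm_Ln_le) auto
      then have "\<bar>Im (Ln (\<zeta> / z))\<bar> \<le> 2 * r"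
        using near[OF that] abs_Im_le_cmod[of "Ln (\<zeta> / z)"] by simp
      then show ?thesis
        using w r(3) unfolding sector_iff u_def plus_complex.simps by linarith
    qed
    have hol_u: "u holomorphic_on U"
      unfolding u_def using \<open>z \<noteq> 0\<close> nonpos by (intro holomorphic_intros) auto
    have hol_g: "g holomorphic_on U"
      using holomorphic_on_compose_gen[OF hol_u holf] u_sector by (auto simp: g_def[abs_def] o_def)
    \<comment> \<open>The ball of radius 1 keeps imaginary parts within \<open>pi\<close> of that of
      \<open>w\<close>, so that the principal logarithm inverts \<open>exp\<close> there.\<close>
    define V where "V = ball w 1 \<inter> exp -` U"
    have "open V"
      unfolding V_def U_def by (intro open_Int open_vimage) (auto intro!: continuous_intros)
    have "z \<in> U" using \<open>z \<noteq> 0\<close> r by (simp add: U_def)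
    have "(rl_deriv ^^ n) f w = (deriv ^^ n) g (exp w)"
    proof (rule rl_deriv_funpow_eq[OF hol_g _ \<open>open V\<close>])
      fix x assume "x \<in> V"
      then have "\<bar>Im (x - w)\<bar> < 1"
        using abs_Im_le_cmod[of "x - w"] by (simp add: V_def dist_norm norm_minus_commute)
      then have "Ln (exp (x - w)) = x - w"
        using pi_gt3 by (intro Ln_exp) linarith+
      then show "f x = g (exp x)"
        by (simp add: g_def u_def z_def flip: exp_diff)
    qed (use \<open>z \<in> U\<close> in \<open>auto simp: U_def V_def z_def\<close>)
    also have "\<dots> = (deriv ^^ n) (\<lambda>\<zeta>. g \<zeta> - (\<Sum>k<n. fps_nth F k * \<zeta> ^ k)) z"
    proof (subst higher_deriv_diff[OF hol_g, where z = z])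
      show "(deriv ^^ n) g (exp w) = (deriv ^^ n) g z - (deriv ^^ n) (\<lambda>\<zeta>. \<Sum>k<n. fps_nth F k * \<zeta> ^ k) z"
        by (simp add: higher_deriv_sum_powers z_def)
    qed (use \<open>z \<in> U\<close> in \<open>auto simp: U_def intro!: holomorphic_intros\<close>)
    \<comment> \<open>On the disc of half the radius the remainder of order \<open>n\<close> is
      bounded through \<open>cmod \<zeta> \<le> 2 * cmod z\<close>; the powers of
      \<open>cmod z\<close> then cancel against the radius.\<close>
    also have "cmod \<dots> \<le> fact n * (C * (A ^ n * M n * (2 * cmod z) ^ n)) / (r * cmod z / 2) ^ n"
    proof (rule Cauchy_inequality)
      have "0 < r * cmod z" using r \<open>z \<noteq> 0\<close> by simp
      then have "cball z (r * cmod z / 2) \<subseteq> ball z (r * cmod z)"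
        by (intro cball_subset_ball_iff[THEN iffD2]) simp
      then have sub: "cball z (r * cmod z / 2) \<subseteq> U" by (simp only: U_def)
      have hol: "(\<lambda>\<zeta>. g \<zeta> - (\<Sum>k<n. fps_nth F k * \<zeta> ^ k)) holomorphic_on U"
        by (intro holomorphic_intros hol_g)
      show "(\<lambda>\<zeta>. g \<zeta> - (\<Sum>k<n. fps_nth F k * \<zeta> ^ k)) holomorphic_on ball z (r * cmod z / 2)"
        by (rule holomorphic_on_subset[OF hol order_trans[OF ball_subset_cball sub]])
      show "continuous_on (cball z (r * cmod z / 2)) (\<lambda>\<zeta>. g \<zeta> - (\<Sum>k<n. fps_nth F k * \<zeta> ^ k))"
        by (rule continuous_on_subset[OF holomorphic_on_imp_continuous_on[OF hol] sub])
      show "0 < r * cmod z / 2" using r \<open>z \<noteq> 0\<close> by simp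
      fix \<zeta> assume "cmod (z - \<zeta>) = r * cmod z / 2"
      then have "\<zeta> \<in> cball z (r * cmod z / 2)" by (simp add: dist_norm)
      then have \<zeta>: "\<zeta> \<in> U" using sub by blast
      have le: "cmod \<zeta> \<le> 2 * cmod z"
      proof -
        have "cmod \<zeta> \<le> cmod z + cmod (z - \<zeta>)"
          by (metis norm_minus_commute norm_triangle_sub)
        moreover have "r * cmod z \<le> 1 * cmod z" using r by (intro mult_right_mono) auto
        ultimately show ?thesis using \<open>cmod (z - \<zeta>) = _\<close> norm_ge_zero[of z] by linarith
      qed
      have "cmod (g \<zeta> - (\<Sum>k<n. fps_nth F k * \<zeta> ^ k)) \<le> C * (A ^ n * M n * cmod \<zeta> ^ n)"
        using C(2)[OF u_sector[OF \<zeta>], of n] unfolding norm_exp_eq_Re[symmetric] u_exp[OF \<zeta>] g_def .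
      also have "\<dots> \<le> C * (A ^ n * M n * (2 * cmod z) ^ n)"
        using le C(1) \<open>0 < A\<close> by (intro mult_left_mono power_mono) auto
      finally show "cmod (g \<zeta> - (\<Sum>k<n. fps_nth F k * \<zeta> ^ k)) \<le> C * (A ^ n * M n * (2 * cmod z) ^ n)" .
    qed
    also have "\<dots> = C * ((4 * A / r) ^ n * hat_seq M n)"
    proof -
      have "(2 * cmod z) ^ n / (r * cmod z / 2) ^ n = (4 / r) ^ n"
        unfolding power_divide[symmetric] using \<open>z \<noteq> 0\<close> by simp
      moreover have "(4 * A / r) ^ n = (4 / r) ^ n * A ^ n"
        by (simp flip: power_mult_distrib)
      ultimately show ?thesis by (simp add: hat_seq_def mult_ac flip: times_divide_eq_right)
    qed
    finally show ?thesis .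
  qed
  have "f \<in> A_class (hat_seq M) (4 * A / r) (sector \<sigma>)"
    unfolding A_class_def rl_holomorphic_on_iff[OF open_sector]
  proof (intro CollectI conjI bdd_aboveI2[where M = C])
    show "f holomorphic_on sector \<sigma>"
      using holf sector_mono[of \<sigma> \<gamma>] assms(2) by (auto intro: holomorphic_on_subset)
    fix x assume "x \<in> sector \<sigma> \<times> (UNIV :: nat set)"
    then show "(case x of (z, p) \<Rightarrow> cmod ((rl_deriv ^^ p) f z) / ((4 * A / r) ^ p * hat_seq M p)) \<le> C"
      using main r \<open>0 < A\<close> by (auto simp: pos_divide_le_eq hat_seq_def)
  qed
  then show ?thesis using r \<open>0 < A\<close> by (auto simp: A_union_def intro!: bexI[of _ "4 * A / r"])
qed

section \<open>From bounds for the derivatives to uniform expansions\<close>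

lemma rl_deriv_holomorphic:
  assumes "f holomorphic_on S" "open S"
  shows "rl_deriv f holomorphic_on S"
    and "w \<in> S \<Longrightarrow> (f has_field_derivative rl_deriv f w * exp w) (at w)"
proof -
  have eq: "rl_deriv f w = deriv f w / exp w" if "w \<in> S" for w
    using assms that by (intro rl_deriv_eq) (auto simp: holomorphic_on_imp_differentiable_at)
  have "(\<lambda>w. deriv f w / exp w) holomorphic_on S"
    using assms by (intro holomorphic_intros) auto
  then show "rl_deriv f holomorphic_on S"
    using holomorphic_cong[OF refl eq] by simp
  show "(f has_field_derivative rl_deriv f w * exp w) (at w)" if "w \<in> S"
    using holomorphic_derivI[OF assms that] by (simp add: eq[OF that])
qed

text \<open>
  All derivatives have limits at the vertex, since the derivative of order \<open>p + 1\<close> is bounded.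
  The expansion is the limit of Taylor's formula along rays.
\<close>

lemma A_class_expansion:
  assumes "0 < \<sigma>" "0 < A" "f \<in> A_class (hat_seq M) A (sector \<sigma>)"
  shows "\<exists>F. has_unif_expansion M (2 * A) (sector \<sigma>) f F"
proof -
  define D where "D p = (rl_deriv ^^ p) f" for p
  have holf: "f holomorphic_on sector \<sigma>"
    using assms(3) by (simp add: A_class_def rl_holomorphic_on_iff open_sector)
  obtain C where "\<And>x. x \<in> sector \<sigma> \<times> UNIV \<Longrightarrow>
      (\<lambda>(z, p). cmod ((rl_deriv ^^ p) f z) / (A ^ p * hat_seq M p)) x \<le> C"
    using assms(3) unfolding A_class_def bdd_above_def by auto
  then have "cmod ((rl_deriv ^^ p) f z) / (A ^ p * hat_seq M p) \<le> C" if "z \<in> sector \<sigma>" for z p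
    using that by fastforce
  then have C: "cmod (D p z) \<le> C * (A ^ p * hat_seq M p)" if "z \<in> sector \<sigma>" for z p
    using that \<open>0 < A\<close> by (simp add: D_def pos_divide_le_eq hat_seq_def)
  have "0 \<le> C"
    using order_trans[OF norm_ge_zero C[OF of_real_in_sector[OF assms(1)], of 0 0]] by (simp add: hat_seq_def)
  have holD: "D p holomorphic_on sector \<sigma>" for p
    unfolding D_def by (induction p) (auto intro: holf rl_deriv_holomorphic open_sector)
  have derivD: "(D p has_field_derivative D (Suc p) w * exp w) (at w)" if "w \<in> sector \<sigma>" for p w
    using rl_deriv_holomorphic(2)[OF holD open_sector that, of p] by (simp add: D_def)
  \<comment> \<open>In the chart the derivative of \<open>D p\<close> is \<open>D (Suc p)\<close>
    times \<open>exp\<close>, and the exponential is small on the convex sets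
    \<open>Re z \<le> b\<close> as \<open>b\<close> decreases.\<close>
  have lipschitz: "cmod (D p w - D p w') \<le> C * (A ^ Suc p * hat_seq M (Suc p)) * exp b * cmod (w - w')"
    if "w \<in> sector \<sigma>" "w' \<in> sector \<sigma>" "Re w \<le> b" "Re w' \<le> b" for p w w' b
  proof (rule field_differentiable_bound)
    show "convex (sector \<sigma> \<inter> {z. Re z \<le> b})"
      by (intro convex_Int convex_sector convex_halfspace_Re_le)
    fix z assume z: "z \<in> sector \<sigma> \<inter> {z. Re z \<le> b}"
    then show "(D p has_field_derivative D (Suc p) z * exp z) (at z within sector \<sigma> \<inter> {z. Re z \<le> b})"
      by (intro has_field_derivative_at_within[OF derivD]) auto
    have "0 \<le> C * (A ^ Suc p * hat_seq M (Suc p))"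
      using \<open>0 \<le> C\<close> \<open>0 < A\<close> by (simp add: hat_seq_def)
    then show "cmod (D (Suc p) z * exp z) \<le> C * (A ^ Suc p * hat_seq M (Suc p)) * exp b"
      unfolding norm_mult using z by (intro mult_mono C) auto
  qed (use that in auto)
  \<comment> \<open>\<open>u n w\<close> runs along the ray of \<open>w\<close> towards the vertex:
    the point is multiplied by \<open>exp (- n)\<close>.\<close>
  define u where "u n w = w + of_real (- real n)" for n and w :: complex
  have u: "u n w \<in> sector \<sigma>" "Re (u n w) = Re w - real n" "exp (u n w) = exp w * of_real (exp (- real n))"
    if "w \<in> sector \<sigma>" for n w
  proof -
    show "u n w \<in> sector \<sigma>" "Re (u n w) = Re w - real n"
      using that by (simp_all add: u_def sector_iff)
    show "exp (u n w) = exp w * of_real (exp (- real n))"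
      by (simp only: u_def exp_add exp_of_real)
  qed
  have exp_0: "(\<lambda>n. exp (- real n)) \<longlonglongrightarrow> 0"
    by (intro filterlim_compose[OF exp_at_bot] filterlim_compose[OF filterlim_uminus_at_bot_at_top] filterlim_real_sequentially)
  have "convergent (\<lambda>n. D p (u n 0))" for p
  proof -
    define K where "K = C * (A ^ Suc p * hat_seq M (Suc p))"
    have 0: "0 \<in> sector \<sigma>" using assms(1) of_real_in_sector[of \<sigma> 0] by simp
    have "summable (\<lambda>n. D p (u (Suc n) 0) - D p (u n 0))"
    proof (rule summable_comparison_test')
      show "summable (\<lambda>n. K * exp (- 1) ^ n)"
        by (intro summable_mult summable_geometric) simp
      fix n :: nat
      have "cmod (D p (u (Suc n) 0) - D p (u n 0)) \<le> K * exp (- real n) * cmod (u (Suc n) 0 - u n 0)"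
        unfolding K_def by (rule lipschitz) (auto simp: u[OF 0])
      then show "norm (D p (u (Suc n) 0) - D p (u n 0)) \<le> K * exp (- 1) ^ n"
        by (simp add: u_def exp_of_nat_mult[symmetric])
    qed
    then have "convergent (\<lambda>n. \<Sum>i<n. D p (u (Suc i) 0) - D p (u i 0))"
      by (simp add: summable_iff_convergent)
    then have "convergent (\<lambda>n. D p (u n 0) - D p (u 0 0))"
      by (simp only: sum_lessThan_telescope[of "\<lambda>i. D p (u i 0)"])
    then show ?thesis
      by (simp add: convergent_diff_const_right_iff)
  qed
  then obtain L where L0: "(\<lambda>n. D p (u n 0)) \<longlonglongrightarrow> L p" for p
    unfolding convergent_def by metis
  \<comment> \<open>The distance of \<open>u n w\<close> and \<open>u n 0\<close> in the chart stays
    fixed while the Lipschitz constant decays, so the limits agree in all directions.\<close>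
  have lim_diff: "(\<lambda>n. D p (u n w) - D p (u n 0)) \<longlonglongrightarrow> 0" if w: "w \<in> sector \<sigma>" for p w
  proof (rule Lim_null_comparison)
    define K where "K = C * (A ^ Suc p * hat_seq M (Suc p))"
    have 0: "0 \<in> sector \<sigma>" using assms(1) of_real_in_sector[of \<sigma> 0] by simp
    have "cmod (D p (u n w) - D p (u n 0)) \<le> K * exp (max 0 (Re w) - real n) * cmod (u n w - u n 0)" for n
      unfolding K_def by (rule lipschitz) (auto simp: u[OF w] u[OF 0])
    then show "\<forall>\<^sub>F n in sequentially. norm (D p (u n w) - D p (u n 0)) \<le> K * exp (max 0 (Re w)) * cmod w * exp (- real n)"
      by (intro always_eventually) (simp add: u_def exp_diff exp_minus field_simps)
    show "(\<lambda>n. K * exp (max 0 (Re w)) * cmod w * exp (- real n)) \<longlonglongrightarrow> 0"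
      using tendsto_mult_right_zero[OF exp_0] by blast
  qed
  have L: "(\<lambda>n. D p (u n w)) \<longlonglongrightarrow> L p" if "w \<in> sector \<sigma>" for p w
    using tendsto_add[OF lim_diff[OF that, of p] L0[of p]] by simp
  define F where "F = Abs_fps (\<lambda>k. L k / fact k)"
  have "has_unif_expansion M (2 * A) (sector \<sigma>) f F"
  proof (rule has_unif_expansionI)
    fix w n assume w: "w \<in> sector \<sigma>"
    show "cmod (f w - (\<Sum>k<n. fps_nth F k * exp w ^ k)) \<le> C * ((2 * A) ^ n * M n * exp (Re w) ^ n)"
    proof (cases n)
      case 0
      then show ?thesis using C[OF w, of 0] by (simp add: D_def hat_seq_def)
    next
      case (Suc j)
      define B where "B = C * (A ^ Suc j * hat_seq M (Suc j))"
      \<comment> \<open>Taylor's formula of order \<open>j\<close> between two points of one ray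
        \<open>S\<close>; \<open>v\<close> lifts this ray from the plane to the surface.\<close>
      have approx: "cmod (f w - (\<Sum>i\<le>j. D i (u l w) * (exp w - exp (u l w)) ^ i / fact i)) \<le>
          B * cmod (exp w - exp (u l w)) ^ Suc j / fact j" for l
      proof -
        define v where "v \<zeta> = w + Ln (\<zeta> / exp w)" for \<zeta>
        define S where "S = {\<zeta>. \<exists>t>0. \<zeta> = of_real t * exp w}"
        have "convex S"
          unfolding convex_def
        proof (intro ballI allI impI)
          fix x y and a b :: real assume "x \<in> S" "y \<in> S" and ab: "0 \<le> a" "0 \<le> b" "a + b = 1"
          then obtain s t where st: "0 < s" "x = of_real s * exp w" "0 < t" "y = of_real t * exp w"
            by (auto simp: S_def)
          have "a *\<^sub>R x + b *\<^sub>R y = of_real (a * s + b * t) * exp w"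
            by (simp add: st scaleR_conv_of_real algebra_simps)
          moreover have "0 < a * s + b * t"
            using st ab by (cases "a = 0") (auto intro!: add_pos_nonneg)
          ultimately show "a *\<^sub>R x + b *\<^sub>R y \<in> S" by (auto simp: S_def)
        qed
        have v: "v (of_real t * exp w) = w + of_real (ln t)" if "0 < t" for t
          using that by (simp add: v_def Ln_of_real)
        have v_sector: "v \<zeta> \<in> sector \<sigma>" "exp (v \<zeta>) = \<zeta>" if \<zeta>: "\<zeta> \<in> S" for \<zeta>
        proof -
          obtain t where t: "0 < t" "\<zeta> = of_real t * exp w" using \<zeta> by (auto simp: S_def)
          show "v \<zeta> \<in> sector \<sigma>" using w by (simp add: t v sector_iff)
          show "exp (v \<zeta>) = \<zeta>" using t by (simp add: v exp_add exp_of_real)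
        qed
        have deriv_v: "(v has_field_derivative 1 / \<zeta>) (at \<zeta>)" if \<zeta>: "\<zeta> \<in> S" for \<zeta>
        proof -
          obtain t where t: "0 < t" "\<zeta> = of_real t * exp w" using \<zeta> by (auto simp: S_def)
          have "\<zeta> / exp w \<notin> \<real>\<^sub>\<le>\<^sub>0" using t by simp
          then show ?thesis
            unfolding v_def by (auto intro!: derivative_eq_intros simp: field_simps)
        qed
        have "cmod (D 0 (v (exp w)) - (\<Sum>i\<le>j. D i (v (exp (u l w))) * (exp w - exp (u l w)) ^ i / fact i)) \<le>
            B * cmod (exp w - exp (u l w)) ^ Suc j / fact j"
        proof (rule complex_Taylor[where f = "\<lambda>i \<zeta>. D i (v \<zeta>)" and S = S])
          fix i \<zeta> assume \<zeta>: "\<zeta> \<in> S"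
          then have "\<zeta> \<noteq> 0" by (auto simp: S_def)
          have "((\<lambda>\<zeta>. D i (v \<zeta>)) has_field_derivative D (Suc i) (v \<zeta>) * exp (v \<zeta>) * (1 / \<zeta>)) (at \<zeta>)"
            by (rule DERIV_chain2[OF derivD[OF v_sector(1)[OF \<zeta>]] deriv_v[OF \<zeta>]])
          then show "((\<lambda>\<zeta>. D i (v \<zeta>)) has_field_derivative D (Suc i) (v \<zeta>)) (at \<zeta> within S)"
            using \<open>\<zeta> \<noteq> 0\<close> by (simp add: v_sector(2)[OF \<zeta>] has_field_derivative_at_within)
        next
          fix \<zeta> assume "\<zeta> \<in> S"
          then show "cmod (D (Suc j) (v \<zeta>)) \<le> B"
            unfolding B_def by (intro C v_sector)
        next
          show "exp (u l w) \<in> S"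
            unfolding u(3)[OF w] S_def by (auto intro!: exI[of _ "exp (- real l)"] simp: mult.commute)
          show "exp w \<in> S"
            unfolding S_def by (auto intro!: exI[of _ 1])
        qed fact
        moreover have "v (exp w) = w"
          using v[of 1] by simp
        moreover have "v (exp (u l w)) = u l w"
          unfolding u(3)[OF w] using v[of "exp (- real l)"] by (simp only: mult.commute ln_exp u_def exp_gt_zero)
        ultimately show ?thesis by (simp add: D_def)
      qed
      have exp_u: "(\<lambda>l. exp (u l w)) \<longlonglongrightarrow> 0"
        unfolding u(3)[OF w] using tendsto_mult[OF tendsto_const tendsto_of_real[OF exp_0], of "exp w"] by simp
      have lim1: "(\<lambda>l. cmod (f w - (\<Sum>i\<le>j. D i (u l w) * (exp w - exp (u l w)) ^ i / fact i)))
          \<longlonglongrightarrow> cmod (f w - (\<Sum>i\<le>j. L i * (exp w - 0) ^ i / fact i))"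
        by (intro tendsto_intros exp_u L w) auto
      have lim2: "(\<lambda>l. B * cmod (exp w - exp (u l w)) ^ Suc j / fact j)
          \<longlonglongrightarrow> B * cmod (exp w - 0) ^ Suc j / fact j"
        by (intro tendsto_intros exp_u) auto
      have "cmod (f w - (\<Sum>i\<le>j. L i * (exp w - 0) ^ i / fact i)) \<le> B * cmod (exp w - 0) ^ Suc j / fact j"
        by (rule LIMSEQ_le[OF lim1 lim2]) (use approx in blast)
      also have "(\<Sum>i\<le>j. L i * (exp w - 0) ^ i / fact i) = (\<Sum>k<n. fps_nth F k * exp w ^ k)"
        by (simp add: F_def Suc lessThan_Suc_atMost)
      also have "B * cmod (exp w - 0) ^ Suc j / fact j = C * (real (Suc j) * A ^ n * M n * exp (Re w) ^ n)"
        by (simp add: B_def hat_seq_def Suc field_simps)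
      \<comment> \<open>The Taylor remainder is divided by \<open>fact j\<close> only, which leaves
        a factor \<open>j + 1\<close> from \<open>fact (j + 1)\<close>. It is absorbed by passing
        from \<open>A\<close> to \<open>2 * A\<close>.\<close>
      also have "\<dots> \<le> C * (2 ^ Suc j * A ^ n * M n * exp (Re w) ^ n)"
        using \<open>0 \<le> C\<close> \<open>0 < A\<close> of_nat_mono[OF less_imp_le[OF less_exp[of "Suc j"]], where 'a = real]
        by (intro mult_left_mono mult_right_mono) auto
      finally show ?thesis by (simp add: Suc power_mult_distrib mult_ac)
    qed
  qed (use \<open>0 < A\<close> in simp)
  then show ?thesis by blast
qed

section \<open>Transfer of surjectivity between the two classes\<close>

lemma A_union_subset_Au_union:
  assumes "0 < \<sigma>"
  shows "A_union (hat_seq M) (sector \<sigma>) \<subseteq> Au_union M (sector \<sigma>)"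
proof
  fix f assume "f \<in> A_union (hat_seq M) (sector \<sigma>)"
  then obtain A where A: "0 < A" "f \<in> A_class (hat_seq M) A (sector \<sigma>)"
    by (auto simp: A_union_def)
  then have "f \<in> Au_class M (2 * A) (sector \<sigma>)"
    using A_class_expansion[OF assms A] by (simp add: Au_class_def A_class_def)
  then show "f \<in> Au_union M (sector \<sigma>)"
    using A(1) unfolding Au_union_def by (intro UN_I[of "2 * A"]) auto
qed

lemma surjective_u_imp_hat:
  assumes "0 < \<sigma>" "\<sigma> < \<gamma>" "borel_surjective_u M (sector \<gamma>)"
  shows "borel_surjective_hat M (sector \<sigma>)"
  unfolding borel_surjective_hat_def
proof (intro equalityI subsetI)
  fix F assume "F \<in> borel_map M (sector \<sigma>) ` A_union (hat_seq M) (sector \<sigma>)"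
  then obtain f where "f \<in> Au_union M (sector \<sigma>)" "F = borel_map M (sector \<sigma>) f"
    using A_union_subset_Au_union[OF assms(1)] by blast
  then show "F \<in> series_union M"
    by (auto elim!: Au_unionE[OF assms(1)] simp: series_union_def)
next
  fix F assume "F \<in> series_union M"
  then obtain A f where "0 < A" and f: "f holomorphic_on sector \<gamma>" "has_unif_expansion M A (sector \<gamma>) f F"
    using borel_surjective_uE[OF _ assms(3)] assms(1,2) by (metis less_trans)
  have "borel_map M (sector \<sigma>) f = F"
    using has_unif_expansion_subset[OF f(2) sector_mono] assms(2)
    by (intro borel_map_eq[OF assms(1) \<open>0 < A\<close>]) auto
  moreover have "f \<in> A_union (hat_seq M) (sector \<sigma>)"
    by (rule expansion_imp_A_class[OF assms(1,2) \<open>0 < A\<close> f])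
  ultimately show "F \<in> borel_map M (sector \<sigma>) ` A_union (hat_seq M) (sector \<sigma>)" by blast
qed

lemma surjective_hat_imp_u:
  assumes "0 < \<sigma>" "borel_surjective_hat M (sector \<sigma>)"
  shows "borel_surjective_u M (sector \<sigma>)"
proof (rule borel_surjective_uI[OF assms(1)])
  fix F assume "F \<in> series_union M"
  then have "F \<in> borel_map M (sector \<sigma>) ` A_union (hat_seq M) (sector \<sigma>)"
    using assms(2) by (simp add: borel_surjective_hat_def)
  then obtain f where f: "f \<in> Au_union M (sector \<sigma>)" "borel_map M (sector \<sigma>) f = F"
    using A_union_subset_Au_union[OF assms(1)] by blast
  from assms(1) f(1) obtain A F' where "0 < A" "f holomorphic_on sector \<sigma>"
    "has_unif_expansion M A (sector \<sigma>) f F'" "borel_map M (sector \<sigma>) f = F'"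
    by (rule Au_unionE)
  then show "\<exists>A>0. \<exists>f. f holomorphic_on sector \<sigma> \<and> has_unif_expansion M A (sector \<sigma>) f F"
    using f(2) by blast
qed

end

section \<open>Surjectivity bounds the index\<close>

text \<open>The Phragmen-Lindeloef principle for bounded functions, in the chart where a sector is a
  strip. The factor \<open>exp (- \<epsilon> * z\<^sup>2)\<close> makes the function small on the
  vertical sides of a large rectangle; then \<open>\<epsilon>\<close> tends to 0.\<close>

lemma strip_maximum_principle:
  fixes f :: "complex \<Rightarrow> complex"
  assumes holf: "f holomorphic_on {w. \<bar>Im w\<bar> < a}" and contf: "continuous_on {w. \<bar>Im w\<bar> \<le> a} f"
    and bounded: "\<And>w. \<bar>Im w\<bar> \<le> a \<Longrightarrow> cmod (f w) \<le> K"
    and boundary: "\<And>w. \<bar>Im w\<bar> = a \<Longrightarrow> cmod (f w) \<le> B"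
    and "0 < B" and w: "\<bar>Im w\<bar> \<le> a"
  shows "cmod (f w) \<le> B"
proof -
  have "cmod (f w) \<le> B * exp (\<epsilon> * (a\<^sup>2 + (Re w)\<^sup>2))" if "0 < \<epsilon>" for \<epsilon>
  proof -
    define g where "g z = f z * exp (- of_real \<epsilon> * z\<^sup>2)" for z
    have norm_g: "cmod (g z) = cmod (f z) * exp (\<epsilon> * (Im z)\<^sup>2) * exp (- \<epsilon> * (Re z)\<^sup>2)" for z
      by (simp add: g_def norm_mult power2_eq_square algebra_simps flip: exp_add)
    have "0 \<le> K" using bounded[OF w] norm_ge_zero by (rule order_trans[rotated])
    have "((\<lambda>R. K * exp (- \<epsilon> * R\<^sup>2)) \<longlongrightarrow> K * 0) at_top"
      by (intro tendsto_intros filterlim_compose[OF exp_at_bot] filterlim_tendsto_neg_mult_at_bot[OF tendsto_const]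
        filterlim_pow_at_top filterlim_ident) (use that in auto)
    then have "\<forall>\<^sub>F R in at_top. K * exp (- \<epsilon> * R\<^sup>2) < B"
      using \<open>0 < B\<close> by (auto dest: order_tendstoD(2))
    then have "\<forall>\<^sub>F R in at_top. K * exp (- \<epsilon> * R\<^sup>2) < B \<and> \<bar>Re w\<bar> < R"
      by (intro eventually_conj eventually_gt_at_top)
    then obtain R where R: "K * exp (- \<epsilon> * R\<^sup>2) < B" "\<bar>Re w\<bar> < R"
      by (auto simp: eventually_at_top_linorder)
    let ?Q = "cbox (Complex (- R) (- a)) (Complex R a)"
    have "cmod (g w) \<le> B * exp (\<epsilon> * a\<^sup>2)"
    proof (rule maximum_modulus_frontier[where S = ?Q and f = g])
      show "g holomorphic_on interior ?Q"
        unfolding g_def interior_cbox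
        by (intro holomorphic_intros holomorphic_on_subset[OF holf]) (auto simp: in_box_complex_iff)
      show "continuous_on (closure ?Q) g"
        unfolding g_def
        by (intro continuous_intros continuous_on_subset[OF contf]) (auto simp: in_cbox_complex_iff)
      show "bounded ?Q" by simp
      show "w \<in> ?Q" using w R by (auto simp: in_cbox_complex_iff)
      fix z assume "z \<in> frontier ?Q"
      then have z: "\<bar>Im z\<bar> \<le> a" "\<bar>Re z\<bar> \<le> R" "\<bar>Im z\<bar> = a \<or> \<bar>Re z\<bar> = R"
        by (auto simp: frontier_def interior_cbox in_cbox_complex_iff in_box_complex_iff)
      have e: "exp (\<epsilon> * (Im z)\<^sup>2) \<le> exp (\<epsilon> * a\<^sup>2)"
        using z(1) that by (simp add: abs_le_square_iff[symmetric])
      have e': "exp (- \<epsilon> * (Re z)\<^sup>2) \<le> 1"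
        using that by simp
      from z(3) show "cmod (g z) \<le> B * exp (\<epsilon> * a\<^sup>2)"
      proof
        assume "\<bar>Im z\<bar> = a"
        then have "cmod (f z) * exp (\<epsilon> * (Im z)\<^sup>2) * exp (- \<epsilon> * (Re z)\<^sup>2) \<le> B * exp (\<epsilon> * a\<^sup>2) * 1"
          using e e' boundary \<open>0 < B\<close> by (intro mult_mono) auto
        then show ?thesis by (simp add: norm_g)
      next
        assume "\<bar>Re z\<bar> = R"
        then have "(Re z)\<^sup>2 = R\<^sup>2" by auto
        then have "cmod (f z) * exp (\<epsilon> * (Im z)\<^sup>2) * exp (- \<epsilon> * (Re z)\<^sup>2)
            \<le> K * exp (\<epsilon> * a\<^sup>2) * exp (- \<epsilon> * R\<^sup>2)"
          using e bounded[OF z(1)] \<open>0 \<le> K\<close> by (intro mult_mono) auto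
        also have "\<dots> = (K * exp (- \<epsilon> * R\<^sup>2)) * exp (\<epsilon> * a\<^sup>2)" by simp
        also have "\<dots> \<le> B * exp (\<epsilon> * a\<^sup>2)"
          using R(1) by (intro mult_right_mono) auto
        finally show ?thesis by (simp add: norm_g)
      qed
    qed
    then have "cmod (f w) * exp (\<epsilon> * (Im w)\<^sup>2) * exp (- \<epsilon> * (Re w)\<^sup>2) * exp (\<epsilon> * (Re w)\<^sup>2)
        \<le> B * exp (\<epsilon> * a\<^sup>2) * exp (\<epsilon> * (Re w)\<^sup>2)"
      by (intro mult_right_mono) (simp_all add: norm_g)
    then have "cmod (f w) * exp (\<epsilon> * (Im w)\<^sup>2) \<le> B * exp (\<epsilon> * (a\<^sup>2 + (Re w)\<^sup>2))"
      by (simp add: mult.assoc distrib_left flip: exp_add)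
    moreover have "cmod (f w) * 1 \<le> cmod (f w) * exp (\<epsilon> * (Im w)\<^sup>2)"
      using that by (intro mult_left_mono) auto
    ultimately show ?thesis by simp
  qed
  then have ev: "\<forall>\<^sub>F \<epsilon> in at_right 0. cmod (f w) \<le> B * exp (\<epsilon> * (a\<^sup>2 + (Re w)\<^sup>2))"
    by (intro eventually_mono[OF eventually_at_right_less[of 0]]) blast
  have "((\<lambda>\<epsilon>. B * exp (\<epsilon> * (a\<^sup>2 + (Re w)\<^sup>2))) \<longlongrightarrow> B * exp (0 * (a\<^sup>2 + (Re w)\<^sup>2))) (at_right 0)"
    by (intro tendsto_intros)
  then have "cmod (f w) \<le> B * exp (0 * (a\<^sup>2 + (Re w)\<^sup>2))"
    by (rule tendsto_lowerbound[OF _ ev]) simp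
  then show ?thesis by simp
qed

text \<open>
  A bounded function on the right half-plane whose real part is at most \<open>ln\<^sup>+ \<bar>v\<bar>\<close> on the
  boundary, but nevertheless grows linearly at \<open>0\<close> along the positive real axis.
\<close>

definition ln_minorant :: "complex \<Rightarrow> complex" where
  "ln_minorant v = (v\<^sup>2 + 3 / 4 * v) / (2 * (v + 2)\<^sup>2)"

lemma norm_add_2_ge:
  assumes "0 \<le> Re v"
  shows "cmod v \<le> cmod (v + 2)" "2 \<le> cmod (v + 2)"
proof -
  show "2 \<le> cmod (v + 2)"
    using assms complex_Re_le_cmod[of "v + 2"] by simp
  show "cmod v \<le> cmod (v + 2)"
    using assms by (simp add: cmod_def power2_eq_square algebra_simps)
qed

lemma holomorphic_on_ln_minorant:
  assumes "u holomorphic_on S" "\<And>z. z \<in> S \<Longrightarrow> 0 \<le> Re (u z)"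
  shows "(\<lambda>z. ln_minorant (u z)) holomorphic_on S"
proof -
  have "u z + 2 \<noteq> 0" if "z \<in> S" for z
    using norm_add_2_ge(2)[OF assms(2)[OF that]] by auto
  then show ?thesis
    unfolding ln_minorant_def by (intro holomorphic_intros assms(1)) simp
qed

lemma continuous_on_ln_minorant:
  assumes "continuous_on S u" "\<And>z. z \<in> S \<Longrightarrow> 0 \<le> Re (u z)"
  shows "continuous_on S (\<lambda>z. ln_minorant (u z))"
proof -
  have "u z + 2 \<noteq> 0" if "z \<in> S" for z
    using norm_add_2_ge(2)[OF assms(2)[OF that]] by auto
  then show ?thesis
    unfolding ln_minorant_def by (intro continuous_intros assms(1)) simp
qed

lemma norm_ln_minorant_le:
  assumes "0 \<le> Re v"
  shows "cmod (ln_minorant v) \<le> 1"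
proof -
  let ?d = "cmod (v + 2)"
  note d = norm_add_2_ge[OF assms]
  have "cmod (v\<^sup>2 + 3 / 4 * v) \<le> (cmod v)\<^sup>2 + 3 / 4 * cmod v"
    using norm_triangle_ineq[of "v\<^sup>2" "3 / 4 * v"] by (simp add: norm_mult norm_power)
  also have "\<dots> \<le> ?d\<^sup>2 + 1 * ?d"
    using d by (intro add_mono power_mono mult_mono) auto
  also have "\<dots> \<le> 2 * ?d\<^sup>2"
    using mult_right_mono[of 1 ?d ?d] d by (simp add: power2_eq_square)
  finally show ?thesis
    using d by (auto simp: ln_minorant_def norm_divide norm_mult norm_power divide_simps)
qed

text \<open>The coefficient 3/4 in \<open>ln_minorant\<close> is chosen so that at
  \<open>v = i y\<close> the real part has the sign of \<open>y\<^sup>2 - 1\<close>. For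
  \<open>\<bar>y\<bar> > 1\<close> it is at most \<open>(1 - inverse (y\<^sup>2)) / 2\<close>, which
  is bounded by \<open>ln \<bar>y\<bar>\<close>.\<close>

lemma Re_ln_minorant_le:
  assumes "Re v = 0" "v \<noteq> 0"
  shows "Re (ln_minorant v) \<le> max 0 (ln (cmod v))"
proof -
  define y where "y = Im v"
  have v: "v = Complex 0 y" and y: "cmod v = \<bar>y\<bar>" "y \<noteq> 0"
    using assms by (auto simp: complex_eq_iff y_def cmod_def)
  have "4 + y\<^sup>2 > 0" by (simp add: add_pos_nonneg)
  have "Re (ln_minorant v) = (y\<^sup>2 * (y\<^sup>2 - 1)) / (2 * (4 + y\<^sup>2)\<^sup>2)"
  proof -
    have "(v\<^sup>2 + 3 / 4 * v) * cnj ((v + 2)\<^sup>2) = Complex (y\<^sup>2 * (y\<^sup>2 - 1)) (Im ((v\<^sup>2 + 3 / 4 * v) * cnj ((v + 2)\<^sup>2)))"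
      by (simp add: v complex_eq_iff power2_eq_square algebra_simps)
    moreover have "(cmod ((v + 2)\<^sup>2))\<^sup>2 = (4 + y\<^sup>2)\<^sup>2"
      by (simp add: norm_power v cmod_power2)
    ultimately have "Re ((v\<^sup>2 + 3 / 4 * v) / (v + 2)\<^sup>2) = (y\<^sup>2 * (y\<^sup>2 - 1)) / (4 + y\<^sup>2)\<^sup>2"
      by (subst complex_div_cnj) (simp del: complex_cnj_power)
    moreover have "ln_minorant v = (v\<^sup>2 + 3 / 4 * v) / (v + 2)\<^sup>2 / 2"
      by (simp add: ln_minorant_def)
    ultimately show ?thesis
      by (simp only: Re_divide_numeral) simp
  qed
  also have "\<dots> \<le> max 0 (ln \<bar>y\<bar>)"
  proof (cases "\<bar>y\<bar> \<le> 1")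
    case True
    then have "y\<^sup>2 \<le> 1" by (simp add: abs_square_le_1)
    then have "(y\<^sup>2 * (y\<^sup>2 - 1)) / (2 * (4 + y\<^sup>2)\<^sup>2) \<le> 0"
      by (intro divide_nonpos_nonneg mult_nonneg_nonpos) auto
    then show ?thesis by (rule order_trans) simp
  next
    case False
    then have y1: "1 < y\<^sup>2" using abs_square_le_1 not_less by blast
    have "(y\<^sup>2 * (y\<^sup>2 - 1)) / (2 * (4 + y\<^sup>2)\<^sup>2) \<le> (y\<^sup>2 * (y\<^sup>2 - 1)) / (2 * (y\<^sup>2)\<^sup>2)"
    proof (intro divide_left_mono mult_left_mono power_mono)
      have "0 < y\<^sup>2" using y1 by linarith
      then show "0 < 2 * (4 + y\<^sup>2)\<^sup>2 * (2 * (y\<^sup>2)\<^sup>2)"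
        using zero_less_power[OF \<open>4 + y\<^sup>2 > 0\<close>, of 2] zero_less_power[of "y\<^sup>2" 2]
        by (intro mult_pos_pos) simp_all
    qed (use y1 in auto)
    also have "\<dots> = (1 - inverse (y\<^sup>2)) / 2"
      using y1 y(2) by (simp add: field_simps power2_eq_square)
    also have "\<dots> \<le> ln (y\<^sup>2) / 2"
      using ln_le_minus_one[of "inverse (y\<^sup>2)"] y1 y(2) by (simp add: ln_inverse)
    also have "ln (y\<^sup>2) / 2 = ln \<bar>y\<bar>"
      using ln_realpow[of "\<bar>y\<bar>" 2] y(2) by simp
    finally show ?thesis by simp
  qed
  finally show ?thesis by (simp add: y)
qed

lemma Re_ln_minorant_ge:
  assumes "0 \<le> x" "x \<le> 1"
  shows "x / 24 \<le> Re (ln_minorant (of_real x))"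
proof -
  have "ln_minorant (of_real x) = of_real ((x\<^sup>2 + 3 / 4 * x) / (2 * (x + 2)\<^sup>2))"
    by (simp add: ln_minorant_def)
  moreover have "(3 / 4 * x) / (2 * 3\<^sup>2) \<le> (x\<^sup>2 + 3 / 4 * x) / (2 * (x + 2)\<^sup>2)"
    using assms by (intro frac_le mult_left_mono power_mono) auto
  ultimately show ?thesis by simp
qed

section \<open>The estimate for an expansion with gaps\<close>

context weight_seq
begin

text \<open>
  The function \<open>g z = (f z - (\<Sum>k\<le>q. a\<^sub>k z\<^sup>k)) / (M\<^sub>q z\<^sup>q)\<close> is close to \<open>-1\<close> at the point
  \<open>2 C A / m p\<close>, but of size \<open>(A m\<^sub>N \<bar>z\<bar>)\<^sup>N\<^sup>-\<^sup>q\<close> near the origin. Multiplying it by the exponential of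
  a multiple of \<^const>\<open>ln_minorant\<close> compensates this on the boundary of the sector, so that the
  maximum principle bounds the exponent at \<open>2 C A / m p\<close>.
\<close>

lemma lacunary_estimate:
  fixes C A \<sigma> :: real
  assumes "0 < \<sigma>" "\<sigma> < \<gamma>" "1 \<le> C" "1 \<le> A"
    and holf: "f holomorphic_on sector \<gamma>"
    and bound: "\<And>z n. z \<in> sector \<gamma> \<Longrightarrow>
      cmod (f z - (\<Sum>k<n. fps_nth F k * exp z ^ k)) \<le> C * (A ^ n * M n * exp (Re z) ^ n)"
    and q: "q = 2 * p" "1 \<le> p" "q < N"
    and gap1: "\<And>k. p \<le> k \<Longrightarrow> k < q \<Longrightarrow> fps_nth F k = 0"
    and gap2: "\<And>k. q < k \<Longrightarrow> k < N \<Longrightarrow> fps_nth F k = 0"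
    and coeff: "fps_nth F q = of_real (M q)"
  shows "\<sigma> * real (N - q) * ((m p / (2 * C * A\<^sup>2 * m N)) powr (1 / \<sigma>) / 24) \<le> ln (4 * C) + real q * ln A"
proof -
  define n where "n = N - q"
  have N: "N = q + n" using q by (simp add: n_def)
  define l where "l = ln (A * m N)"
  have el: "exp l = A * m N" using assms by (simp add: l_def)
  define R where "R z = f z - (\<Sum>k<q. fps_nth F k * exp z ^ k)" for z
  \<comment> \<open>The first gap turns the remainder of order \<open>q\<close> into the one of
    order \<open>p\<close>, whose better bound is needed at the point \<open>w\<close>; the second
    gap does the same below for order \<open>N\<close>.\<close>
  have R_eq: "R z = f z - (\<Sum>k<p. fps_nth F k * exp z ^ k)" for z
  proof -
    have "(\<Sum>k<q. fps_nth F k * exp z ^ k) = (\<Sum>k<p. fps_nth F k * exp z ^ k)"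
      using q gap1 by (intro sum.mono_neutral_right) auto
    then show ?thesis by (simp add: R_def)
  qed
  define r where "r z = R z - of_real (M q) * exp z ^ q" for z
  have r_eq: "r z = f z - (\<Sum>k<N. fps_nth F k * exp z ^ k)" for z
  proof -
    have "(\<Sum>k<N. fps_nth F k * exp z ^ k) = (\<Sum>k<Suc q. fps_nth F k * exp z ^ k)"
      using q gap2 by (intro sum.mono_neutral_right) auto
    then show ?thesis by (simp add: r_def R_def coeff)
  qed
  define g where "g z = r z / (of_real (M q) * exp z ^ q)" for z
  \<comment> \<open>This is the power of exponent \<open>- 1 / \<sigma>\<close> of
    \<open>A * m N\<close> times the point. It maps the sector of opening \<open>\<sigma>\<close>
    into the right half-plane and its boundary rays into the imaginary axis.\<close>
  define v where "v z = exp (- (z + of_real l) / of_real \<sigma>)" for z :: complex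
  define \<Phi> where "\<Phi> z = g z * exp (of_real (\<sigma> * real n) * ln_minorant (v z))" for z
  define B where "B = 2 * C * A ^ q"
  have B: "0 < B" "C * A ^ q \<le> B" using assms by (auto simp: B_def)
  have "1 \<le> C * A ^ q" using assms one_le_power[of A q] mult_mono[of 1 C 1 "A ^ q"] by simp
  have norm_g: "cmod (g z) = cmod (r z) / (M q * exp (Re z) ^ q)" for z
    by (simp add: g_def norm_divide norm_mult norm_power)
  have g_le: "cmod (g z) \<le> B" if z: "z \<in> sector \<gamma>" for z
  proof -
    have "cmod (r z) \<le> C * (A ^ q * M q * exp (Re z) ^ q) + M q * exp (Re z) ^ q"
      unfolding r_def using bound[OF z, of q]
      by (intro order_trans[OF norm_triangle_ineq4] add_mono) (auto simp: R_def norm_mult norm_power)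
    also have "\<dots> = (C * A ^ q + 1) * (M q * exp (Re z) ^ q)" by (simp add: algebra_simps)
    also have "\<dots> \<le> B * (M q * exp (Re z) ^ q)"
      using \<open>1 \<le> C * A ^ q\<close> by (intro mult_right_mono) (auto simp: B_def)
    finally show ?thesis by (simp add: norm_g pos_divide_le_eq)
  qed
  have g_le': "cmod (g z) \<le> C * A ^ q * exp (real n * (Re z + l))" if z: "z \<in> sector \<gamma>" for z
  proof -
    have "cmod (r z) \<le> C * (A ^ N * M N * exp (Re z) ^ N)"
      unfolding r_eq by (rule bound[OF z])
    also have "\<dots> \<le> C * (A ^ N * (M q * m N ^ n) * exp (Re z) ^ N)"
      using M_add_le[of q n] assms by (intro mult_left_mono mult_right_mono) (auto simp: N)
    also have "\<dots> = C * A ^ q * exp (real n * (Re z + l)) * (M q * exp (Re z) ^ q)"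
      by (simp add: N power_add power_mult_distrib exp_of_nat_mult exp_add el mult_ac)
    finally show ?thesis by (simp add: norm_g pos_divide_le_eq)
  qed
  have strip: "z \<in> sector \<gamma>" if "\<bar>Im z\<bar> \<le> \<sigma> * pi / 2" for z
    using that \<open>\<sigma> < \<gamma>\<close> by (auto simp: sector_iff intro: le_less_trans)
  have norm_v: "ln (cmod (v z)) = - (Re z + l) / \<sigma>" for z
    by (simp add: v_def)
  have Re_v: "0 \<le> Re (v z)" if "\<bar>Im z\<bar> \<le> \<sigma> * pi / 2" for z
  proof -
    have "\<bar>Im z / \<sigma>\<bar> \<le> pi / 2"
      using that \<open>0 < \<sigma>\<close> by (simp add: field_simps)
    then have "- (pi / 2) \<le> Im z / \<sigma>" "Im z / \<sigma> \<le> pi / 2" by linarith+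
    then have "0 \<le> cos (Im z / \<sigma>)" by (rule cos_ge_zero)
    then show ?thesis by (simp add: v_def Re_exp)
  qed
  have Re_v0: "Re (v z) = 0" if "\<bar>Im z\<bar> = \<sigma> * pi / 2" for z
  proof -
    have "\<bar>Im z / \<sigma>\<bar> = pi / 2"
      using that \<open>0 < \<sigma>\<close> by (simp add: field_simps)
    then have "Im z / \<sigma> = pi / 2 \<or> Im z / \<sigma> = - (pi / 2)" by linarith
    then have "cos (Im z / \<sigma>) = 0" by (metis cos_minus cos_pi_half)
    then show ?thesis by (simp add: v_def Re_exp)
  qed
  have norm_\<Phi>: "cmod (\<Phi> z) = cmod (g z) * exp (\<sigma> * real n * Re (ln_minorant (v z)))" for z
    by (simp add: \<Phi>_def norm_mult)
  have hol_v: "v holomorphic_on S" for S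
    unfolding v_def using \<open>0 < \<sigma>\<close> by (intro holomorphic_intros) simp
  \<comment> \<open>Chosen so that \<open>m p * x = 2 * C * A\<close>; then the remainder of order
    \<open>p\<close> is at most half of \<open>M q * x ^ q\<close>.\<close>
  define x where "x = 2 * C * A / m p"
  have x: "0 < x" using assms by (simp add: x_def)
  define w where "w = complex_of_real (ln x)"
  have w: "Re w = ln x" "Im w = 0" "w \<in> sector \<gamma>" "\<bar>Im w\<bar> \<le> \<sigma> * pi / 2"
    using assms by (auto simp: w_def sector_iff)
  have "cmod (\<Phi> w) \<le> B"
  proof (rule strip_maximum_principle[where f = \<Phi> and w = w and a = "\<sigma> * pi / 2" and K = "B * exp (\<sigma> * real n)"])
    have "f holomorphic_on {w. \<bar>Im w\<bar> < \<sigma> * pi / 2}"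
      by (rule holomorphic_on_subset[OF holf]) (auto intro: strip)
    then show "\<Phi> holomorphic_on {w. \<bar>Im w\<bar> < \<sigma> * pi / 2}"
      unfolding \<Phi>_def g_def r_eq using Re_v
      by (intro holomorphic_intros holomorphic_on_ln_minorant hol_v) auto
    have "continuous_on {w. \<bar>Im w\<bar> \<le> \<sigma> * pi / 2} f"
      by (rule continuous_on_subset[OF holomorphic_on_imp_continuous_on[OF holf]]) (auto intro: strip)
    then show "continuous_on {w. \<bar>Im w\<bar> \<le> \<sigma> * pi / 2} \<Phi>"
      unfolding \<Phi>_def g_def r_eq using Re_v
      by (intro continuous_intros continuous_on_ln_minorant holomorphic_on_imp_continuous_on[OF hol_v]) auto
  next
    fix z assume z: "\<bar>Im z\<bar> \<le> \<sigma> * pi / 2"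
    have "Re (ln_minorant (v z)) \<le> 1"
      using norm_ln_minorant_le[OF Re_v[OF z]] complex_Re_le_cmod order_trans by blast
    then have "\<sigma> * real n * Re (ln_minorant (v z)) \<le> \<sigma> * real n * 1"
      using \<open>0 < \<sigma>\<close> by (intro mult_left_mono) auto
    then show "cmod (\<Phi> z) \<le> B * exp (\<sigma> * real n)"
      unfolding norm_\<Phi> using g_le[OF strip[OF z]] B by (intro mult_mono) auto
  next
    fix z assume z: "\<bar>Im z\<bar> = \<sigma> * pi / 2"
    then have zs: "z \<in> sector \<gamma>" by (intro strip) simp
    have k: "Re (ln_minorant (v z)) \<le> max 0 (- (Re z + l) / \<sigma>)"
      using Re_ln_minorant_le[OF Re_v0[OF z]] by (simp add: v_def flip: norm_v)
    show "cmod (\<Phi> z) \<le> B"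
    \<comment> \<open>Where \<open>v z\<close> has modulus at most 1, the minorant is at most 0 and
      \<open>g_le\<close> suffices. Otherwise its exponential is at most the inverse of the
      exponential in \<open>g_le'\<close>.\<close>
    proof (cases "0 \<le> Re z + l")
      case True
      then have "- (Re z + l) / \<sigma> \<le> 0"
        using \<open>0 < \<sigma>\<close> by (intro divide_nonpos_pos) auto
      then have "Re (ln_minorant (v z)) \<le> 0" using k by linarith
      then have "cmod (g z) * exp (\<sigma> * real n * Re (ln_minorant (v z))) \<le> B * 1"
        using g_le[OF zs] B \<open>0 < \<sigma>\<close> by (intro mult_mono) (auto simp: mult_nonneg_nonpos)
      then show ?thesis by (simp add: norm_\<Phi>)
    next
      case False
      then have "0 \<le> - (Re z + l) / \<sigma>"
        using \<open>0 < \<sigma>\<close> by (intro divide_nonneg_pos) auto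
      then have "Re (ln_minorant (v z)) \<le> - (Re z + l) / \<sigma>" using k by linarith
      then have "\<sigma> * real n * Re (ln_minorant (v z)) \<le> \<sigma> * real n * (- (Re z + l) / \<sigma>)"
        using \<open>0 < \<sigma>\<close> by (intro mult_left_mono) auto
      also have "\<dots> = - (real n * (Re z + l))" using \<open>0 < \<sigma>\<close> by (simp add: field_simps)
      finally have "cmod (\<Phi> z) \<le> (C * A ^ q * exp (real n * (Re z + l))) * exp (- (real n * (Re z + l)))"
        unfolding norm_\<Phi> using g_le'[OF zs] assms by (intro mult_mono) auto
      also have "\<dots> = C * A ^ q" by (simp add: mult.assoc flip: exp_add)
      finally show ?thesis using B by simp
    qed
  qed (use B w in auto)
  moreover have "1 / 2 \<le> cmod (g w)"
  proof -
    have "cmod (R w) \<le> C * (A ^ p * M p * x ^ p)"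
      unfolding R_eq using bound[OF w(3), of p] x by (simp add: w)
    also have "\<dots> \<le> 1 / 2 * (M q * x ^ q)"
    proof -
      \<comment> \<open>Here \<open>1 \<le> p\<close> enters. The other ingredient is
        \<open>M p * m p ^ p \<le> M (2 * p)\<close>, the reason for the choice
        \<open>q = 2 * p\<close>.\<close>
      have "2 * C \<le> (2 * C) ^ p"
        using q assms self_le_power[of "2 * C" p] by simp
      then have "2 * C * A ^ p \<le> (2 * C) ^ p * A ^ p"
        using assms by (intro mult_right_mono) auto
      also have "\<dots> = m p ^ p * x ^ p"
      proof -
        have "2 * C * A = m p * x" by (simp add: x_def)
        then show ?thesis by (metis power_mult_distrib)
      qed
      finally have "2 * C * A ^ p * (M p * x ^ p) \<le> (m p ^ p * x ^ p) * (M p * x ^ p)"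
        using x by (intro mult_right_mono) auto
      also have "\<dots> = (M p * m p ^ p) * x ^ q"
        unfolding q mult_2 power_add by (simp only: mult_ac)
      also have "\<dots> \<le> M q * x ^ q"
        using M_add_ge[of p p] x by (intro mult_right_mono) (auto simp: q mult_2)
      finally show ?thesis by (simp add: mult_ac)
    qed
    finally have "cmod (R w) \<le> 1 / 2 * (M q * x ^ q)" .
    moreover have "cmod (of_real (M q) * exp w ^ q) = M q * x ^ q"
      using x by (simp add: norm_mult norm_power w)
    ultimately have "1 / 2 * (M q * x ^ q) \<le> cmod (r w)"
      unfolding r_def using norm_triangle_ineq2[of "of_real (M q) * exp w ^ q" "R w"]
      by (simp add: norm_minus_commute)
    then show ?thesis using x by (simp add: norm_g w pos_le_divide_eq)
  qed
  ultimately have "1 / 2 * exp (\<sigma> * real n * Re (ln_minorant (v w))) \<le> B"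
    unfolding norm_\<Phi> by (meson exp_ge_zero mult_right_mono order_trans)
  then have "exp (\<sigma> * real n * Re (ln_minorant (v w))) \<le> 4 * C * A ^ q"
    by (simp add: B_def)
  then have "\<sigma> * real n * Re (ln_minorant (v w)) \<le> ln (4 * C * A ^ q)"
    using assms by (subst ln_ge_iff) auto
  also have "\<dots> = ln (4 * C) + real q * ln A"
    using assms by (simp add: ln_mult ln_realpow)
  finally have upper: "\<sigma> * real n * Re (ln_minorant (v w)) \<le> ln (4 * C) + real q * ln A" .
  \<comment> \<open>\<open>y\<close> is the inverse of \<open>A * m N * x\<close>, so that
    \<open>v w\<close> is \<open>y powr (1 / \<sigma>)\<close>. Monotonicity of \<open>m\<close>
    puts it into the range of \<open>Re_ln_minorant_ge\<close>.\<close>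
  define y where "y = m p / (2 * C * A\<^sup>2 * m N)"
  have y: "0 < y" "y \<le> 1"
  proof -
    show "0 < y" using assms by (simp add: y_def)
    have "1 * m p \<le> (2 * C * A\<^sup>2) * m N"
    proof (rule mult_mono)
      have "1 * 1 \<le> (2 * C) * A\<^sup>2" using assms by (intro mult_mono one_le_power) auto
      then show "1 \<le> 2 * C * A\<^sup>2" by simp
    qed (use q assms in \<open>auto intro: m_mono\<close>)
    then show "y \<le> 1" using assms by (simp add: y_def)
  qed
  have "ln x + l = - ln y"
    using assms x by (simp add: x_def l_def y_def ln_mult ln_div ln_realpow)
  then have "v w = of_real (y powr (1 / \<sigma>))"
    using y by (simp add: v_def w_def powr_def flip: of_real_add of_real_minus of_real_divide exp_of_real)
  then have "y powr (1 / \<sigma>) / 24 \<le> Re (ln_minorant (v w))"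
    using Re_ln_minorant_ge[of "y powr (1 / \<sigma>)"] y assms by (simp add: powr_le1)
  then have "\<sigma> * real n * (y powr (1 / \<sigma>) / 24) \<le> \<sigma> * real n * Re (ln_minorant (v w))"
    using assms by (intro mult_left_mono) auto
  with upper show ?thesis
    by (simp add: y_def n_def)
qed

end

section \<open>Sequences that are not almost increasing, and the bound for the index\<close>

text \<open>For positive sequences finitely many terms do not affect almost monotonicity, so it
  fails beyond every index and for every constant.\<close>

lemma not_almost_increasing_tail:
  assumes pos: "\<And>p. 0 < c p" and not: "\<not> almost_increasing c"
  shows "\<exists>p\<ge>P. \<exists>q\<ge>p. a * c q < c p"
proof (rule ccontr)
  assume "\<not> ?thesis"
  then have le: "c p \<le> a * c q" if "P \<le> p" "p \<le> q" for p q
    using that by (auto simp: not_less)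
  define a' where "a' = max a 1"
  have le': "c p \<le> a' * c q" if "P \<le> p" "p \<le> q" for p q
    by (rule order_trans[OF le[OF that] mult_right_mono]) (auto simp: a'_def less_imp_le[OF pos])
  \<comment> \<open>\<open>R\<close> dominates all quotients of terms up to index \<open>P\<close>.
    A pair with the first index below \<open>P\<close> is compared through \<open>c P\<close>, or
    directly if both lie below.\<close>
  define R where "R = 1 + (\<Sum>i\<le>P. \<Sum>j\<le>P. c i / c j)"
  have "0 \<le> (\<Sum>i\<le>P. \<Sum>j\<le>P. c i / c j)"
    by (intro sum_nonneg divide_nonneg_nonneg less_imp_le[OF pos])
  then have R1: "1 \<le> R" by (simp add: R_def)
  have R: "c i \<le> R * c j" if "i \<le> P" "j \<le> P" for i j
  proof -
    have "c i / c j \<le> (\<Sum>j\<le>P. c i / c j)"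
      by (rule member_le_sum[of j _ "\<lambda>j. c i / c j"]) (use that in \<open>auto intro!: divide_nonneg_nonneg less_imp_le[OF pos]\<close>)
    also have "\<dots> \<le> (\<Sum>i\<le>P. \<Sum>j\<le>P. c i / c j)"
      by (rule member_le_sum[of i _ "\<lambda>i. \<Sum>j\<le>P. c i / c j"])
        (use that in \<open>auto intro!: sum_nonneg divide_nonneg_nonneg less_imp_le[OF pos]\<close>)
    finally have "c i / c j \<le> R" by (simp add: R_def)
    then show ?thesis using pos[of j] by (simp add: pos_divide_le_eq)
  qed
  have a': "1 \<le> a'" by (simp add: a'_def)
  have "c p \<le> R * a' * c q" if "p \<le> q" for p q
  proof -
    consider "P \<le> p" | "p < P" "P \<le> q" | "q < P" using \<open>p \<le> q\<close> by linarith
    then show ?thesis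
    proof cases
      case 1
      then have "c p \<le> 1 * (a' * c q)" using le' that by simp
      also have "\<dots> \<le> R * (a' * c q)"
        using R1 a' pos[of q] by (intro mult_right_mono) auto
      finally show ?thesis by (simp add: mult.assoc)
    next
      case 2
      then have "c p \<le> R * c P" using R by simp
      also have "\<dots> \<le> R * (a' * c q)"
        using R1 le' 2 by (intro mult_left_mono) auto
      finally show ?thesis by (simp add: mult.assoc)
    next
      case 3
      then have "c p \<le> R * (1 * c q)" using R that by simp
      also have "\<dots> \<le> R * (a' * c q)"
        using R1 a' pos[of q] by (intro mult_left_mono mult_right_mono) auto
      finally show ?thesis by (simp add: mult.assoc)
    qed
  qed
  moreover have "0 < R * a'" using R1 a' by simp
  ultimately have "almost_increasing c" unfolding almost_increasing_def by blast
  with not show False by contradiction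
qed

context weight_seq
begin

definition scaled :: "real \<Rightarrow> nat \<Rightarrow> real" where
  "scaled \<sigma> p = m p / real (p + 1) powr \<sigma>"

lemma scaled_pos: "0 < scaled \<sigma> p"
  by (simp add: scaled_def)

text \<open>As \<open>m p \<le> m N\<close>, a drop by more than \<open>4 powr \<sigma>\<close> can
  only come from the denominators. It provides room for \<open>q = 2 * p\<close> below
  \<open>N\<close> with \<open>N - q\<close> at least \<open>(N + 1) / 2\<close>.\<close>

lemma scaled_index_bound:
  assumes "0 < \<sigma>" "p \<le> N" "4 powr \<sigma> * scaled \<sigma> N < scaled \<sigma> p"
  shows "4 * (p + 1) < N + 1"
proof (rule ccontr)
  assume "\<not> ?thesis"
  then have "real (N + 1) \<le> 4 * real (p + 1)" by linarith
  then have "real (N + 1) powr \<sigma> \<le> (4 * real (p + 1)) powr \<sigma>"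
    using assms by (intro powr_mono2) auto
  then have "real (N + 1) powr \<sigma> \<le> 4 powr \<sigma> * real (p + 1) powr \<sigma>"
    by (subst (asm) powr_mult) auto
  then have "m p * real (N + 1) powr \<sigma> \<le> m N * (4 powr \<sigma> * real (p + 1) powr \<sigma>)"
    using m_mono[OF assms(2)] by (intro mult_mono) auto
  then have "scaled \<sigma> p \<le> 4 powr \<sigma> * scaled \<sigma> N"
    by (simp add: scaled_def field_simps)
  with assms(3) show False by simp
qed

lemma surjective_imp_almost_increasing:
  assumes "0 < \<sigma>" "\<sigma> < \<gamma>" and surj: "borel_surjective_u M (sector \<gamma>)"
  shows "almost_increasing (scaled \<sigma>)"
proof (rule ccontr)
  assume not: "\<not> almost_increasing (scaled \<sigma>)"
  \<comment> \<open>The summand \<open>i\<close> makes the drops unbounded; the summand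
    \<open>4 powr \<sigma>\<close> makes \<open>scaled_index_bound\<close> available for every
    pair.\<close>
  define P where "P i x \<longleftrightarrow> 1 \<le> fst x \<and> fst x \<le> snd x \<and>
    (real i + 4 powr \<sigma>) * scaled \<sigma> (snd x) < scaled \<sigma> (fst x)" for i and x :: "nat \<times> nat"
  have "\<exists>x. P 0 x"
    using not_almost_increasing_tail[OF scaled_pos not, of 1 "real 0 + 4 powr \<sigma>"] by (auto simp: P_def)
  moreover have "\<exists>y. P (Suc i) y \<and> snd x < fst y" for i x
  proof -
    obtain p q where "Suc (snd x) \<le> p" "p \<le> q" "(real (Suc i) + 4 powr \<sigma>) * scaled \<sigma> q < scaled \<sigma> p"
      using not_almost_increasing_tail[OF scaled_pos not] by metis
    then have "P (Suc i) (p, q) \<and> snd x < fst (p, q)" by (simp add: P_def)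
    then show ?thesis by blast
  qed
  ultimately obtain s where s: "\<And>i. P i (s i)" "\<And>i. snd (s i) < fst (s (Suc i))"
    using dependent_nat_choice[of P "\<lambda>i x y. snd x < fst y"] by blast
  define p where "p i = fst (s i)" for i
  define N where "N i = snd (s i)" for i
  have pN: "1 \<le> p i" "p i \<le> N i" "(real i + 4 powr \<sigma>) * scaled \<sigma> (N i) < scaled \<sigma> (p i)"
    "N i < p (Suc i)" for i
    using s[of i] by (auto simp: P_def p_def N_def)
  have "strict_mono N"
    by (rule strict_monoI_Suc) (meson pN le_trans less_le_trans)
  have Np: "N i < p j" if "i < j" for i j
  proof -
    obtain k where j: "j = Suc k" using \<open>i < j\<close> by (cases j) auto
    have "N i \<le> N k"
      using that \<open>strict_mono N\<close> by (auto simp: j strict_mono_less_eq)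
    then show ?thesis using pN(4)[of k] by (simp add: j)
  qed
  have large: "4 * (p i + 1) < N i + 1" for i
  proof (rule scaled_index_bound[OF assms(1) pN(2)])
    have "4 powr \<sigma> * scaled \<sigma> (N i) \<le> (real i + 4 powr \<sigma>) * scaled \<sigma> (N i)"
      using scaled_pos by (intro mult_right_mono) (auto intro: less_imp_le)
    then show "4 powr \<sigma> * scaled \<sigma> (N i) < scaled \<sigma> (p i)"
      using pN(3)[of i] by simp
  qed
  define F where "F = Abs_fps (\<lambda>k. if k \<in> range (\<lambda>i. 2 * p i) then complex_of_real (M k) else 0)"
  have "F \<in> series_class M 1"
    by (rule series_classI[where C = 1]) (auto simp: F_def)
  then have "F \<in> series_union M" by (auto simp: series_union_def intro!: bexI[of _ 1])
  moreover have "0 < \<gamma>" using assms by simp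
  ultimately obtain A0 f where f: "0 < A0" "f holomorphic_on sector \<gamma>"
    "has_unif_expansion M A0 (sector \<gamma>) f F"
    using borel_surjective_uE surj by metis
  then obtain C0 where C0: "0 \<le> C0" "\<And>z n. z \<in> sector \<gamma> \<Longrightarrow>
      cmod (f z - (\<Sum>k<n. fps_nth F k * exp z ^ k)) \<le> C0 * (A0 ^ n * M n * exp (Re z) ^ n)"
    using has_unif_expansionD[OF f(3,1)] by metis
  define A where "A = max 1 A0"
  define C where "C = max 1 C0"
  have A: "1 \<le> A" and C: "1 \<le> C" by (auto simp: A_def C_def)
  have bound: "cmod (f z - (\<Sum>k<n. fps_nth F k * exp z ^ k)) \<le> C * (A ^ n * M n * exp (Re z) ^ n)"
    if "z \<in> sector \<gamma>" for z n
    using f(1) C0(1)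
    by (intro order_trans[OF C0(2)[OF that]] mult_mono power_mono)
      (auto simp: A_def C_def intro!: mult_nonneg_nonneg)
  define K where "K = ln (4 * C) + 2 * ln A"
  have K: "0 \<le> ln (4 * C)" "0 \<le> ln A" using A C by auto
  \<comment> \<open>The bound obtained for \<open>(N + 1) / (p + 1)\<close> times the power of
    exponent \<open>1 / \<sigma>\<close> of \<open>m p / m N\<close>; 48 is the 24 of
    \<open>Re_ln_minorant_ge\<close> times the 2 from
    \<open>N - q \<ge> (N + 1) / 2\<close>.\<close>
  define K' where "K' = 48 * K * (2 * C * A\<^sup>2) powr (1 / \<sigma>) / \<sigma>"
  have "real i \<le> K' powr \<sigma>" for i
  proof -
    define q where "q = 2 * p i"
    have "q < N i" using large[of i] by (simp add: q_def)
    \<comment> \<open>Exponents of earlier pairs lie below \<open>p i\<close>, because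
      \<open>4 * (p j + 1) < N j + 1 \<le> p i\<close>; those of later pairs lie above
      \<open>N i\<close>.\<close>
    have zero: "fps_nth F k = 0" if k: "p i \<le> k" "k < N i" "k \<noteq> q" for k
    proof -
      have "k \<noteq> 2 * p j" for j
      proof -
        consider "j < i" | "j = i" | "i < j" by linarith
        then show ?thesis
        proof cases
          case 1
          have "2 * p j \<le> 4 * (p j + 1)" by simp
          also have "\<dots> < N j + 1" by (rule large)
          also have "\<dots> \<le> p i" using Np[OF 1] by simp
          also have "\<dots> \<le> k" by (rule k)
          finally have "2 * p j < k" .
          then show ?thesis by simp
        next
          case 3
          have "k < p j" using k(2) Np[OF 3] by (rule less_trans)
          then have "k < 2 * p j" by simp
          then show ?thesis by simp
        qed (use k q_def in auto)
      qed
      then show ?thesis by (auto simp: F_def)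
    qed
    have "\<sigma> * real (N i - q) * ((m (p i) / (2 * C * A\<^sup>2 * m (N i))) powr (1 / \<sigma>) / 24) \<le> ln (4 * C) + real q * ln A"
    proof (rule lacunary_estimate[OF assms(1,2) C A f(2) bound q_def pN(1) \<open>q < N i\<close>])
      show "fps_nth F k = 0" if "p i \<le> k" "k < q" for k
        using zero[of k] that \<open>q < N i\<close> by simp
      show "fps_nth F k = 0" if "q < k" "k < N i" for k
        using zero[of k] that by (simp add: q_def)
      show "fps_nth F q = of_real (M q)" by (auto simp: F_def q_def)
    qed
    also have "\<dots> \<le> K * real (p i)"
    proof -
      have "ln (4 * C) * 1 \<le> ln (4 * C) * real (p i)"
        using K pN(1)[of i] by (intro mult_left_mono) auto
      then show ?thesis by (simp add: K_def q_def algebra_simps)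
    qed
    also have "\<dots> \<le> K * real (p i + 1)" using K by (intro mult_left_mono) (auto simp: K_def)
    finally have 1: "\<sigma> * real (N i - q) * ((m (p i) / (2 * C * A\<^sup>2 * m (N i))) powr (1 / \<sigma>) / 24) \<le> K * real (p i + 1)" .
    define y where "y = (m (p i) / m (N i)) powr (1 / \<sigma>)"
    define L where "L = (2 * C * A\<^sup>2) powr (1 / \<sigma>)"
    have "0 < L" using A C by (simp add: L_def)
    have "(m (p i) / (2 * C * A\<^sup>2 * m (N i))) powr (1 / \<sigma>) = (m (p i) / m (N i) / (2 * C * A\<^sup>2)) powr (1 / \<sigma>)"
      by (simp add: mult_ac)
    also have "\<dots> = y / L"
      unfolding y_def L_def by (rule powr_divide)
    finally have yL: "(m (p i) / (2 * C * A\<^sup>2 * m (N i))) powr (1 / \<sigma>) = y / L" .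
    have "\<sigma> * (real (N i + 1) / 2) * (y / L / 24) \<le> \<sigma> * real (N i - q) * (y / L / 24)"
      using large[of i] assms(1) \<open>q < N i\<close> \<open>0 < L\<close>
      by (intro mult_right_mono mult_left_mono) (auto simp: q_def y_def)
    with 1 have "\<sigma> * (real (N i + 1) / 2) * (y / L / 24) \<le> K * real (p i + 1)"
      by (simp add: yL)
    then have "real (N i + 1) / real (p i + 1) * y \<le> K'"
      unfolding K'_def L_def[symmetric] using assms(1) \<open>0 < L\<close> by (simp add: field_simps)
    moreover have "real (N i + 1) / real (p i + 1) * y = (scaled \<sigma> (p i) / scaled \<sigma> (N i)) powr (1 / \<sigma>)"
    proof -
      have eq: "scaled \<sigma> (p i) / scaled \<sigma> (N i) = (real (N i + 1) / real (p i + 1)) powr \<sigma> * (m (p i) / m (N i))"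
        by (subst powr_divide) (auto simp: scaled_def)
      have key: "(R powr \<sigma> * r) powr (1 / \<sigma>) = R * r powr (1 / \<sigma>)" if "0 < R" for R r
        unfolding powr_mult powr_powr using assms(1) that by simp
      show ?thesis unfolding eq y_def by (rule key[symmetric]) simp
    qed
    ultimately have "((scaled \<sigma> (p i) / scaled \<sigma> (N i)) powr (1 / \<sigma>)) powr \<sigma> \<le> K' powr \<sigma>"
      using assms(1) by (intro powr_mono2) auto
    then have "scaled \<sigma> (p i) / scaled \<sigma> (N i) \<le> K' powr \<sigma>"
      using assms(1) scaled_pos[of \<sigma>] by (simp add: powr_powr less_imp_le)
    moreover have "real i + 4 powr \<sigma> < scaled \<sigma> (p i) / scaled \<sigma> (N i)"
      using pN(3)[of i] scaled_pos by (simp add: pos_less_divide_eq)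
    moreover have "0 \<le> (4::real) powr \<sigma>" by simp
    ultimately show ?thesis by linarith
  qed
  then show False
    using reals_Archimedean2[of "K' powr \<sigma>"] by (meson not_less)
qed

end

section \<open>The chain of implications\<close>

theorem theorem3p12:
  fixes M :: "nat \<Rightarrow> real" and \<gamma> :: real
  assumes "weight_sequence M" and "cond_dc M" and "0 < gamma_index M" and "0 < \<gamma>"
  shows
    "(ennreal \<gamma> < gamma_index M \<longrightarrow>
        (\<exists>G\<in>Au_union M (sector \<gamma>). optimal_flat M (sector \<gamma>) G)) \<and>
     ((\<exists>G\<in>Au_union M (sector \<gamma>). optimal_flat M (sector \<gamma>) G) \<longrightarrow>
        has_extension_operators M (sector \<gamma>)) \<and>
     (has_extension_operators M (sector \<gamma>) \<longrightarrow> borel_surjective_u M (sector \<gamma>)) \<and>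
     (borel_surjective_u M (sector \<gamma>) \<longleftrightarrow> {0<..\<gamma>} \<subseteq> surj_interval_u M) \<and>
     (borel_surjective_u M (sector \<gamma>) \<longrightarrow> {0<..<\<gamma>} \<subseteq> surj_interval_hat M) \<and>
     ({0<..<\<gamma>} \<subseteq> surj_interval_hat M \<longrightarrow> ennreal \<gamma> \<le> gamma_index M)"
proof -
  interpret weight_seq M using assms(1) by unfold_locales
  have index: "(M (p + 1) / M p) / real (p + 1) powr \<sigma> = scaled \<sigma> p" for \<sigma> p
    by (simp add: scaled_def m_def)
  have i_ii: "\<exists>G\<in>Au_union M (sector \<gamma>). optimal_flat M (sector \<gamma>) G" if less: "ennreal \<gamma> < gamma_index M"
  proof -
    obtain \<sigma> where "almost_increasing (scaled \<sigma>)" "ennreal \<gamma> < ennreal \<sigma>"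
      using less unfolding gamma_index_def less_SUP_iff index by blast
    then show ?thesis
      using optimal_flat_exists[of \<gamma> \<sigma>] assms(4) by (simp add: ennreal_less_iff scaled_def[abs_def])
  qed
  have v_vi: "ennreal \<gamma> \<le> gamma_index M" if sub: "{0<..<\<gamma>} \<subseteq> surj_interval_hat M"
  proof (rule ccontr)
    assume "\<not> ?thesis"
    then obtain z where z: "gamma_index M < z" "z < ennreal \<gamma>"
      using dense by (auto simp: not_le)
    then obtain \<sigma> where \<sigma>: "z = ennreal \<sigma>" "0 \<le> \<sigma>"
      by (cases z) auto
    \<comment> \<open>Positivity of \<open>\<sigma>\<close> comes from
      \<open>0 < gamma_index M\<close>.\<close>
    then have "0 < \<sigma>" "\<sigma> < \<gamma>"
      using z assms(3) by (auto simp: ennreal_less_iff intro: ccontr)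
    \<comment> \<open>A second opening strictly between: surjectivity on
      \<open>sector \<tau>\<close> yields almost monotonicity only for exponents strictly below
      \<open>\<tau>\<close>.\<close>
    define \<tau> where "\<tau> = (\<sigma> + \<gamma>) / 2"
    have \<tau>: "\<sigma> < \<tau>" "0 < \<tau>" "\<tau> < \<gamma>"
      using \<open>0 < \<sigma>\<close> \<open>\<sigma> < \<gamma>\<close> by (auto simp: \<tau>_def)
    then have "borel_surjective_hat M (sector \<tau>)"
      using sub by (auto simp: surj_interval_hat_def)
    then have "almost_increasing (scaled \<sigma>)"
      by (intro surjective_imp_almost_increasing[OF \<open>0 < \<sigma>\<close> \<tau>(1)] surjective_hat_imp_u[OF \<tau>(2)])
    then have "ennreal \<sigma> \<le> gamma_index M"
      unfolding gamma_index_def index using \<open>0 < \<sigma>\<close> by (intro SUP_upper) simp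
    with z(1) \<sigma>(1) show False by simp
  qed
  have iv_v: "{0<..<\<gamma>} \<subseteq> surj_interval_hat M" if "borel_surjective_u M (sector \<gamma>)"
    using surjective_u_imp_hat[OF _ _ that] by (auto simp: surj_interval_hat_def)
  show ?thesis
    using i_ii optimal_flat_imp_extension_operators[OF assms(4,2)]
      extension_operators_imp_surjective[OF assms(4)] borel_surjective_u_iff[OF assms(4)] iv_v v_vi
    by blast
qed

end
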